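(* Fix $0<s<2$. There exists a constant $C_*$ (depending only on $s$) such that the following two statements hold. (1) Let $\Omega:S^2\to\mathbb{R}$ be smooth, strictly positive, even ($\Omega(\bar{\mathbf{x}})=\Omega(-\bar{\mathbf{x}})$) and axisymmetric with respect to the $x_3$-axis, so that $\Omega=\Omega(\theta)$. If the minimum of $\Omega$ is achieved at $\theta=\frac\pi2$ with $\Omega(\frac\pi2)=1$, and $$\Omega(\theta)\ge 1+C_*\Big|\theta-\frac\pi2\Big|^2,\quad\forall\,\theta\in[0,\pi/2],$$ then $\rho_{2D}$ is the unique energy minimizer (up to translation) for $W(\mathbf{x})=|\mathbf{x}|^{-s}\Omega(\bar{\mathbf{x}})+|\mathbf{x}|^2$. (2) Let $\omega:S^2\to\mathbb{R}$ be smooth with $\min\omega=0$, even ($\omega(\bar{\mathbf{x}})=\omega(-\bar{\mathbf{x}})$) and axisymmetric with respect to the $x_3$-axis, so that $\omega=\omega(\theta)$. Suppose $\omega$ achieves its minimum at $\theta=\frac\pi2$, $\omega(\frac\pi2)=0$, and there is $c_\omega>0$ with $$\omega(\theta)\ge c_\omega\Big|\theta-\frac\pi2\Big|^2,\quad\forall\,\theta\in[0,\pi/2].$$ Then there exists a unique $\alpha_*$ with $0<\alpha_*\le C_*/c_\omega$ such that, with $W_\alpha(\mathbf{x})=|\mathbf{x}|^{-s}(1+\alpha\omega(\bar{\mathbf{x}}))+|\mathbf{x}|^2$: for any $\alpha>\alpha_*$, $\rho_{2D}$ is the unique energy minimizer (up to translation) for $W_\alpha$; and for any $0\le\alpha<\alpha_*$,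 $\rho_{2D}$ is not an energy minimizer for $W_\alpha$.
   Context: For $\mathbf{x}\in\mathbb{R}^3\setminus\{0\}$, $\bar{\mathbf{x}}=\mathbf{x}/|\mathbf{x}|=(\sin\theta\cos\mu,\sin\theta\sin\mu,\cos\theta)\in S^2$ with $0\le\theta\le\pi$, $0\le\mu<2\pi$. An axisymmetric function on $S^2$ is regarded as a function of $\theta$. The energy of a probability measure $\rho$ on $\mathbb{R}^3$ for a potential $W$ is $E[\rho]=\frac12\int\int W(\mathbf{x}-\mathbf{y})\,\rho(\mathbf{y})\,d\mathbf{y}\,\rho(\mathbf{x})\,d\mathbf{x}$; an energy minimizer is a minimizer over all probability measures on $\mathbb{R}^3$. For $0<s<2$, let $\rho_2(\mathbf{z})=C_2(R_2^2-|\mathbf{z}|^2)_+^{s/2}$ on $\mathbb{R}^2$, with $C_2=\frac{4\sin\frac{s\pi}{2}}{s^2\pi^2}$ and $R_2=\Big(\frac{8\sin\frac{s\pi}{2}}{s^2(2+s)\pi}\Big)^{-1/(s+2)}$; it is the probability density on $\mathbb{R}^2$ minimizing the energy with potential $|\mathbf{z}|^{-s}+|\mathbf{z}|^2$. Define the probability measure on $\mathbb{R}^3$ $\rho_{2D}(\mathbf{x})=\delta(x_3)\rho_2(x_1,x_2)$, with $\delta$ the Dirac delta. *)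

theory Defs
  imports "HOL-Probability.Probability"
begin

section \<open>Smooth, even and axisymmetric functions on the unit sphere\<close>

text \<open>
  Only meaningful for open \<open>U\<close>: all partial derivatives of order at most \<open>k\<close> exist and are
  continuous on \<open>U\<close>.
\<close>

primrec Ck_on :: "nat \<Rightarrow> 'a::euclidean_space set \<Rightarrow> ('a \<Rightarrow> 'b::real_normed_vector) \<Rightarrow> bool" where
  "Ck_on 0 U f \<longleftrightarrow> continuous_on U f"
| "Ck_on (Suc k) U f \<longleftrightarrow>
     (\<forall>x\<in>U. f differentiable (at x)) \<and>
     (\<forall>b\<in>Basis. Ck_on k U (\<lambda>x. frechet_derivative f (at x) b))"

text \<open>
  A function on a subset \<open>S\<close> of a Euclidean space is smooth if near every point of \<open>S\<close> it is the
  restriction of a \<open>C\<close>-infinity function on an open set. The values of \<open>f\<close> off \<open>S\<close> play no role.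
\<close>

definition smooth_on_set :: "'a::euclidean_space set \<Rightarrow> ('a \<Rightarrow> 'b::real_normed_vector) \<Rightarrow> bool" where
  "smooth_on_set S f \<longleftrightarrow>
     (\<forall>x\<in>S. \<exists>U g. open U \<and> x \<in> U \<and> (\<forall>k. Ck_on k U g) \<and> (\<forall>y\<in>S \<inter> U. g y = f y))"

abbreviation S2 :: "(real^3) set" where
  "S2 \<equiv> sphere 0 1"

definition even_on_S2 :: "(real^3 \<Rightarrow> real) \<Rightarrow> bool" where
  "even_on_S2 f \<longleftrightarrow> (\<forall>x\<in>S2. f (- x) = f x)"

definition sph :: "real \<Rightarrow> real \<Rightarrow> real^3" where
  "sph \<theta> \<mu> = vector [sin \<theta> * cos \<mu>, sin \<theta> * sin \<mu>, cos \<theta>]"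

definition axisymmetric :: "(real^3 \<Rightarrow> real) \<Rightarrow> bool" where
  "axisymmetric f \<longleftrightarrow>
     (\<forall>\<theta>\<in>{0..pi}. \<forall>\<mu>\<in>{0..<2*pi}. \<forall>\<mu>'\<in>{0..<2*pi}. f (sph \<theta> \<mu>) = f (sph \<theta> \<mu>'))"

text \<open>An axisymmetric function regarded as a function of the polar angle.\<close>

definition profile :: "(real^3 \<Rightarrow> real) \<Rightarrow> real \<Rightarrow> real" where
  "profile f \<theta> = f (sph \<theta> 0)"


section \<open>Interaction energy\<close>

text \<open>
  The potential \<open>|x|\<^sup>-\<^sup>s \<Omega>(x/|x|) + |x|\<^sup>2\<close>. It is used only with \<open>\<Omega> > 0\<close> on the sphere, so that
  \<open>ennreal\<close> truncates nothing. The singularity at the origin has value \<open>+\<infinity>\<close> (the lower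
  semicontinuous extension); in HOL \<open>0 powr (-s) = 0\<close>, which would give a Dirac mass zero energy.
\<close>

definition potential :: "real \<Rightarrow> (real^3 \<Rightarrow> real) \<Rightarrow> real^3 \<Rightarrow> ennreal" where
  "potential s \<Omega> x =
     (if x = 0 then \<infinity>
      else ennreal (norm x powr (- s) * \<Omega> (x /\<^sub>R norm x) + (norm x)\<^sup>2))"

definition energy :: "(real^3 \<Rightarrow> ennreal) \<Rightarrow> (real^3) measure \<Rightarrow> ennreal" where
  "energy W \<rho> = 1 / 2 * (\<integral>\<^sup>+ x. (\<integral>\<^sup>+ y. W (x - y) \<partial>\<rho>) \<partial>\<rho>)"

definition borel_prob :: "(real^3) measure set" where
  "borel_prob = {\<rho>. prob_space \<rho> \<and> sets \<rho> = sets borel}"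

definition energy_minimizer :: "(real^3 \<Rightarrow> ennreal) \<Rightarrow> (real^3) measure \<Rightarrow> bool" where
  "energy_minimizer W \<rho> \<longleftrightarrow>
     \<rho> \<in> borel_prob \<and> (\<forall>\<sigma>\<in>borel_prob. energy W \<rho> \<le> energy W \<sigma>)"

definition unique_energy_minimizer :: "(real^3 \<Rightarrow> ennreal) \<Rightarrow> (real^3) measure \<Rightarrow> bool" where
  "unique_energy_minimizer W \<rho> \<longleftrightarrow>
     energy_minimizer W \<rho> \<and>
     (\<forall>\<sigma>. energy_minimizer W \<sigma> \<longrightarrow> (\<exists>a. \<sigma> = distr \<rho> borel (\<lambda>x. x + a)))"


section \<open>The planar minimizer\<close>

definition C2 :: "real \<Rightarrow> real" where
  "C2 s = 4 * sin (s * pi / 2) / (s\<^sup>2 * pi\<^sup>2)"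

definition R2 :: "real \<Rightarrow> real" where
  "R2 s = (8 * sin (s * pi / 2) / (s\<^sup>2 * (2 + s) * pi)) powr (- 1 / (s + 2))"

definition rho2 :: "real \<Rightarrow> real^2 \<Rightarrow> real" where
  "rho2 s z = C2 s * (max 0 ((R2 s)\<^sup>2 - (norm z)\<^sup>2)) powr (s / 2)"

text \<open>
  \<open>\<delta>(x\<^sub>3) \<rho>\<^sub>2(x\<^sub>1, x\<^sub>2)\<close> is the image of the planar measure with density \<open>\<rho>\<^sub>2\<close> under the inclusion
  of the plane \<open>x\<^sub>3 = 0\<close>.
\<close>

definition rho2D :: "real \<Rightarrow> (real^3) measure" where
  "rho2D s = distr (density lborel (\<lambda>z::real^2. ennreal (rho2 s z))) borel
                   (\<lambda>z. vector [z $ 1, z $ 2, 0])"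

end

theory Submission
  imports Defs
begin

text \<open>
  The three-dimensional problem is reduced to the planar one by averaging over projections. For
  \<open>b\<close> in the plane, the map \<open>tilt b\<close>, \<open>(z, h) \<mapsto> z + h b\<close>, projects space onto the plane
  \<open>x\<^sub>3 = 0\<close> along a line and fixes that plane pointwise. Let \<open>W\<close> be the planar potential
  \<open>|z|\<^sup>-\<^sup>s + |z|\<^sup>2\<close> and \<open>\<mu>\<close> the measure with density \<open>\<rho>\<^sub>2\<close>. For every probability measure \<open>\<sigma>\<close> on space,
  the energy of \<open>\<sigma>\<close> for \<open>W \<circ> tilt b\<close> is the planar energy of a projection of \<open>\<sigma>\<close>, so it is at
  least the planar energy of \<open>\<mu>\<close>, and \<open>\<rho>\<^sub>2\<^sub>D\<close> attains this bound for all \<open>b\<close> at once. Hence \<open>\<rho>\<^sub>2\<^sub>D\<close> also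
  minimizes the energy for any average \<open>W\<^sub>*\<close> of these potentials over \<open>b\<close>
  (\<open>tilted_kernel_energy_ge\<close>). Since \<open>s < 2\<close>, averaging over small \<open>b\<close> makes the singularity of
  \<open>W \<circ> tilt b\<close> along a line integrable, and the first-order term in \<open>h\<close> cancels by symmetry;
  therefore \<open>W\<^sub>*\<close> is at most \<open>|x|\<^sup>-\<^sup>s (1 + C x\<^sub>3\<^sup>2 / |x|\<^sup>2) + |x|\<^sup>2\<close>, with strict inequality off the plane
  (\<open>tilted_kernel_le\<close>). A potential that dominates \<open>W\<^sub>*\<close>, strictly off the plane and with equality on
  it, has \<open>\<rho>\<^sub>2\<^sub>D\<close> as its unique minimizer: a competitor of equal energy must lie in one horizontal
  plane, where the planar uniqueness applies (\<open>collapse_by_comparison\<close>). This is statement (1).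

  That \<open>\<mu>\<close> is the unique planar minimizer (\<open>planar_min_optimal\<close>) rests on two facts. Positive
  definiteness of the Riesz energy comes from writing \<open>|z|\<^sup>-\<^sup>s\<close> as a mixture of Gaussians, each the
  convolution of two Gaussians (\<open>mutual_energy_positive_definite\<close>). The Euler--Lagrange conditions
  follow from the layer-cake formula: with \<open>s = 2 g\<close>, the potential of \<open>(R\<^sup>2 - |w|\<^sup>2)\<^sub>+\<^sup>g\<close> at \<open>z\<close> is
  the integral of the \<open>g\<close>-th power of \<open>(R\<^sup>2 - |w|\<^sup>2)\<^sub>+ / |z - w|\<^sup>2\<close> over \<open>w\<close>, and all superlevel sets of
  this quotient are discs (\<open>superlevel_set_is_disc\<close>), so the potential becomes an
  explicit one-dimensional integral, for \<open>z\<close> inside and outside the disc alike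
  (\<open>disc_potential_bounds\<close>).

  For statement (2), the comparison argument shows that once \<open>\<rho>\<^sub>2\<^sub>D\<close> is a minimizer for some \<open>\<alpha>\<close> it is
  the unique one for every larger parameter (\<open>collapse_monotone\<close>), so \<open>\<alpha>\<^sub>*\<close> is the infimum of
  the parameters for which \<open>\<rho>\<^sub>2\<^sub>D\<close> is a minimizer. The bound \<open>\<alpha>\<^sub>* \<le> C\<^sub>* / c\<^sub>\<omega>\<close> is statement (1), and
  \<open>\<alpha>\<^sub>* > 0\<close> because at small \<open>\<alpha>\<close> it pays to split the layer: moving half of the mass up by \<open>H\<close> gains
  about \<open>H\<^bsup>2 - s\<^esup>\<close> in repulsion and costs only about \<open>H\<^sup>2\<close> in confinement
  (\<open>not_minimizer_for_small_anisotropy\<close>).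
\<close>

section \<open>Gamma integrals and Gaussian mixtures\<close>

text \<open>
  The value \<open>\<infinity>\<close> at the origin agrees with the Gaussian mixture below, which diverges there.
\<close>
definition riesz :: "real \<Rightarrow> 'a::real_normed_vector \<Rightarrow> ennreal" where
  "riesz s z = (if z = 0 then \<infinity> else ennreal (norm z powr (- s)))"

lemma riesz_measurable [measurable]: "riesz s \<in> borel_measurable borel"
  unfolding riesz_def by measurable

lemma nn_integral_powr_exp:
  fixes a c :: real
  assumes "0 < a" "0 < c"
  shows "(\<integral>\<^sup>+t. ennreal (t powr (a - 1) * exp (- (c * t))) * indicator {0<..} t \<partial>lborel)
         = ennreal (Gamma a * c powr (- a))"
proof -
  let ?f = "\<lambda>t::real. ennreal (indicator {0..} t * t powr (a - 1) / exp t)"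
  have "ennreal (Gamma a) = (\<integral>\<^sup>+t. ?f t \<partial>lborel)"
    using Gamma_conv_nn_integral_real[OF assms(1)] by simp
  also have "\<dots> = ennreal \<bar>c\<bar> * (\<integral>\<^sup>+t. ?f (0 + c * t) \<partial>lborel)"
    using assms by (intro nn_integral_real_affine) auto
  also have "(\<integral>\<^sup>+t. ?f (0 + c * t) \<partial>lborel)
     = (\<integral>\<^sup>+t. ennreal (c powr (a - 1)) * (ennreal (t powr (a - 1) * exp (- (c * t))) * indicator {0<..} t) \<partial>lborel)"
    using assms
    by (intro nn_integral_cong)
       (auto simp: indicator_def powr_mult exp_minus field_simps zero_le_mult_iff ennreal_mult[symmetric])
  also have "\<dots> = ennreal (c powr (a - 1)) * (\<integral>\<^sup>+t. (ennreal (t powr (a - 1) * exp (- (c * t))) * indicator {0<..} t) \<partial>lborel)"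
    by (rule nn_integral_cmult) measurable
  finally have *: "ennreal (Gamma a) = ennreal (c powr a) * (\<integral>\<^sup>+t. (ennreal (t powr (a - 1) * exp (- (c * t))) * indicator {0<..} t) \<partial>lborel)"
    using assms by (simp add: mult.assoc[symmetric] ennreal_mult[symmetric] powr_diff)
  have "ennreal (Gamma a * c powr (- a)) = ennreal (c powr (- a)) * ennreal (Gamma a)"
    using assms by (simp add: ennreal_mult Gamma_real_pos less_imp_le mult.commute)
  also have "\<dots> = (ennreal (c powr (- a)) * ennreal (c powr a)) * (\<integral>\<^sup>+t. (ennreal (t powr (a - 1) * exp (- (c * t))) * indicator {0<..} t) \<partial>lborel)"
    unfolding * by (simp only: mult.assoc)
  also have "ennreal (c powr (- a)) * ennreal (c powr a) = 1"
    using assms by (simp add: ennreal_mult[symmetric] powr_add[symmetric])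
  finally show ?thesis by simp
qed

text \<open>
  The scaled Gamma integrals \<open>\<Gamma>(a) c\<^sup>-\<^sup>a\<close> bound this integral from below, and they are unbounded as
  \<open>c\<close> tends to \<open>0\<close>.
\<close>
lemma nn_integral_powr_infinite:
  fixes a :: real
  assumes "0 < a"
  shows "(\<integral>\<^sup>+t. ennreal (t powr (a - 1)) * indicator {0<..} t \<partial>lborel) = \<infinity>" (is "?I = _")
proof (rule ccontr)
  assume "?I \<noteq> \<infinity>"
  then obtain r where r: "0 \<le> r" "?I = ennreal r"
    by (cases ?I) auto
  have G: "0 < Gamma a" using assms by (rule Gamma_real_pos)
  \<comment> \<open>chosen such that \<open>\<Gamma>(a) c\<^sup>-\<^sup>a = r + 1\<close>\<close>
  define c where "c = (Gamma a / (r + 1)) powr (1 / a)"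
  have c: "0 < c" "c powr (- a) = (r + 1) / Gamma a"
    using r(1) assms less_imp_neq[OF G] G by (auto simp: c_def powr_powr powr_minus simp del: Gamma_real_pos)
  have "ennreal (Gamma a * c powr (- a)) \<le> ?I"
    unfolding nn_integral_powr_exp[OF assms c(1), symmetric]
    using c(1) by (intro nn_integral_mono) (auto simp: indicator_def intro!: ennreal_leI mult_left_le)
  then show False
    unfolding r(2) c(2) using G r(1) by simp
qed

text \<open>
  A change of scale in the Gamma integral exhibits the Riesz kernel as a positive mixture of
  Gaussians; at the origin both sides are infinite.
\<close>
lemma riesz_gaussian_mixture:
  assumes "0 < s"
  shows "(\<integral>\<^sup>+t. ennreal (t powr (s / 2 - 1) * exp (- ((norm z)\<^sup>2 * t))) * indicator {0<..} t \<partial>lborel)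
         = ennreal (Gamma (s / 2)) * riesz s z"
proof (cases "z = 0")
  case True
  have "0 < Gamma (s/2)" using assms by (intro Gamma_real_pos) simp
  then show ?thesis
    using True nn_integral_powr_infinite[of "s / 2"] assms
    less_imp_neq[OF \<open>0 < Gamma (s/2)\<close>]
    by (simp add: riesz_def ennreal_mult_top del: Gamma_real_pos)
next
  case False
  then have n: "0 < (norm z)\<^sup>2" by simp
  have "((norm z)\<^sup>2) powr (- (s / 2)) = norm z powr (- s)"
    using False by (simp add: powr_numeral[symmetric] powr_powr del: powr_numeral)
  then show ?thesis
    using nn_integral_powr_exp[of "s / 2", OF _ n] assms False
    by (simp add: riesz_def ennreal_mult' Gamma_real_pos less_imp_le)
qed

text \<open>
  Replacing \<open>(1 + t) powr (- (a + b))\<close> by its own Gamma integral and exchanging the order of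
  integration leaves a product of two Gamma integrals.
\<close>
lemma nn_integral_Beta_halfline:
  fixes a b :: real
  assumes "0 < a" "0 < b"
  shows "(\<integral>\<^sup>+t. ennreal (t powr (a - 1) * (1 + t) powr (- (a + b))) * indicator {0<..} t \<partial>lborel)
         = ennreal (Gamma a * Gamma b / Gamma (a + b))" (is "?I = _")
proof -
  let ?g = "\<lambda>t x::real. ennreal (t powr (a - 1)) * indicator {0<..} t *
      (ennreal (x powr (a + b - 1) * exp (- ((1 + t) * x))) * indicator {0<..} x)"
  have G: "0 < Gamma a" "0 < Gamma b" "0 < Gamma (a + b)"
    using assms by (auto intro: Gamma_real_pos)
  have "ennreal (Gamma (a + b)) * ?I = (\<integral>\<^sup>+t. ennreal (Gamma (a + b)) * (ennreal (t powr (a - 1) * (1 + t) powr (- (a + b))) * indicator {0<..} t) \<partial>lborel)"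
    by (rule nn_integral_cmult[symmetric]) measurable
  also have "\<dots> = (\<integral>\<^sup>+t. (\<integral>\<^sup>+x. ?g t x \<partial>lborel) \<partial>lborel)"
  proof (rule nn_integral_cong)
    fix t :: real
    show "ennreal (Gamma (a + b)) * (ennreal (t powr (a - 1) * (1 + t) powr (- (a + b))) * indicator {0<..} t)
        = (\<integral>\<^sup>+x. ?g t x \<partial>lborel)"
    proof (cases "0 < t")
      case True
      have "(\<integral>\<^sup>+x. ?g t x \<partial>lborel) = ennreal (t powr (a - 1)) * indicator {0<..} t *
        (\<integral>\<^sup>+x. ennreal (x powr (a + b - 1) * exp (- ((1 + t) * x))) * indicator {0<..} x \<partial>lborel)"
        by (rule nn_integral_cmult) measurable
      also have "\<dots> = ennreal (t powr (a - 1)) * ennreal (Gamma (a + b) * (1 + t) powr (- (a + b)))"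
        using nn_integral_powr_exp[of "a + b" "1 + t"] True assms by simp
      finally show ?thesis
        using True G by (simp add: ennreal_mult[symmetric] algebra_simps)
    qed simp
  qed
  also have "\<dots> = (\<integral>\<^sup>+x. (\<integral>\<^sup>+t. ?g t x \<partial>lborel) \<partial>lborel)"
    by (rule lborel_pair.Fubini') measurable
  also have "\<dots> = (\<integral>\<^sup>+x. ennreal (Gamma a) * (ennreal (x powr (b - 1) * exp (- (1 * x))) * indicator {0<..} x) \<partial>lborel)"
  proof (rule nn_integral_cong)
    fix x :: real
    show "(\<integral>\<^sup>+t. ?g t x \<partial>lborel) = ennreal (Gamma a) * (ennreal (x powr (b - 1) * exp (- (1 * x))) * indicator {0<..} x)"
    proof (cases "0 < x")
      case True
      have "(\<integral>\<^sup>+t. ?g t x \<partial>lborel) = (\<integral>\<^sup>+t. ennreal (x powr (a + b - 1) * exp (- x)) *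
         (ennreal (t powr (a - 1) * exp (- (x * t))) * indicator {0<..} t) \<partial>lborel)"
        using True by (intro nn_integral_cong)
          (auto simp: indicator_def ennreal_mult[symmetric] exp_add[symmetric] algebra_simps)
      also have "\<dots> = ennreal (x powr (a + b - 1) * exp (- x)) *
         (\<integral>\<^sup>+t. ennreal (t powr (a - 1) * exp (- (x * t))) * indicator {0<..} t \<partial>lborel)"
        by (rule nn_integral_cmult) measurable
      also have "\<dots> = ennreal (x powr (a + b - 1) * exp (- x)) * ennreal (Gamma a * x powr (- a))"
        using nn_integral_powr_exp[OF assms(1) True] by simp
      also have "x powr (b - 1) = x powr (a + b - 1) * x powr (- a)"
        by (simp add: powr_add[symmetric])
      then have "ennreal (x powr (a + b - 1) * exp (- x)) * ennreal (Gamma a * x powr (- a)) = ennreal (Gamma a) * ennreal (x powr (b - 1) * exp (- (1 * x)))"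
        using G by (simp add: ennreal_mult[symmetric] mult_ac)
      finally show ?thesis
        using True by simp
    qed simp
  qed
  also have "\<dots> = ennreal (Gamma a) * (\<integral>\<^sup>+x. (ennreal (x powr (b - 1) * exp (- (1 * x))) * indicator {0<..} x) \<partial>lborel)"
    by (rule nn_integral_cmult) measurable
  also have "\<dots> = ennreal (Gamma a * Gamma b)"
    using nn_integral_powr_exp[OF assms(2), of 1] G by (simp add: ennreal_mult)
  finally have *: "ennreal (Gamma (a + b)) * ?I = ennreal (Gamma a * Gamma b)" .
  have "?I = (ennreal (1 / Gamma (a + b)) * ennreal (Gamma (a + b))) * ?I"
    using G by (simp add: ennreal_mult[symmetric])
  also have "\<dots> = ennreal (1 / Gamma (a + b)) * ennreal (Gamma a * Gamma b)"
    unfolding *[symmetric] by (simp only: mult.assoc)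
  finally show ?thesis
    using G by (simp add: ennreal_mult[symmetric])
qed

lemma Gamma_reflection_real:
  fixes x :: real
  assumes "0 < x" "x < 1"
  shows "Gamma x * Gamma (1 - x) = pi / sin (pi * x)"
proof -
  have "complex_of_real (Gamma x * Gamma (1 - x)) = Gamma (of_real x) * Gamma (1 - of_real x)"
    using assms by (simp add: Gamma_complex_of_real[symmetric] del: of_real_diff Gamma_complex_of_real)
       (metis Gamma_complex_of_real of_real_1 of_real_diff)
  also have "\<dots> = of_real (pi / sin (pi * x))"
    by (simp add: Gamma_reflection_complex sin_of_real[symmetric] del: sin_of_real)
  finally show ?thesis by (simp only: of_real_eq_iff)
qed

section \<open>Positive definiteness of the Riesz energy\<close>

lemma nn_integral_swap:
  assumes "sigma_finite_measure M" "sigma_finite_measure N"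
    and "case_prod f \<in> borel_measurable (M \<Otimes>\<^sub>M N)"
  shows "(\<integral>\<^sup>+x. (\<integral>\<^sup>+y. f x y \<partial>N) \<partial>M) = (\<integral>\<^sup>+y. (\<integral>\<^sup>+x. f x y \<partial>M) \<partial>N)"
proof -
  interpret pair_sigma_finite M N using assms(1,2) by (rule pair_sigma_finite.intro)
  show ?thesis using Fubini'[OF assms(3)] by simp
qed

text \<open>
  This rigidity of ordered integrands turns every case of equality of energies into an almost-sure
  identity.
\<close>
lemma nn_integral_le_eq_imp_AE_eq:
  fixes f g :: "'a \<Rightarrow> ennreal"
  assumes [measurable]: "f \<in> borel_measurable M" "g \<in> borel_measurable M"
    and le: "\<And>x. x \<in> space M \<Longrightarrow> g x \<le> f x"
    and eq: "(\<integral>\<^sup>+x. f x \<partial>M) \<le> (\<integral>\<^sup>+x. g x \<partial>M)" and fin: "(\<integral>\<^sup>+x. g x \<partial>M) < \<infinity>"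
  shows "AE x in M. f x = g x"
proof -
  have "(\<integral>\<^sup>+x. f x - g x \<partial>M) = (\<integral>\<^sup>+x. f x \<partial>M) - (\<integral>\<^sup>+x. g x \<partial>M)"
    using le fin by (intro nn_integral_diff) auto
  also have "\<dots> = 0" using eq fin by (intro diff_eq_0_ennreal) (auto simp: less_top)
  finally have "AE x in M. f x - g x = 0"
    by (subst (asm) nn_integral_0_iff_AE) auto
  then show ?thesis
    using AE_space by eventually_elim (metis ennreal_minus_eq_0 le antisym)
qed

lemma nn_integral_lborel_affine:
  fixes f :: "'a::euclidean_space \<Rightarrow> ennreal"
  assumes [measurable]: "f \<in> borel_measurable borel" and "c \<noteq> 0"
  shows "(\<integral>\<^sup>+x. f x \<partial>lborel) = ennreal (\<bar>c\<bar> ^ DIM('a)) * (\<integral>\<^sup>+x. f (a + c *\<^sub>R x) \<partial>lborel)"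
  by (subst lborel_affine[OF assms(2), of a])
     (simp add: nn_integral_density nn_integral_distr nn_integral_cmult)

lemma nn_integral_gaussian_real:
  assumes "0 < c"
  shows "(\<integral>\<^sup>+x. ennreal (exp (- (c * x\<^sup>2))) \<partial>lborel) = ennreal (sqrt (pi / c))"
proof -
  define \<sigma> where "\<sigma> = sqrt (1 / (2 * c))"
  have s: "0 < \<sigma>" "\<sigma>\<^sup>2 = 1 / (2 * c)" using assms by (auto simp: \<sigma>_def)
  have "(\<integral>\<^sup>+x. ennreal (exp (- (c * x\<^sup>2))) \<partial>lborel)
      = (\<integral>\<^sup>+x. ennreal (sqrt (pi / c)) * ennreal (normal_density 0 \<sigma> x) \<partial>lborel)"
    using assms s(1)
    by (intro nn_integral_cong) (simp add: normal_density_def s(2) ennreal_mult[symmetric] real_sqrt_divide field_simps)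
  also have "\<dots> = ennreal (sqrt (pi / c)) * (\<integral>\<^sup>+x. ennreal (normal_density 0 \<sigma> x) \<partial>lborel)"
    by (rule nn_integral_cmult) measurable
  also have "(\<integral>\<^sup>+x. ennreal (normal_density 0 \<sigma> x) \<partial>lborel) = 1"
    using s(1) by (subst nn_integral_eq_integral) auto
  finally show ?thesis by simp
qed

lemma nn_integral_gaussian:
  assumes "0 < c"
  shows "(\<integral>\<^sup>+x. ennreal (exp (- (c * (norm (x::'a::euclidean_space))\<^sup>2))) \<partial>lborel)
         = ennreal (sqrt (pi / c) ^ DIM('a))"
proof -
  have n: "(norm x)\<^sup>2 = (\<Sum>b\<in>Basis. (x \<bullet> b)\<^sup>2)" for x :: 'a
    unfolding power2_norm_eq_inner by (subst euclidean_inner) (simp add: power2_eq_square)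
  have "(\<integral>\<^sup>+x. ennreal (exp (- (c * (norm (x::'a))\<^sup>2))) \<partial>lborel)
      = (\<integral>\<^sup>+x. (\<Prod>b\<in>Basis. ennreal (exp (- (c * (x \<bullet> b)\<^sup>2)))) \<partial>(lborel :: 'a measure))"
    by (intro nn_integral_cong)
       (simp add: prod_ennreal exp_sum[symmetric] n sum_distrib_left sum_negf)
  also have "\<dots> = (\<Prod>b\<in>(Basis::'a set). (\<integral>\<^sup>+x. ennreal (exp (- (c * x\<^sup>2))) \<partial>lborel))"
    by (intro nn_integral_lborel_prod) auto
  finally show ?thesis
    using assms by (simp add: nn_integral_gaussian_real ennreal_power)
qed

text \<open>
  By the parallelogram law the exponents add up to a Gaussian around the midpoint of \<open>x\<close> and \<open>y\<close>
  and a factor that depends on \<open>x - y\<close> alone. This factorization separates the two variables, which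
  is what makes the energy a sum of squares.
\<close>
lemma gaussian_self_convolution:
  fixes x y :: "'a::euclidean_space"
  assumes "0 < t"
  shows "(\<integral>\<^sup>+w. ennreal (exp (- (2 * t * (norm (x - w))\<^sup>2))) * ennreal (exp (- (2 * t * (norm (y - w))\<^sup>2))) \<partial>lborel)
       = ennreal (sqrt (pi / (4 * t)) ^ DIM('a)) * ennreal (exp (- ((norm (x - y))\<^sup>2 * t)))"
proof -
  define m where "m = (1 / 2) *\<^sub>R (x + y)"
  have id: "2 * t * (norm (x - (m + w)))\<^sup>2 + 2 * t * (norm (y - (m + w)))\<^sup>2
      = 4 * t * (norm w)\<^sup>2 + (norm (x - y))\<^sup>2 * t" for w
  proof -
    define d where "d = (1 / 2) *\<^sub>R (x - y)"
    have e: "x - (m + w) = d - w" "y - (m + w) = - (d + w)" "x - y = 2 *\<^sub>R d"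
      by (auto simp: m_def d_def algebra_simps scaleR_2[symmetric])
    show ?thesis unfolding e norm_minus_cancel
      by (simp add: power2_norm_eq_inner algebra_simps inner_commute)
  qed
  have "(\<integral>\<^sup>+w. ennreal (exp (- (2 * t * (norm (x - w))\<^sup>2))) * ennreal (exp (- (2 * t * (norm (y - w))\<^sup>2))) \<partial>lborel)
     = (\<integral>\<^sup>+w. ennreal (exp (- (2 * t * (norm (x - (m + w)))\<^sup>2))) * ennreal (exp (- (2 * t * (norm (y - (m + w)))\<^sup>2))) \<partial>lborel)"
    by (subst nn_integral_lborel_affine[where c = 1 and a = m]) auto
  also have "\<dots> = (\<integral>\<^sup>+w. ennreal (exp (- (4 * t * (norm (w::'a))\<^sup>2))) * ennreal (exp (- ((norm (x - y))\<^sup>2 * t))) \<partial>lborel)"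
  proof (rule nn_integral_cong)
    fix w
    have "exp (- (2 * t * (norm (x - (m + w)))\<^sup>2)) * exp (- (2 * t * (norm (y - (m + w)))\<^sup>2))
        = exp (- (4 * t * (norm w)\<^sup>2)) * exp (- ((norm (x - y))\<^sup>2 * t))"
      unfolding exp_add[symmetric] using id[of w] by simp
    then show "ennreal (exp (- (2 * t * (norm (x - (m + w)))\<^sup>2))) * ennreal (exp (- (2 * t * (norm (y - (m + w)))\<^sup>2)))
        = ennreal (exp (- (4 * t * (norm w)\<^sup>2))) * ennreal (exp (- ((norm (x - y))\<^sup>2 * t)))"
      by (simp add: ennreal_mult[symmetric])
  qed
  also have "\<dots> = (\<integral>\<^sup>+w. ennreal (exp (- (4 * t * (norm (w::'a))\<^sup>2))) \<partial>lborel) * ennreal (exp (- ((norm (x - y))\<^sup>2 * t)))"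
    by (rule nn_integral_multc) measurable
  finally show ?thesis
    using assms by (simp add: nn_integral_gaussian)
qed

definition mutual_energy :: "real \<Rightarrow> 'a::euclidean_space measure \<Rightarrow> 'a measure \<Rightarrow> ennreal" where
  "mutual_energy s \<sigma> \<tau> = (\<integral>\<^sup>+x. (\<integral>\<^sup>+y. riesz s (x - y) \<partial>\<tau>) \<partial>\<sigma>)"

definition smear :: "real \<Rightarrow> 'a::euclidean_space measure \<Rightarrow> 'a \<Rightarrow> ennreal" where
  "smear t \<sigma> w = (\<integral>\<^sup>+x. ennreal (exp (- (2 * t * (norm (x - w))\<^sup>2))) \<partial>\<sigma>)"

lemma smear_measurable:
  assumes "prob_space \<sigma>" and [measurable_cong]: "sets \<sigma> = sets borel"
  shows "(\<lambda>p. smear (fst p) \<sigma> (snd p)) \<in> borel_measurable (borel \<Otimes>\<^sub>M borel)"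
proof -
  interpret prob_space \<sigma> by fact
  show ?thesis unfolding smear_def by measurable
qed

lemma smear_le_1:
  assumes "prob_space \<sigma>" "0 < t"
  shows "smear t \<sigma> w \<le> 1"
proof -
  interpret prob_space \<sigma> by fact
  have "smear t \<sigma> w \<le> (\<integral>\<^sup>+x. 1 \<partial>\<sigma>)"
    unfolding smear_def using assms(2) by (intro nn_integral_mono) simp
  then show ?thesis by (simp add: emeasure_space_1)
qed

text \<open>
  The Riesz energy is an \<open>L\<^sup>2\<close> inner product of Gaussian convolutions, averaged over the scale \<open>t\<close>.
\<close>
lemma mutual_energy_as_smear:
  fixes \<sigma> \<tau> :: "'a::euclidean_space measure"
  assumes "0 < s" and p: "prob_space \<sigma>" "prob_space \<tau>"
    and [measurable_cong]: "sets \<sigma> = sets borel" "sets \<tau> = sets borel"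
  shows "ennreal (Gamma (s / 2)) * mutual_energy s \<sigma> \<tau> =
    (\<integral>\<^sup>+t. ennreal (t powr (s / 2 - 1) * sqrt (4 * t / pi) ^ DIM('a)) * indicator {0<..} t *
         (\<integral>\<^sup>+w. smear t \<sigma> w * smear t \<tau> w \<partial>lborel) \<partial>lborel)"
proof -
  interpret S: prob_space \<sigma> by fact
  interpret T: prob_space \<tau> by fact
  note sf = S.sigma_finite_measure_axioms T.sigma_finite_measure_axioms lborel.sigma_finite_measure_axioms
  let ?h = "\<lambda>t x y. ennreal (t powr (s / 2 - 1) * exp (- ((norm (x - y::'a))\<^sup>2 * t))) * indicator {0<..} t"
  have inner: "(\<integral>\<^sup>+x. (\<integral>\<^sup>+y. ?h t x y \<partial>\<tau>) \<partial>\<sigma>) =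
     ennreal (t powr (s / 2 - 1) * sqrt (4 * t / pi) ^ DIM('a)) * indicator {0<..} t *
         (\<integral>\<^sup>+w. smear t \<sigma> w * smear t \<tau> w \<partial>lborel)" for t
  proof (cases "0 < t")
    case True
    let ?e = "\<lambda>x w::'a. ennreal (exp (- (2 * t * (norm (x - w))\<^sup>2)))"
    let ?c = "ennreal (t powr (s / 2 - 1) * sqrt (4 * t / pi) ^ DIM('a))"
    have h: "?h t x y = ?c * (\<integral>\<^sup>+w. ?e x w * ?e y w \<partial>lborel)" for x y
    proof -
      have "sqrt (4 * t / pi) ^ DIM('a) * sqrt (pi / (4 * t)) ^ DIM('a) = 1"
        using True by (simp add: power_mult_distrib[symmetric] real_sqrt_mult[symmetric])
      then have "?c * ennreal (sqrt (pi / (4 * t)) ^ DIM('a)) = ennreal (t powr (s / 2 - 1))"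
        using True by (simp add: ennreal_mult[symmetric] mult.assoc)
      then show ?thesis
        using True unfolding gaussian_self_convolution[OF True]
        by (simp add: mult.assoc[symmetric] ennreal_mult)
    qed
    have "(\<integral>\<^sup>+x. (\<integral>\<^sup>+y. ?h t x y \<partial>\<tau>) \<partial>\<sigma>) = (\<integral>\<^sup>+x. (\<integral>\<^sup>+y. ?c * (\<integral>\<^sup>+w. ?e x w * ?e y w \<partial>lborel) \<partial>\<tau>) \<partial>\<sigma>)"
      unfolding h ..
    also have "\<dots> = ?c * (\<integral>\<^sup>+x. (\<integral>\<^sup>+y. (\<integral>\<^sup>+w. ?e x w * ?e y w \<partial>lborel) \<partial>\<tau>) \<partial>\<sigma>)"
      by (simp add: nn_integral_cmult)
    also have "(\<integral>\<^sup>+x. (\<integral>\<^sup>+y. (\<integral>\<^sup>+w. ?e x w * ?e y w \<partial>lborel) \<partial>\<tau>) \<partial>\<sigma>)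
        = (\<integral>\<^sup>+x. (\<integral>\<^sup>+w. ?e x w * smear t \<tau> w \<partial>lborel) \<partial>\<sigma>)"
      unfolding smear_def
      by (subst nn_integral_swap[OF sf(2,3)]) (simp_all add: nn_integral_cmult)
    also have "\<dots> = (\<integral>\<^sup>+w. smear t \<sigma> w * smear t \<tau> w \<partial>lborel)"
      unfolding smear_def
      by (subst nn_integral_swap[OF sf(1,3)]) (simp_all add: nn_integral_multc)
    finally show ?thesis using True by simp
  qed simp
  have "ennreal (Gamma (s / 2)) * mutual_energy s \<sigma> \<tau> = (\<integral>\<^sup>+x. (\<integral>\<^sup>+y. (\<integral>\<^sup>+t. ?h t x y \<partial>lborel) \<partial>\<tau>) \<partial>\<sigma>)"
    unfolding mutual_energy_def riesz_gaussian_mixture[OF assms(1)]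
    by (simp add: nn_integral_cmult)
  also have "\<dots> = (\<integral>\<^sup>+x. (\<integral>\<^sup>+t. (\<integral>\<^sup>+y. ?h t x y \<partial>\<tau>) \<partial>lborel) \<partial>\<sigma>)"
    by (subst nn_integral_swap[OF sf(2,3)]) simp_all
  also have "\<dots> = (\<integral>\<^sup>+t. (\<integral>\<^sup>+x. (\<integral>\<^sup>+y. ?h t x y \<partial>\<tau>) \<partial>\<sigma>) \<partial>lborel)"
    by (rule nn_integral_swap[OF sf(1,3)]) measurable
  finally show ?thesis unfolding inner .
qed


lemma ennreal_two_mult_le_squares:
  fixes p q :: ennreal
  assumes "p \<le> 1" "q \<le> 1"
  shows "2 * (p * q) \<le> p * p + q * q" and "p * p + q * q = 2 * (p * q) \<Longrightarrow> p = q"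
proof -
  obtain a b where ab: "p = ennreal a" "q = ennreal b" "0 \<le> a" "0 \<le> b"
    using assms by (cases p; cases q) (auto simp: top_unique)
  have s: "p * p + q * q = ennreal (a * a + b * b)" "2 * (p * q) = ennreal (2 * (a * b))"
    unfolding ab(1,2) using ab(3,4)
    by (simp_all add: ennreal_mult[symmetric] ennreal_plus[symmetric] del: ennreal_plus)
       (metis ennreal_mult ennreal_numeral mult_nonneg_nonneg zero_le_numeral)
  show "2 * (p * q) \<le> p * p + q * q"
    unfolding s using sum_squares_bound[of a b] ab by (intro ennreal_leI) (simp add: power2_eq_square)
  assume "p * p + q * q = 2 * (p * q)"
  then have "a * a + b * b = 2 * (a * b)"
    unfolding s using ab by (subst (asm) ennreal_inj) auto
  then have "(a - b)\<^sup>2 = 0" by (simp add: power2_eq_square algebra_simps)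
  then show "p = q" using ab by simp
qed

text \<open>
  The energy of the difference \<open>\<sigma> - \<tau>\<close> is an average of squares. It is stated without subtraction,
  since the energies may be infinite. In the case of equality all squares vanish, so that \<open>\<sigma>\<close> and
  \<open>\<tau>\<close> have the same convolution with almost every Gaussian.
\<close>
lemma mutual_energy_positive_definite:
  fixes \<sigma> \<tau> :: "'a::euclidean_space measure"
  assumes s: "0 < s" and p: "prob_space \<sigma>" "prob_space \<tau>"
    and b: "sets \<sigma> = sets borel" "sets \<tau> = sets borel"
  shows "2 * mutual_energy s \<sigma> \<tau> \<le> mutual_energy s \<sigma> \<sigma> + mutual_energy s \<tau> \<tau>"
    and "mutual_energy s \<sigma> \<sigma> + mutual_energy s \<tau> \<tau> \<le> 2 * mutual_energy s \<sigma> \<tau> \<Longrightarrow>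
      mutual_energy s \<sigma> \<tau> < \<infinity> \<Longrightarrow>
      AE t in lborel. 0 < t \<longrightarrow> (AE w in lborel. smear t \<sigma> w = smear t \<tau> w)"
proof -
  define c where "c t = ennreal (t powr (s / 2 - 1) * sqrt (4 * t / pi) ^ DIM('a)) * indicator {0<..} t" for t :: real
  define A where "A t w = smear t \<sigma> w * smear t \<sigma> w + smear t \<tau> w * smear t \<tau> w" for t w
  define B where "B t w = 2 * (smear t \<sigma> w * smear t \<tau> w)" for t w
  note [measurable] = smear_measurable[OF p(1) b(1)] smear_measurable[OF p(2) b(2)]
  have m1 [measurable]: "smear t \<sigma> \<in> borel_measurable borel" "smear t \<tau> \<in> borel_measurable borel" for t
    using measurable_compose_Pair1[OF _ smear_measurable[OF p(1) b(1)], of t]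
      measurable_compose_Pair1[OF _ smear_measurable[OF p(2) b(2)], of t] by simp_all
  have mA [measurable]: "(\<lambda>p. A (fst p) (snd p)) \<in> borel_measurable (borel \<Otimes>\<^sub>M borel)"
    and mB [measurable]: "(\<lambda>p. B (fst p) (snd p)) \<in> borel_measurable (borel \<Otimes>\<^sub>M borel)"
    unfolding A_def B_def by measurable
  have mA1 [measurable]: "A t \<in> borel_measurable borel" "B t \<in> borel_measurable borel" for t
    unfolding A_def B_def by measurable
  have mc [measurable]: "c \<in> borel_measurable borel" unfolding c_def by measurable
  have mI [measurable]: "(\<lambda>t. \<integral>\<^sup>+w. A t w \<partial>lborel) \<in> borel_measurable lborel"
      "(\<lambda>t. \<integral>\<^sup>+w. B t w \<partial>lborel) \<in> borel_measurable lborel"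
    using lborel.borel_measurable_nn_integral_fst[of "\<lambda>p. A (fst p) (snd p)" lborel]
      lborel.borel_measurable_nn_integral_fst[of "\<lambda>p. B (fst p) (snd p)" lborel] mA mB by simp_all
  have mI2 [measurable]: "(\<lambda>t. \<integral>\<^sup>+w. smear t \<sigma> w * smear t \<sigma> w \<partial>lborel) \<in> borel_measurable lborel"
      "(\<lambda>t. \<integral>\<^sup>+w. smear t \<tau> w * smear t \<tau> w \<partial>lborel) \<in> borel_measurable lborel"
      "(\<lambda>t. \<integral>\<^sup>+w. smear t \<sigma> w * smear t \<tau> w \<partial>lborel) \<in> borel_measurable lborel"
    using lborel.borel_measurable_nn_integral_fst[of "\<lambda>p. smear (fst p) \<sigma> (snd p) * smear (fst p) \<sigma> (snd p)" lborel]
      lborel.borel_measurable_nn_integral_fst[of "\<lambda>p. smear (fst p) \<tau> (snd p) * smear (fst p) \<tau> (snd p)" lborel]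
      lborel.borel_measurable_nn_integral_fst[of "\<lambda>p. smear (fst p) \<sigma> (snd p) * smear (fst p) \<tau> (snd p)" lborel]
    by simp_all
  have G: "0 < Gamma (s / 2)" using s by simp
  let ?G = "ennreal (Gamma (s / 2))"
  have eA: "?G * (mutual_energy s \<sigma> \<sigma> + mutual_energy s \<tau> \<tau>) = (\<integral>\<^sup>+t. c t * (\<integral>\<^sup>+w. A t w \<partial>lborel) \<partial>lborel)"
    unfolding distrib_left mutual_energy_as_smear[OF s p(1) p(1) b(1) b(1)]
      mutual_energy_as_smear[OF s p(2) p(2) b(2) b(2)] A_def c_def[symmetric]
    by (simp add: nn_integral_add distrib_left)
  have eB: "?G * (2 * mutual_energy s \<sigma> \<tau>) = (\<integral>\<^sup>+t. c t * (\<integral>\<^sup>+w. B t w \<partial>lborel) \<partial>lborel)"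
    unfolding mult.left_commute[of ?G] mutual_energy_as_smear[OF s p b] B_def c_def[symmetric]
    by (simp add: nn_integral_cmult mult.left_commute[of _ 2])
  have BA: "B t w \<le> A t w" if "0 < t" for t w
    unfolding A_def B_def using that p by (intro ennreal_two_mult_le_squares smear_le_1)
  have le: "c t * (\<integral>\<^sup>+w. B t w \<partial>lborel) \<le> c t * (\<integral>\<^sup>+w. A t w \<partial>lborel)" for t
    using BA by (cases "0 < t") (auto simp: c_def intro!: mult_left_mono nn_integral_mono)
  have "?G * (2 * mutual_energy s \<sigma> \<tau>) \<le> ?G * (mutual_energy s \<sigma> \<sigma> + mutual_energy s \<tau> \<tau>)"
    unfolding eA eB by (intro nn_integral_mono le)
  then show "2 * mutual_energy s \<sigma> \<tau> \<le> mutual_energy s \<sigma> \<sigma> + mutual_energy s \<tau> \<tau>"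
    using G by (subst (asm) ennreal_mult_le_mult_iff) auto
  assume eq: "mutual_energy s \<sigma> \<sigma> + mutual_energy s \<tau> \<tau> \<le> 2 * mutual_energy s \<sigma> \<tau>"
    and fin: "mutual_energy s \<sigma> \<tau> < \<infinity>"
  have finB: "(\<integral>\<^sup>+t. c t * (\<integral>\<^sup>+w. B t w \<partial>lborel) \<partial>lborel) < \<infinity>"
    unfolding eB[symmetric] using fin by (simp add: ennreal_mult_less_top)
  have "AE t in lborel. c t * (\<integral>\<^sup>+w. A t w \<partial>lborel) = c t * (\<integral>\<^sup>+w. B t w \<partial>lborel)"
  proof (rule nn_integral_le_eq_imp_AE_eq)
    show "(\<integral>\<^sup>+t. c t * (\<integral>\<^sup>+w. A t w \<partial>lborel) \<partial>lborel) \<le> (\<integral>\<^sup>+t. c t * (\<integral>\<^sup>+w. B t w \<partial>lborel) \<partial>lborel)"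
      unfolding eA[symmetric] eB[symmetric] by (intro mult_left_mono eq) simp
  qed (use le finB in auto)
  moreover have "AE t in lborel. c t * (\<integral>\<^sup>+w. B t w \<partial>lborel) \<noteq> \<infinity>"
    using finB by (intro nn_integral_PInf_AE) auto
  ultimately show "AE t in lborel. 0 < t \<longrightarrow> (AE w in lborel. smear t \<sigma> w = smear t \<tau> w)"
  proof eventually_elim
    case (elim t)
    show ?case
    proof
      assume t: "0 < t"
      have c0: "c t \<noteq> 0" "c t \<noteq> \<infinity>" using t by (auto simp: c_def)
      have fB: "(\<integral>\<^sup>+w. B t w \<partial>lborel) < \<infinity>"
        using elim(2) c0 by (auto simp: ennreal_mult_eq_top_iff less_top)
      have "(\<integral>\<^sup>+w. A t w \<partial>lborel) = (\<integral>\<^sup>+w. B t w \<partial>lborel)"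
        using elim(1) c0 by (simp add: ennreal_mult_cancel_left)
      then have "AE w in lborel. A t w = B t w"
        using BA[OF t] fB by (intro nn_integral_le_eq_imp_AE_eq) auto
      then show "AE w in lborel. smear t \<sigma> w = smear t \<tau> w"
        unfolding A_def B_def
        by eventually_elim (rule ennreal_two_mult_le_squares(2)[OF smear_le_1[OF p(1) t] smear_le_1[OF p(2) t]])
    qed
  qed
qed

section \<open>Strict positive definiteness\<close>

text \<open>
  The indicator of a closed set is the pointwise limit of the functions
  \<open>max 0 (1 - n d(x, C))\<close>, and the closed sets are an intersection-stable generator.
\<close>
lemma prob_measure_eqI_continuous:
  fixes \<sigma> \<tau> :: "'a::metric_space measure"
  assumes p: "prob_space \<sigma>" "prob_space \<tau>"
    and b [measurable_cong]: "sets \<sigma> = sets borel" "sets \<tau> = sets borel"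
    and eq: "\<And>f::'a \<Rightarrow> real. continuous_on UNIV f \<Longrightarrow> (\<And>x. 0 \<le> f x \<and> f x \<le> 1) \<Longrightarrow>
       (\<integral>\<^sup>+x. ennreal (f x) \<partial>\<sigma>) = (\<integral>\<^sup>+x. ennreal (f x) \<partial>\<tau>)"
  shows "\<sigma> = \<tau>"
proof (rule measure_eqI_generator_eq[where E = "{C. closed C}" and \<Omega> = UNIV and A = "\<lambda>_. UNIV"])
  interpret S: prob_space \<sigma> by fact
  interpret T: prob_space \<tau> by fact
  show "sets \<sigma> = sigma_sets UNIV {C. closed C}" "sets \<tau> = sigma_sets UNIV {C. closed C}"
    using b by (simp_all add: borel_eq_closed)
  show "emeasure \<sigma> UNIV \<noteq> \<infinity>" by simp
  fix C :: "'a set" assume "C \<in> {C. closed C}"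
  then have C: "closed C" by simp
  have [measurable]: "C \<in> sets borel" using C by (rule borel_closed)
  show "emeasure \<sigma> C = emeasure \<tau> C"
  proof (cases "C = {}")
    case False
    define f where "f n x = max 0 (1 - real n * infdist x C)" for n :: nat and x
    have cf: "continuous_on UNIV (f n)" for n
      unfolding f_def by (intro continuous_intros)
    have f01: "0 \<le> f n x \<and> f n x \<le> 1" for n x
      by (auto simp: f_def infdist_nonneg)
    have [measurable]: "f n \<in> borel_measurable borel" for n
      by (intro borel_measurable_continuous_onI cf)
    have lim: "(\<lambda>n. ennreal (f n x)) \<longlonglongrightarrow> indicator C x" for x
    proof (cases "x \<in> C")
      case True
      then show ?thesis by (simp add: f_def)
    next
      case False
      then have d: "0 < infdist x C"
        using in_closed_iff_infdist_zero[OF C \<open>C \<noteq> {}\<close>] infdist_nonneg[of x C] by fastforce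
      obtain N where N: "1 < real N * infdist x C"
        using reals_Archimedean3[OF d] by blast
      have "f n x = 0" if "N \<le> n" for n
      proof -
        have "real N * infdist x C \<le> real n * infdist x C"
          using that d by (intro mult_right_mono) auto
        then show ?thesis using N by (simp add: f_def)
      qed
      then have "\<forall>\<^sub>F n in sequentially. ennreal (f n x) = 0"
        by (intro eventually_sequentiallyI[of N]) simp
      then show ?thesis
        using False by (simp add: tendsto_eventually)
    qed
    have "(\<lambda>n. \<integral>\<^sup>+x. ennreal (f n x) \<partial>M) \<longlonglongrightarrow> emeasure M C"
      if M: "prob_space M" "sets M = sets borel" for M
    proof -
      interpret M: prob_space M by fact
      note [measurable_cong] = M(2)
      have "(\<lambda>n. \<integral>\<^sup>+x. ennreal (f n x) \<partial>M) \<longlonglongrightarrow> (\<integral>\<^sup>+x. indicator C x \<partial>M)"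
        using C f01 lim
        by (intro nn_integral_dominated_convergence[where w = "\<lambda>_. 1"]) (auto simp: M.emeasure_space_1)
      then show ?thesis using C M(2) by simp
    qed
    from this[OF p(1) b(1)] this[OF p(2) b(2)] show ?thesis
      using eq[OF cf f01] LIMSEQ_unique by auto
  qed simp
qed (auto simp: Int_stable_def)

text \<open>
  Gaussians are an approximate identity as \<open>t\<close> tends to infinity. Equality is only known for almost
  every \<open>t\<close>, but this provides a sequence of admissible \<open>t\<close> tending to infinity.
\<close>
lemma prob_measure_eqI_smear:
  fixes \<sigma> \<tau> :: "'a::euclidean_space measure"
  assumes p: "prob_space \<sigma>" "prob_space \<tau>"
    and b [measurable_cong]: "sets \<sigma> = sets borel" "sets \<tau> = sets borel"
    and eq: "AE t in lborel. 0 < t \<longrightarrow> (AE w in lborel. smear t \<sigma> w = smear t \<tau> w)"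
  shows "\<sigma> = \<tau>"
proof (rule prob_measure_eqI_continuous[OF p b])
  fix f :: "'a \<Rightarrow> real"
  assume cf: "continuous_on UNIV f" and f01: "\<And>x. 0 \<le> f x \<and> f x \<le> 1"
  have [measurable]: "f \<in> borel_measurable borel"
    by (intro borel_measurable_continuous_onI cf)
  have "\<exists>t. real n + 1 < t \<and> (AE w in lborel. smear t \<sigma> w = smear t \<tau> w)" for n
  proof (rule ccontr)
    assume neg: "\<not> ?thesis"
    have "AE t in lborel. t \<notin> {real n + 1<..<real n + 2}"
      using eq by eventually_elim (use neg in auto)
    then have "emeasure lborel {real n + 1<..<real n + 2} = 0"
      by (subst (asm) AE_iff_null_sets[symmetric]) auto
    then show False by simp
  qed
  then obtain T where T: "\<And>n. real n + 1 < T n" "\<And>n. AE w in lborel. smear (T n) \<sigma> w = smear (T n) \<tau> w"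
    by metis
  have Tpos: "0 < T n" for n using T(1)[of n] by linarith
  \<comment> \<open>The width at which the substitution \<open>w = x + c v\<close> turns the Gaussian of parameter \<open>T n\<close> into a fixed one.\<close>
  define c where "c n = 1 / sqrt (T n)" for n
  have c: "0 < c n" "T n * (c n)\<^sup>2 = 1" for n
    using Tpos[of n] by (simp_all add: c_def power_divide)
  have climit: "c \<longlonglongrightarrow> 0"
  proof (rule tendsto_sandwich[of "\<lambda>_. 0" _ _ "\<lambda>n. 1 / sqrt (real n + 1)"])
    show "\<forall>\<^sub>F n in sequentially. c n \<le> 1 / sqrt (real n + 1)"
      unfolding c_def using less_imp_le[OF T(1)] by (intro always_eventually allI frac_le real_sqrt_le_mono) auto
    show "(\<lambda>n. 1 / sqrt (real n + 1)) \<longlonglongrightarrow> 0"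
      by real_asymp
  qed (use c(1) in \<open>auto intro!: always_eventually less_imp_le\<close>)
  define g where "g v = exp (- (2 * (norm (v::'a))\<^sup>2))" for v
  have [measurable]: "g \<in> borel_measurable borel" unfolding g_def by measurable
  have g0: "0 \<le> g v" for v by (simp add: g_def)
  define \<Gamma> where "\<Gamma> = sqrt (pi / 2) ^ DIM('a)"
  have G: "0 < \<Gamma>" "(\<integral>\<^sup>+v. ennreal (g v) \<partial>lborel) = ennreal \<Gamma>"
    using nn_integral_gaussian[of 2, where 'a = 'a] by (auto simp: \<Gamma>_def g_def)
  define F where "F M n = (\<integral>\<^sup>+x. (\<integral>\<^sup>+v. ennreal (f (x + c n *\<^sub>R v) * g v) \<partial>lborel) \<partial>M)" for M n
  have Fsmear: "(\<integral>\<^sup>+w. ennreal (f w) * smear (T n) M w \<partial>lborel) = ennreal (c n ^ DIM('a)) * F M n"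
    if M: "prob_space M" "sets M = sets borel" for M n
  proof -
    interpret M: prob_space M by fact
    note [measurable_cong] = M(2)
    let ?e = "\<lambda>x w::'a. ennreal (exp (- (2 * T n * (norm (x - w))\<^sup>2)))"
    have "(\<integral>\<^sup>+w. ennreal (f w) * smear (T n) M w \<partial>lborel) = (\<integral>\<^sup>+w. (\<integral>\<^sup>+x. ennreal (f w) * ?e x w \<partial>M) \<partial>lborel)"
      unfolding smear_def by (simp add: nn_integral_cmult)
    also have "\<dots> = (\<integral>\<^sup>+x. (\<integral>\<^sup>+w. ennreal (f w) * ?e x w \<partial>lborel) \<partial>M)"
      by (rule nn_integral_swap[OF lborel.sigma_finite_measure_axioms M.sigma_finite_measure_axioms]) measurable
    also have "\<dots> = (\<integral>\<^sup>+x. ennreal (c n ^ DIM('a)) * (\<integral>\<^sup>+v. ennreal (f (x + c n *\<^sub>R v) * g v) \<partial>lborel) \<partial>M)"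
    proof (rule nn_integral_cong)
      fix x
      have n: "2 * T n * (norm (x - (x + c n *\<^sub>R v)))\<^sup>2 = 2 * (norm v)\<^sup>2" for v :: 'a
        using c(2)[of n] by (simp add: power_mult_distrib)
      have "(\<integral>\<^sup>+w. ennreal (f w) * ?e x w \<partial>lborel)
         = ennreal (\<bar>c n\<bar> ^ DIM('a)) * (\<integral>\<^sup>+v. ennreal (f (x + c n *\<^sub>R v)) * ?e x (x + c n *\<^sub>R v) \<partial>lborel)"
        using c(1)[of n] by (intro nn_integral_lborel_affine) auto
      then show "(\<integral>\<^sup>+w. ennreal (f w) * ?e x w \<partial>lborel)
         = ennreal (c n ^ DIM('a)) * (\<integral>\<^sup>+v. ennreal (f (x + c n *\<^sub>R v) * g v) \<partial>lborel)"
        unfolding n using c(1)[of n] f01 by (simp add: g_def ennreal_mult)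
    qed
    also have "\<dots> = ennreal (c n ^ DIM('a)) * F M n"
      unfolding F_def by (rule nn_integral_cmult) measurable
    finally show ?thesis .
  qed
  have Feq: "F \<sigma> n = F \<tau> n" for n
  proof -
    have "(\<integral>\<^sup>+w. ennreal (f w) * smear (T n) \<sigma> w \<partial>lborel) = (\<integral>\<^sup>+w. ennreal (f w) * smear (T n) \<tau> w \<partial>lborel)"
      using T(2)[of n] by (intro nn_integral_cong_AE) (auto elim!: eventually_mono)
    then show ?thesis
      unfolding Fsmear[OF p(1) b(1)] Fsmear[OF p(2) b(2)] using c(1)[of n]
      by (simp add: ennreal_mult_cancel_left)
  qed
  have Flim: "F M \<longlonglongrightarrow> ennreal \<Gamma> * (\<integral>\<^sup>+x. ennreal (f x) \<partial>M)"
    if M: "prob_space M" "sets M = sets borel" for M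
  proof -
    interpret M: prob_space M by fact
    interpret pair_sigma_finite M lborel ..
    note [measurable_cong] = M(2)
    have F': "F M n = (\<integral>\<^sup>+p. ennreal (f (fst p + c n *\<^sub>R snd p) * g (snd p)) \<partial>(M \<Otimes>\<^sub>M lborel))" for n
      unfolding F_def by (subst lborel.nn_integral_fst[symmetric]) auto
    have "(\<lambda>n. F M n) \<longlonglongrightarrow> (\<integral>\<^sup>+p. ennreal (f (fst p) * g (snd p)) \<partial>(M \<Otimes>\<^sub>M lborel))"
      unfolding F'
    proof (rule nn_integral_dominated_convergence[where w = "\<lambda>p. ennreal (g (snd p))"])
      show "AE p in M \<Otimes>\<^sub>M lborel. ennreal (f (fst p + c n *\<^sub>R snd p) * g (snd p)) \<le> ennreal (g (snd p))" for n
        using f01 g0 by (intro AE_I2 ennreal_leI mult_left_le_one_le) auto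
      have "(\<integral>\<^sup>+p. ennreal (g (snd p)) \<partial>(M \<Otimes>\<^sub>M lborel)) = (\<integral>\<^sup>+x. (\<integral>\<^sup>+v. ennreal (g v) \<partial>lborel) \<partial>M)"
        by (subst lborel.nn_integral_fst[symmetric]) auto
      then show "(\<integral>\<^sup>+p. ennreal (g (snd p)) \<partial>(M \<Otimes>\<^sub>M lborel)) < \<infinity>"
        unfolding G by (simp add: M.emeasure_space_1)
      show "AE p in M \<Otimes>\<^sub>M lborel. (\<lambda>n. ennreal (f (fst p + c n *\<^sub>R snd p) * g (snd p))) \<longlonglongrightarrow> ennreal (f (fst p) * g (snd p))"
      proof (intro AE_I2 tendsto_ennrealI tendsto_mult tendsto_const)
        fix p :: "'a \<times> 'a"
        have "(\<lambda>n. fst p + c n *\<^sub>R snd p) \<longlonglongrightarrow> fst p + 0 *\<^sub>R snd p"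
          by (intro tendsto_intros climit)
        then show "(\<lambda>n. f (fst p + c n *\<^sub>R snd p)) \<longlonglongrightarrow> f (fst p)"
          using cf by (intro isCont_tendsto_compose[of _ f]) (auto simp: continuous_on_eq_continuous_at)
      qed
    qed measurable
    also have "(\<integral>\<^sup>+p. ennreal (f (fst p) * g (snd p)) \<partial>(M \<Otimes>\<^sub>M lborel)) = (\<integral>\<^sup>+x. (\<integral>\<^sup>+v. ennreal (f x) * ennreal (g v) \<partial>lborel) \<partial>M)"
      using f01 g0 by (subst lborel.nn_integral_fst[symmetric]) (auto simp: ennreal_mult)
    also have "\<dots> = ennreal \<Gamma> * (\<integral>\<^sup>+x. ennreal (f x) \<partial>M)"
      by (simp add: nn_integral_cmult nn_integral_multc G mult.commute)
    finally show ?thesis .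
  qed
  have "F \<sigma> = F \<tau>" using Feq by auto
  then have "ennreal \<Gamma> * (\<integral>\<^sup>+x. ennreal (f x) \<partial>\<sigma>) = ennreal \<Gamma> * (\<integral>\<^sup>+x. ennreal (f x) \<partial>\<tau>)"
    using Flim[OF p(1) b(1)] Flim[OF p(2) b(2)] LIMSEQ_unique by metis
  then show "(\<integral>\<^sup>+x. ennreal (f x) \<partial>\<sigma>) = (\<integral>\<^sup>+x. ennreal (f x) \<partial>\<tau>)"
    using G(1) by (simp add: ennreal_mult_cancel_left)
qed

section \<open>Riesz potentials on a disc\<close>

lemma powr_eq_nn_integral:
  fixes y g :: real
  assumes "0 \<le> y" "0 < g"
  shows "ennreal (y powr g) = (\<integral>\<^sup>+t. ennreal (g * t powr (g - 1)) * indicator {0<..<y} t \<partial>lborel)"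
proof -
  have "((\<lambda>x. x powr (g - 1)) has_integral (y powr (g - 1 + 1) / (g - 1 + 1))) {0..y}"
    using assms by (intro has_integral_powr_from_0) auto
  then have "((\<lambda>x. g * x powr (g - 1)) has_integral (g * (y powr (g - 1 + 1) / (g - 1 + 1)))) {0..y}"
    by (rule has_integral_mult_right)
  then have "(\<integral>\<^sup>+t. ennreal (indicator {0..y} t * (g * t powr (g - 1))) \<partial>lborel) = ennreal (y powr g)"
    using assms by (subst nn_integral_has_integral_lebesgue) auto
  also have "(\<integral>\<^sup>+t. ennreal (indicator {0..y} t * (g * t powr (g - 1))) \<partial>lborel)
      = (\<integral>\<^sup>+t. ennreal (g * t powr (g - 1)) * indicator {0<..<y} t \<partial>lborel)"
    using AE_lborel_singleton[of y]
    by (intro nn_integral_cong_AE) (auto elim!: eventually_mono simp: indicator_def)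
  finally show ?thesis ..
qed

text \<open>
  Integrating over the superlevel sets reduces all the planar integrals below to areas of discs.
\<close>
lemma layer_cake_powr:
  fixes f :: "'a \<Rightarrow> real"
  assumes "sigma_finite_measure M" and [measurable]: "f \<in> borel_measurable M"
    and "\<And>x. 0 \<le> f x" "0 < g"
  shows "(\<integral>\<^sup>+x. ennreal (f x powr g) \<partial>M)
    = (\<integral>\<^sup>+t. ennreal (g * t powr (g - 1)) * indicator {0<..} t * emeasure M {x\<in>space M. t < f x} \<partial>lborel)"
proof -
  interpret sigma_finite_measure M by fact
  let ?k = "\<lambda>t. ennreal (g * t powr (g - 1)) * indicator {0<..} t"
  have "(\<integral>\<^sup>+x. ennreal (f x powr g) \<partial>M) = (\<integral>\<^sup>+x. (\<integral>\<^sup>+t. ?k t * indicator {x\<in>space M. t < f x} x \<partial>lborel) \<partial>M)"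
    unfolding powr_eq_nn_integral[OF assms(3,4)]
    by (intro nn_integral_cong) (auto simp: indicator_def)
  also have "\<dots> = (\<integral>\<^sup>+t. (\<integral>\<^sup>+x. ?k t * indicator {x\<in>space M. t < f x} x \<partial>M) \<partial>lborel)"
    by (rule nn_integral_swap[OF assms(1) lborel.sigma_finite_measure_axioms]) measurable
  also have "\<dots> = (\<integral>\<^sup>+t. ?k t * emeasure M {x\<in>space M. t < f x} \<partial>lborel)"
    by (simp add: nn_integral_cmult)
  finally show ?thesis .
qed

lemma emeasure_disc:
  assumes "0 \<le> r"
  shows "emeasure lborel (ball c r :: (real^2) set) = ennreal (pi * r\<^sup>2)"
  using assms by (simp add: emeasure_ball unit_ball_vol_2)

lemma nn_integral_disc_powr:
  fixes g R :: real
  assumes "0 < g" "0 < R"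
  shows "(\<integral>\<^sup>+w. ennreal ((max 0 (R\<^sup>2 - (norm (w::real^2))\<^sup>2)) powr g) \<partial>lborel)
       = ennreal (pi * R powr (2 * g + 2) / (g + 1))"
proof -
  let ?f = "\<lambda>w::real^2. max 0 (R\<^sup>2 - (norm w)\<^sup>2)"
  have set_eq: "{w \<in> space lborel. t < ?f w} = ball 0 (sqrt (R\<^sup>2 - t))" if "0 < t" "t < R\<^sup>2" for t
  proof -
    have "t < ?f w \<longleftrightarrow> (norm w)\<^sup>2 < R\<^sup>2 - t" for w
      using that(1) by linarith
    moreover have "(norm w)\<^sup>2 < R\<^sup>2 - t \<longleftrightarrow> norm w < sqrt (R\<^sup>2 - t)" for w :: "real^2"
      using real_sqrt_less_iff[of "(norm w)\<^sup>2" "R\<^sup>2 - t"] by (simp only: real_sqrt_abs abs_norm_cancel)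
    ultimately have "t < ?f w \<longleftrightarrow> norm w < sqrt (R\<^sup>2 - t)" for w by blast
    then show ?thesis
      by (intro set_eqI) (simp only: mem_Collect_eq mem_ball dist_norm space_lborel space_borel UNIV_I simp_thms diff_0 norm_minus_cancel)
  qed
  have empty: "{w \<in> space lborel. t < ?f w} = {}" if "0 < t" "R\<^sup>2 \<le> t" for t
    using that zero_le_power2 by (auto simp: max_def) (smt (verit, best) zero_le_power2)
  have "(\<integral>\<^sup>+w. ennreal (?f w powr g) \<partial>lborel)
    = (\<integral>\<^sup>+t. ennreal (g * t powr (g - 1)) * indicator {0<..} t * emeasure lborel {w \<in> space lborel. t < ?f w} \<partial>lborel)"
    using assms by (intro layer_cake_powr lborel.sigma_finite_measure_axioms) auto
  also have "\<dots> = (\<integral>\<^sup>+t. ennreal (indicator {0..R\<^sup>2} t * (g * pi * (R\<^sup>2 * t powr (g - 1) - t powr g))) \<partial>lborel)"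
  proof (rule nn_integral_cong)
    fix t :: real
    consider "t \<le> 0" | "0 < t" "t < R\<^sup>2" | "0 < t" "R\<^sup>2 \<le> t" by linarith
    then show "ennreal (g * t powr (g - 1)) * indicator {0<..} t * emeasure lborel {w \<in> space lborel. t < ?f w}
        = ennreal (indicator {0..R\<^sup>2} t * (g * pi * (R\<^sup>2 * t powr (g - 1) - t powr g)))"
    proof cases
      case 2
      have "t powr g = t * t powr (g - 1)" using 2 by (simp add: powr_diff)
      then show ?thesis
        using 2 assms unfolding set_eq[OF 2]
        by (simp add: emeasure_disc ennreal_mult[symmetric] algebra_simps)
    next
      case 3
      have "t powr g = t * t powr (g - 1)" using 3 by (simp add: powr_diff)
      then show ?thesis
        using 3 unfolding empty[OF 3] by (auto simp: indicator_def)
    qed (auto simp: indicator_def)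
  qed
  also have "\<dots> = ennreal (g * pi * (R\<^sup>2 * ((R\<^sup>2) powr (g - 1 + 1) / (g - 1 + 1)) - (R\<^sup>2) powr (g + 1) / (g + 1)))"
  proof (rule nn_integral_has_integral_lebesgue)
    show "((\<lambda>t. g * pi * (R\<^sup>2 * t powr (g - 1) - t powr g)) has_integral
      g * pi * (R\<^sup>2 * ((R\<^sup>2) powr (g - 1 + 1) / (g - 1 + 1)) - (R\<^sup>2) powr (g + 1) / (g + 1))) {0..R\<^sup>2}"
      using assms by (intro has_integral_mult_right has_integral_diff has_integral_powr_from_0) auto
    fix t assume t: "t \<in> {0..R\<^sup>2}"
    have "t powr g = t * t powr (g - 1)" using t by (cases "t = 0") (auto simp: powr_diff)
    then show "0 \<le> g * pi * (R\<^sup>2 * t powr (g - 1) - t powr g)"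
      using t assms by (auto simp: left_diff_distrib[symmetric])
  qed
  also have "g * pi * (R\<^sup>2 * ((R\<^sup>2) powr (g - 1 + 1) / (g - 1 + 1)) - (R\<^sup>2) powr (g + 1) / (g + 1))
      = pi * R powr (2 * g + 2) / (g + 1)"
  proof -
    have "(R\<^sup>2) powr (g + 1) = R\<^sup>2 * (R\<^sup>2) powr g" using assms by (simp add: powr_add)
    moreover have "(R\<^sup>2) powr (g + 1) = R powr (2 * g + 2)"
      using assms by (simp add: powr_numeral[symmetric] powr_powr algebra_simps del: powr_numeral)
    moreover have "g * pi * (x / g - x / (g + 1)) = pi * x / (g + 1)" for x
    proof -
      have "x / g - x / (g + 1) = x / (g * (g + 1))"
        using assms by (simp add: divide_simps) (simp add: algebra_simps)
      then show ?thesis using assms by simp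
    qed
    ultimately show ?thesis by simp
  qed
  finally show ?thesis .
qed

lemma nn_integral_reflection_kernels:
  fixes g :: real
  assumes "0 < g" "g < 1"
  shows "(\<integral>\<^sup>+t. ennreal (t powr (g - 1) / (1 + t)) * indicator {0<..} t \<partial>lborel) = ennreal (pi / sin (pi * g))"
    and "(\<integral>\<^sup>+t. ennreal (t powr g / (1 + t)\<^sup>2) * indicator {0<..} t \<partial>lborel) = ennreal (g * (pi / sin (pi * g)))"
proof -
  have "(\<integral>\<^sup>+t. ennreal (t powr (g - 1) / (1 + t)) * indicator {0<..} t \<partial>lborel)
    = (\<integral>\<^sup>+t. ennreal (t powr (g - 1) * (1 + t) powr (- (g + (1 - g)))) * indicator {0<..} t \<partial>lborel)"
    by (intro nn_integral_cong) (auto simp: indicator_def powr_minus field_simps)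
  also have "\<dots> = ennreal (Gamma g * Gamma (1 - g) / Gamma (g + (1 - g)))"
    using assms by (intro nn_integral_Beta_halfline) auto
  finally show "(\<integral>\<^sup>+t. ennreal (t powr (g - 1) / (1 + t)) * indicator {0<..} t \<partial>lborel) = ennreal (pi / sin (pi * g))"
    using Gamma_reflection_real[OF assms] by simp
  have "(\<integral>\<^sup>+t. ennreal (t powr g / (1 + t)\<^sup>2) * indicator {0<..} t \<partial>lborel)
    = (\<integral>\<^sup>+t. ennreal (t powr (g + 1 - 1) * (1 + t) powr (- (g + 1 + (1 - g)))) * indicator {0<..} t \<partial>lborel)"
    by (intro nn_integral_cong) (auto simp: indicator_def powr_minus field_simps)
  also have "\<dots> = ennreal (Gamma (g + 1) * Gamma (1 - g) / Gamma (g + 1 + (1 - g)))"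
    using assms by (intro nn_integral_Beta_halfline) auto
  also have "Gamma (g + 1) = g * Gamma g"
    using assms by (intro Gamma_plus1) (auto simp: nonpos_Ints_def)
  also have "Gamma (g + 1 + (1 - g)) = 1"
    by (simp add: Gamma_numeral[of "num.Bit0 num.One", simplified])
  finally show "(\<integral>\<^sup>+t. ennreal (t powr g / (1 + t)\<^sup>2) * indicator {0<..} t \<partial>lborel) = ennreal (g * (pi / sin (pi * g)))"
    using Gamma_reflection_real[OF assms] by (simp add: mult.assoc)
qed

text \<open>
  Completing the square in \<open>t |z - w|\<^sup>2 < R\<^sup>2 - |w|\<^sup>2\<close> gives a disc, whether \<open>z\<close> lies inside or outside
  the disc of radius \<open>R\<close>; the truncation of the squared radius at \<open>0\<close> covers the empty case. The
  point \<open>z\<close> is removed because the quotient has the value \<open>0\<close> there.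
\<close>
lemma superlevel_set_is_disc:
  fixes z :: "real^2"
  assumes "0 < t"
  shows "{w. t < max 0 (R\<^sup>2 - (norm w)\<^sup>2) / (norm (z - w))\<^sup>2}
    = ball ((t / (1 + t)) *\<^sub>R z) (sqrt (max 0 (R\<^sup>2 / (1 + t) - t * (norm z)\<^sup>2 / (1 + t)\<^sup>2))) - {z}"
proof -
  let ?c = "(t / (1 + t)) *\<^sub>R z"
  let ?D = "R\<^sup>2 / (1 + t) - t * (norm z)\<^sup>2 / (1 + t)\<^sup>2"
  have "t < max 0 (R\<^sup>2 - (norm w)\<^sup>2) / (norm (z - w))\<^sup>2 \<longleftrightarrow> norm (?c - w) < sqrt (max 0 ?D)"
    if "w \<noteq> z" for w
  proof -
    have pos: "0 < (norm (z - w))\<^sup>2" using that by simp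
    have "t < max 0 (R\<^sup>2 - (norm w)\<^sup>2) / (norm (z - w))\<^sup>2 \<longleftrightarrow> t * (norm (z - w))\<^sup>2 < max 0 (R\<^sup>2 - (norm w)\<^sup>2)"
      using pos by (simp add: pos_less_divide_eq)
    also have "\<dots> \<longleftrightarrow> t * (norm (z - w))\<^sup>2 + (norm w)\<^sup>2 - R\<^sup>2 < 0"
      using assms pos by (smt (verit, best) mult_pos_pos)
    also have "t * (norm (z - w))\<^sup>2 + (norm w)\<^sup>2 - R\<^sup>2 = (1 + t) * ((norm (?c - w))\<^sup>2 - ?D)"
    proof -
      have 1: "(norm (z - w))\<^sup>2 = (norm z)\<^sup>2 - 2 * (z \<bullet> w) + (norm w)\<^sup>2"
        by (simp add: power2_norm_eq_inner algebra_simps inner_commute)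
      have 2: "(norm (?c - w))\<^sup>2 = (t / (1 + t))\<^sup>2 * (norm z)\<^sup>2 - 2 * (t / (1 + t)) * (z \<bullet> w) + (norm w)\<^sup>2"
        unfolding power2_norm_eq_inner by (simp add: algebra_simps inner_commute power2_eq_square)
      have "1 + t \<noteq> 0" using assms by simp
      then show ?thesis unfolding 1 2
        by (simp add: divide_simps power2_eq_square) (simp add: algebra_simps)
    qed
    also have "\<dots> < 0 \<longleftrightarrow> (norm (?c - w))\<^sup>2 < ?D"
      using assms by (simp add: mult_less_0_iff)
    also have "\<dots> \<longleftrightarrow> norm (?c - w) < sqrt (max 0 ?D)"
      by (smt (verit) norm_ge_zero real_less_rsqrt real_sqrt_abs real_sqrt_less_iff real_sqrt_zero zero_le_power2 abs_norm_cancel)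
    finally show ?thesis .
  qed
  note iff = this
  show ?thesis
  proof (rule set_eqI)
    fix w
    show "w \<in> {w. t < max 0 (R\<^sup>2 - (norm w)\<^sup>2) / (norm (z - w))\<^sup>2} \<longleftrightarrow> w \<in> ball ?c (sqrt (max 0 ?D)) - {z}"
using iff[of w] assms by (cases "w = z") (simp_all only: mem_Collect_eq mem_ball dist_norm Diff_iff singleton_iff, simp_all)
  qed
qed

text \<open>
  The exponents are matched so that the integrand is the \<open>g\<close>-th power of
  \<open>(R\<^sup>2 - |w|\<^sup>2)\<^sub>+ / |z - w|\<^sup>2\<close>.
\<close>
definition disc_potential :: "real \<Rightarrow> real \<Rightarrow> real^2 \<Rightarrow> ennreal" where
  "disc_potential g R z =
    (\<integral>\<^sup>+w. ennreal ((max 0 (R\<^sup>2 - (norm w)\<^sup>2)) powr g) * riesz (2 * g) (z - w) \<partial>lborel)"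

lemma disc_potential_eq:
  fixes z :: "real^2"
  assumes "0 < g"
  shows "disc_potential g R z =
    (\<integral>\<^sup>+t. ennreal (g * t powr (g - 1)) * indicator {0<..} t *
       ennreal (pi * max 0 (R\<^sup>2 / (1 + t) - t * (norm z)\<^sup>2 / (1 + t)\<^sup>2)) \<partial>lborel)"
proof -
  let ?f = "\<lambda>w. max 0 (R\<^sup>2 - (norm w)\<^sup>2) / (norm (z - w))\<^sup>2"
  have "disc_potential g R z = (\<integral>\<^sup>+w. ennreal (?f w powr g) \<partial>lborel)"
    unfolding disc_potential_def
  proof (rule nn_integral_cong_AE, use AE_lborel_singleton[of z] in eventually_elim)
    fix w assume "w \<noteq> z"
    then have "((norm (z - w))\<^sup>2) powr g = norm (z - w) powr (2 * g)" "z - w \<noteq> 0"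
      by (simp_all add: powr_numeral[symmetric] powr_powr del: powr_numeral)
    then show "ennreal ((max 0 (R\<^sup>2 - (norm w)\<^sup>2)) powr g) * riesz (2 * g) (z - w) = ennreal (?f w powr g)"
      by (simp add: riesz_def powr_divide ennreal_mult[symmetric] powr_minus_divide)
  qed
  also have "\<dots> = (\<integral>\<^sup>+t. ennreal (g * t powr (g - 1)) * indicator {0<..} t * emeasure lborel {w \<in> space lborel. t < ?f w} \<partial>lborel)"
    using assms by (intro layer_cake_powr lborel.sigma_finite_measure_axioms) auto
  also have "\<dots> = (\<integral>\<^sup>+t. ennreal (g * t powr (g - 1)) * indicator {0<..} t *
       ennreal (pi * max 0 (R\<^sup>2 / (1 + t) - t * (norm z)\<^sup>2 / (1 + t)\<^sup>2)) \<partial>lborel)"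
  proof (rule nn_integral_cong)
    fix t :: real
    let ?D = "R\<^sup>2 / (1 + t) - t * (norm z)\<^sup>2 / (1 + t)\<^sup>2"
    have "emeasure lborel {w \<in> space lborel. t < ?f w} = ennreal (pi * max 0 ?D)" if "0 < t"
    proof -
      have "emeasure lborel {w \<in> space lborel. t < ?f w}
          = emeasure lborel (ball ((t / (1 + t)) *\<^sub>R z) (sqrt (max 0 ?D)) - {z})"
        using superlevel_set_is_disc[OF that] by simp
      also have "\<dots> = emeasure lborel (ball ((t / (1 + t)) *\<^sub>R z) (sqrt (max 0 ?D)))"
        by (intro emeasure_Diff_null_set) auto
      finally show ?thesis by (simp add: emeasure_disc)
    qed
    then show "ennreal (g * t powr (g - 1)) * indicator {0<..} t * emeasure lborel {w \<in> space lborel. t < ?f w}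
      = ennreal (g * t powr (g - 1)) * indicator {0<..} t * ennreal (pi * max 0 ?D)"
      by (auto simp: indicator_def)
  qed
  finally show ?thesis .
qed

text \<open>
  The truncation in the one-dimensional formula is the only place where the position of \<open>z\<close> matters:
  for \<open>|z| \<le> R\<close> nothing is truncated and the integral is an affine function of \<open>|z|\<^sup>2\<close>, while in
  general truncation can only increase the integral. Thus the equality inside the disc and the
  inequality outside come from the same computation.
\<close>
lemma disc_potential_bounds:
  fixes z :: "real^2"
  assumes "0 < g" "g < 1"
  defines "\<kappa> \<equiv> pi / sin (pi * g)"
  shows "disc_potential g R z \<le> ennreal (pi * g * \<kappa> * R\<^sup>2)"
    and "ennreal (pi * g * \<kappa> * R\<^sup>2) \<le> disc_potential g R z + ennreal (pi * g\<^sup>2 * \<kappa> * (norm z)\<^sup>2)"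
    and "norm z \<le> R \<Longrightarrow> ennreal (pi * g * \<kappa> * R\<^sup>2) = disc_potential g R z + ennreal (pi * g\<^sup>2 * \<kappa> * (norm z)\<^sup>2)"
proof -
  have "0 < sin (pi * g)" using assms(1,2) by (intro sin_gt_zero) auto
  then have k: "0 < \<kappa>" by (simp add: \<kappa>_def)
  let ?P = "\<lambda>t. ennreal (t powr (g - 1) / (1 + t)) * indicator {0<..} t"
  let ?Q = "\<lambda>t. ennreal (t powr g / (1 + t)\<^sup>2) * indicator {0<..} t"
  let ?V = "\<lambda>t. ennreal (g * t powr (g - 1)) * indicator {0<..} t *
       ennreal (pi * max 0 (R\<^sup>2 / (1 + t) - t * (norm z)\<^sup>2 / (1 + t)\<^sup>2))"
  have IP: "(\<integral>\<^sup>+t. ennreal (pi * g * R\<^sup>2) * ?P t \<partial>lborel) = ennreal (pi * g * \<kappa> * R\<^sup>2)"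
    using assms(1) k by (subst nn_integral_cmult, measurable,
      unfold nn_integral_reflection_kernels[OF assms(1,2)] \<kappa>_def[symmetric])
      (simp add: ennreal_mult[symmetric] mult_ac)
  have IQ: "(\<integral>\<^sup>+t. ennreal (pi * g * (norm z)\<^sup>2) * ?Q t \<partial>lborel) = ennreal (pi * g\<^sup>2 * \<kappa> * (norm z)\<^sup>2)"
    using assms(1) k by (subst nn_integral_cmult, measurable,
      unfold nn_integral_reflection_kernels[OF assms(1,2)] \<kappa>_def[symmetric])
      (simp add: ennreal_mult[symmetric] mult_ac power2_eq_square)
  have r: "?V t = ennreal (pi * g * t powr (g - 1) * max 0 (R\<^sup>2 / (1 + t) - t * (norm z)\<^sup>2 / (1 + t)\<^sup>2))"
      "ennreal (pi * g * R\<^sup>2) * ?P t = ennreal (pi * g * t powr (g - 1) * (R\<^sup>2 / (1 + t)))"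
      "ennreal (pi * g * (norm z)\<^sup>2) * ?Q t = ennreal (pi * g * t powr (g - 1) * (t * (norm z)\<^sup>2 / (1 + t)\<^sup>2))"
    if "0 < t" for t
    using that assms(1) by (simp_all add: ennreal_mult[symmetric] powr_diff mult_ac)
  have nn: "0 \<le> pi * g * t powr (g - 1)" "0 \<le> R\<^sup>2 / (1 + t)" "0 \<le> t * (norm z)\<^sup>2 / (1 + t)\<^sup>2" if "0 < t" for t
    using that assms(1) by auto
  show "disc_potential g R z \<le> ennreal (pi * g * \<kappa> * R\<^sup>2)"
    unfolding disc_potential_eq[OF assms(1)] IP[symmetric]
  proof (rule nn_integral_mono)
    fix t :: real
    show "?V t \<le> ennreal (pi * g * R\<^sup>2) * ?P t"
    proof (cases "0 < t")
      case True
      then show ?thesis unfolding r[OF True] using nn[OF True]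
        by (intro ennreal_leI mult_left_mono) auto
    qed simp
  qed
  have sum: "disc_potential g R z + ennreal (pi * g\<^sup>2 * \<kappa> * (norm z)\<^sup>2)
      = (\<integral>\<^sup>+t. ?V t + ennreal (pi * g * (norm z)\<^sup>2) * ?Q t \<partial>lborel)"
    unfolding disc_potential_eq[OF assms(1)] IQ[symmetric] by (subst nn_integral_add) auto
  have s: "?V t + ennreal (pi * g * (norm z)\<^sup>2) * ?Q t
     = ennreal (pi * g * t powr (g - 1) * (max 0 (R\<^sup>2 / (1 + t) - t * (norm z)\<^sup>2 / (1 + t)\<^sup>2) + t * (norm z)\<^sup>2 / (1 + t)\<^sup>2))"
    if "0 < t" for t
    unfolding r[OF that] distrib_left
    by (rule ennreal_plus[symmetric, OF mult_nonneg_nonneg[OF nn(1)[OF that] max.cobounded1]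
          mult_nonneg_nonneg[OF nn(1)[OF that] nn(3)[OF that]]])
  show "ennreal (pi * g * \<kappa> * R\<^sup>2) \<le> disc_potential g R z + ennreal (pi * g\<^sup>2 * \<kappa> * (norm z)\<^sup>2)"
    unfolding sum IP[symmetric]
  proof (rule nn_integral_mono)
    fix t :: real
    show "ennreal (pi * g * R\<^sup>2) * ?P t \<le> ?V t + ennreal (pi * g * (norm z)\<^sup>2) * ?Q t"
    proof (cases "0 < t")
      case True
      then show ?thesis unfolding s[OF True] r(2)[OF True] using nn[OF True]
        by (intro ennreal_leI mult_left_mono) auto
    qed simp
  qed
  assume zR: "norm z \<le> R"
  show "ennreal (pi * g * \<kappa> * R\<^sup>2) = disc_potential g R z + ennreal (pi * g\<^sup>2 * \<kappa> * (norm z)\<^sup>2)"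
    unfolding sum IP[symmetric]
  proof (rule nn_integral_cong)
    fix t :: real
    show "ennreal (pi * g * R\<^sup>2) * ?P t = ?V t + ennreal (pi * g * (norm z)\<^sup>2) * ?Q t"
    proof (cases "0 < t")
      case True
      have "t * (norm z)\<^sup>2 \<le> (1 + t) * R\<^sup>2"
        using True zR by (intro mult_mono power_mono) auto
      then have "t * (norm z)\<^sup>2 / (1 + t)\<^sup>2 \<le> R\<^sup>2 / (1 + t)"
        using True by (simp add: divide_simps power2_eq_square mult_ac)
      then show ?thesis unfolding s[OF True] r(2)[OF True] by (simp add: max_def)
    qed simp
  qed
qed

section \<open>The planar measure and its potential\<close>

definition planar_min :: "real \<Rightarrow> (real^2) measure" where
  "planar_min s = density lborel (\<lambda>z. ennreal (rho2 s z))"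

lemma planar_consts_pos:
  assumes "0 < s" "s < 2"
  shows "0 < sin (s * pi / 2)" "0 < C2 s" "0 < R2 s"
proof -
  show sin: "0 < sin (s * pi / 2)"
    using assms by (intro sin_gt_zero) auto
  show "0 < C2 s" "0 < R2 s"
    using sin assms by (simp_all add: C2_def R2_def)
qed

lemma rho2_measurable [measurable]: "rho2 s \<in> borel_measurable borel"
  unfolding rho2_def by measurable

lemma sets_planar_min [simp, measurable_cong]: "sets (planar_min s) = sets borel"
  by (simp add: planar_min_def)

lemma space_planar_min [simp]: "space (planar_min s) = UNIV"
  by (simp add: planar_min_def)

lemma prob_space_planar_min:
  assumes "0 < s" "s < 2"
  shows "prob_space (planar_min s)"
proof
  note pos = planar_consts_pos[OF assms]
  let ?K = "8 * sin (s * pi / 2) / (s\<^sup>2 * (2 + s) * pi)"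
  have K: "0 < ?K" using pos assms by simp
  have R: "R2 s powr (2 * (s / 2) + 2) = 1 / ?K"
    unfolding R2_def powr_powr using assms K pos(1) by (simp add: powr_minus_divide)
  have "emeasure (planar_min s) (space (planar_min s)) = (\<integral>\<^sup>+z. ennreal (rho2 s z) \<partial>lborel)"
    unfolding planar_min_def by (simp add: emeasure_density)
  also have "\<dots> = (\<integral>\<^sup>+z. ennreal (C2 s) * ennreal ((max 0 ((R2 s)\<^sup>2 - (norm (z::real^2))\<^sup>2)) powr (s / 2)) \<partial>lborel)"
    using pos by (intro nn_integral_cong) (simp add: rho2_def ennreal_mult)
  also have "\<dots> = ennreal (C2 s) * ennreal (pi * R2 s powr (2 * (s / 2) + 2) / (s / 2 + 1))"
    using assms pos by (subst nn_integral_cmult) (auto simp: nn_integral_disc_powr[of "s / 2" "R2 s"])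
  also have "\<dots> = ennreal (C2 s * (pi * (1 / ?K) / (s / 2 + 1)))"
    unfolding R using pos K assms by (intro ennreal_mult[symmetric]) (auto simp: less_imp_le)
  also have "C2 s * (pi * (1 / ?K) / (s / 2 + 1)) = 1"
  proof -
    define S u where "S = sin (s * pi / 2)" and "u = 2 + s"
    have "S \<noteq> 0" "u \<noteq> 0" "s / 2 + 1 = u / 2"
      using pos(1) assms by (auto simp: S_def u_def)
    then show ?thesis
      unfolding C2_def S_def[symmetric] u_def[symmetric] using assms
      by (simp add: power2_eq_square)
  qed
  finally show "emeasure (planar_min s) (space (planar_min s)) = 1" by simp
qed

lemma AE_planar_min_le: "AE z in planar_min s. norm z \<le> R2 s"
proof (cases "0 \<le> R2 s")
  case True
  have "rho2 s z = 0" if "\<not> norm z \<le> R2 s" for z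
  proof -
    have "(R2 s)\<^sup>2 \<le> (norm z)\<^sup>2" using that True by (intro power_mono) auto
    then show ?thesis by (simp add: rho2_def max_def)
  qed
  then show ?thesis
    unfolding planar_min_def by (subst AE_density) (auto intro!: AE_I2 intro: ccontr)
qed (simp add: R2_def)

definition planar_potential :: "real \<Rightarrow> real^2 \<Rightarrow> ennreal" where
  "planar_potential s z = (\<integral>\<^sup>+w. riesz s (z - w) \<partial>planar_min s)"

text \<open>
  The last two claims are the Euler--Lagrange conditions of the planar problem. The normalization \<open>C2\<close> is exactly
  the one that makes the coefficient of \<open>|z|\<^sup>2\<close> equal to that of the confining potential.
\<close>
lemma planar_potential_bounds:
  assumes "0 < s" "s < 2"
  defines "A \<equiv> (R2 s)\<^sup>2 / (s / 2)"
  shows "planar_potential s z \<le> ennreal A"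
    and "ennreal A \<le> planar_potential s z + ennreal ((norm z)\<^sup>2)"
    and "norm z \<le> R2 s \<Longrightarrow> planar_potential s z + ennreal ((norm z)\<^sup>2) = ennreal A"
proof -
  note pos = planar_consts_pos[OF assms(1,2)]
  let ?g = "s / 2" and ?\<kappa> = "pi / sin (pi * (s / 2))"
  have g: "0 < ?g" "?g < 1" using assms by auto
  have sinp: "0 < sin (pi * (s / 2))" using pos(1) by (simp add: mult.commute)
  have eq: "planar_potential s z = ennreal (C2 s) * disc_potential ?g (R2 s) z"
  proof -
    have "planar_potential s z = (\<integral>\<^sup>+w. ennreal (rho2 s w) * riesz s (z - w) \<partial>lborel)"
      unfolding planar_potential_def planar_min_def by (subst nn_integral_density) auto
    also have "\<dots> = (\<integral>\<^sup>+w. ennreal (C2 s) * (ennreal ((max 0 ((R2 s)\<^sup>2 - (norm w)\<^sup>2)) powr ?g) * riesz s (z - w)) \<partial>lborel)"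
      using pos by (intro nn_integral_cong) (simp add: rho2_def ennreal_mult mult.assoc)
    also have "\<dots> = ennreal (C2 s) * disc_potential ?g (R2 s) z"
      unfolding disc_potential_def by (subst nn_integral_cmult) auto
    finally show ?thesis .
  qed
  have c: "C2 s * (pi * ?g * ?\<kappa> * x) = x / ?g" "C2 s * (pi * ?g\<^sup>2 * ?\<kappa> * x) = x" for x
  proof -
    define S where "S = sin (pi * (s / 2))"
    have "C2 s = 4 * S / (s\<^sup>2 * pi\<^sup>2)" "S \<noteq> 0"
      using sinp by (simp_all add: C2_def S_def mult.commute)
    then show "C2 s * (pi * ?g * ?\<kappa> * x) = x / ?g" "C2 s * (pi * ?g\<^sup>2 * ?\<kappa> * x) = x"
      unfolding S_def[symmetric] using assms(1) by (simp_all add: power2_eq_square)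
  qed
  have k: "0 \<le> ?\<kappa>" using sinp by simp
  have e1: "ennreal A = ennreal (C2 s) * ennreal (pi * ?g * ?\<kappa> * (R2 s)\<^sup>2)"
    unfolding A_def c(1)[symmetric] by (intro ennreal_mult mult_nonneg_nonneg k) (use pos g in auto)
  have e2: "ennreal ((norm z)\<^sup>2) = ennreal (C2 s) * ennreal (pi * ?g\<^sup>2 * ?\<kappa> * (norm z)\<^sup>2)"
    by (subst c(2)[symmetric]) (intro ennreal_mult mult_nonneg_nonneg k; use pos g in auto)
  show "planar_potential s z \<le> ennreal A"
    unfolding eq e1 by (intro mult_left_mono disc_potential_bounds(1)[OF g]) simp
  show "ennreal A \<le> planar_potential s z + ennreal ((norm z)\<^sup>2)"
    unfolding eq e1 e2 distrib_left[symmetric] by (intro mult_left_mono disc_potential_bounds(2)[OF g]) simp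
  show "norm z \<le> R2 s \<Longrightarrow> planar_potential s z + ennreal ((norm z)\<^sup>2) = ennreal A"
    unfolding eq e1 e2 distrib_left[symmetric] by (simp only: disc_potential_bounds(3)[OF g, symmetric])
qed

lemma distr_planar_min_uminus: "distr (planar_min s) borel uminus = planar_min s"
proof (rule measure_eqI)
  fix A assume "A \<in> sets (distr (planar_min s) borel uminus)"
  then have [measurable]: "A \<in> sets borel" by simp
  have [measurable]: "(uminus -` A :: (real^2) set) \<in> sets borel"
    using measurable_sets[of uminus borel borel A] by simp
  have "emeasure (distr (planar_min s) borel uminus) A = (\<integral>\<^sup>+z. ennreal (rho2 s z) * indicator A (- z) \<partial>lborel)"
    unfolding planar_min_def
    by (subst emeasure_distr) (auto simp: emeasure_density indicator_def intro!: nn_integral_cong)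
  also have "\<dots> = ennreal (\<bar>- 1\<bar> ^ DIM(real^2)) * (\<integral>\<^sup>+z. ennreal (rho2 s (0 + (-1) *\<^sub>R z)) * indicator A (- (0 + (-1) *\<^sub>R z)) \<partial>lborel)"
    by (rule nn_integral_lborel_affine) auto
  also have "\<dots> = emeasure (planar_min s) A"
    unfolding planar_min_def by (simp add: emeasure_density rho2_def)
  finally show "emeasure (distr (planar_min s) borel uminus) A = emeasure (planar_min s) A" .
qed simp

lemma integrable_planar_min:
  fixes f :: "real^2 \<Rightarrow> 'b::{banach, second_countable_topology}"
  assumes s: "0 < s" "s < 2" and "continuous_on UNIV f"
  shows "integrable (planar_min s) f"
proof -
  interpret prob_space "planar_min s" by (rule prob_space_planar_min[OF s])
  have [measurable]: "f \<in> borel_measurable borel"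
    using assms(3) by (rule borel_measurable_continuous_onI)
  have "compact (f ` cball 0 (R2 s))"
    using assms(3) continuous_on_subset by (intro compact_continuous_image) auto
  then obtain B where "\<And>z. norm z \<le> R2 s \<Longrightarrow> norm (f z) \<le> B"
    using compact_imp_bounded bounded_iff by (metis (no_types) imageI mem_cball_0)
  then show ?thesis
    using AE_planar_min_le[of s]
    by (intro integrable_const_bound[where B = B]) (auto elim!: eventually_mono)
qed

text \<open>The density is even.\<close>
lemma integral_planar_min_id:
  assumes s: "0 < s" "s < 2"
  shows "(\<integral>z. z \<partial>planar_min s) = 0"
proof -
  have "(\<integral>z. z \<partial>planar_min s) = (\<integral>z. z \<partial>distr (planar_min s) borel uminus)"
    by (simp only: distr_planar_min_uminus)
  also have "\<dots> = (\<integral>z. - z \<partial>planar_min s)"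
    by (rule integral_distr) auto
  also have "\<dots> = - (\<integral>z. z \<partial>planar_min s)"
    by simp
  finally have "(\<integral>z. z \<partial>planar_min s) + (\<integral>z. z \<partial>planar_min s) = 0"
    by (metis add.right_inverse)
  then have "2 *\<^sub>R (\<integral>z. z \<partial>planar_min s) = 0"
    by (simp only: scaleR_2)
  then show ?thesis by simp
qed

section \<open>Minimality in the plane\<close>

lemma ennreal_add_right_le_cancel:
  fixes a b c :: ennreal
  assumes "c < \<infinity>" "a + c \<le> b + c"
  shows "a \<le> b"
  using assms ennreal_add_left_cancel_le[of c a b] by (simp add: add.commute less_top[symmetric])

definition pair_energy :: "('a::minus \<Rightarrow> ennreal) \<Rightarrow> 'a measure \<Rightarrow> ennreal" where
  "pair_energy W \<sigma> = (\<integral>\<^sup>+x. (\<integral>\<^sup>+y. W (x - y) \<partial>\<sigma>) \<partial>\<sigma>)"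

definition planar_kernel :: "real \<Rightarrow> real^2 \<Rightarrow> ennreal" where
  "planar_kernel s z = riesz s z + ennreal ((norm z)\<^sup>2)"

lemma planar_kernel_measurable [measurable]: "planar_kernel s \<in> borel_measurable borel"
  unfolding planar_kernel_def by measurable

text \<open>
  Finiteness of the double integral yields one point around which the second moment is finite, and
  hence a mean. The double integral is then twice the variance.
\<close>
lemma finite_second_moment:
  fixes \<sigma> :: "'a::euclidean_space measure"
  assumes "prob_space \<sigma>" and [measurable_cong]: "sets \<sigma> = sets borel"
    and fin: "(\<integral>\<^sup>+x. (\<integral>\<^sup>+y. ennreal ((norm (x - y))\<^sup>2) \<partial>\<sigma>) \<partial>\<sigma>) < \<infinity>"
  defines "m \<equiv> (\<integral>x. x \<partial>\<sigma>)"
  shows "(\<integral>\<^sup>+x. ennreal ((norm (x - m))\<^sup>2) \<partial>\<sigma>) < \<infinity>"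
    and "(\<integral>\<^sup>+x. (\<integral>\<^sup>+y. ennreal ((norm (x - y))\<^sup>2) \<partial>\<sigma>) \<partial>\<sigma>) = 2 * (\<integral>\<^sup>+x. ennreal ((norm (x - m))\<^sup>2) \<partial>\<sigma>)"
proof -
  interpret prob_space \<sigma> by fact
  have "AE x in \<sigma>. (\<integral>\<^sup>+y. ennreal ((norm (x - y))\<^sup>2) \<partial>\<sigma>) \<noteq> \<infinity>"
    using fin by (intro nn_integral_PInf_AE) auto
  then obtain a where a: "(\<integral>\<^sup>+y. ennreal ((norm (a - y))\<^sup>2) \<partial>\<sigma>) \<noteq> \<infinity>"
    using AE_E_prob by (metis (mono_tags, lifting) AE_False eventually_mono)
  have ia: "integrable \<sigma> (\<lambda>y. (norm (a - y))\<^sup>2)"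
    using a by (intro integrableI_nonneg) (auto simp: less_top)
  have i2: "integrable \<sigma> (\<lambda>y. (norm (y - c))\<^sup>2)" for c
  proof (rule Bochner_Integration.integrable_bound)
    show "integrable \<sigma> (\<lambda>y. 2 * (norm (a - y))\<^sup>2 + 2 * (norm (a - c))\<^sup>2)" using ia by auto
    show "AE y in \<sigma>. norm ((norm (y - c))\<^sup>2) \<le> norm (2 * (norm (a - y))\<^sup>2 + 2 * (norm (a - c))\<^sup>2)"
    proof (rule AE_I2)
      fix y
      have "norm (y - c) \<le> norm (a - y) + norm (a - c)"
        using norm_triangle_ineq4[of "a - c" "a - y"] by (simp add: add.commute)
      then have "(norm (y - c))\<^sup>2 \<le> (norm (a - y) + norm (a - c))\<^sup>2" by (intro power_mono) auto
      also have "\<dots> \<le> 2 * (norm (a - y))\<^sup>2 + 2 * (norm (a - c))\<^sup>2"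
        using sum_squares_bound[of "norm (a - y)" "norm (a - c)"] by (simp add: power2_sum)
      finally show "norm ((norm (y - c))\<^sup>2) \<le> norm (2 * (norm (a - y))\<^sup>2 + 2 * (norm (a - c))\<^sup>2)" by simp
    qed
  qed measurable
  have i1: "integrable \<sigma> (\<lambda>y. y)"
  proof (rule Bochner_Integration.integrable_bound)
    show "integrable \<sigma> (\<lambda>y. 1 + (norm (y - 0))\<^sup>2)" by (intro Bochner_Integration.integrable_add i2) auto
    show "AE y in \<sigma>. norm y \<le> norm (1 + (norm (y - 0))\<^sup>2)"
    proof (rule AE_I2)
      fix y :: 'a
      have "norm y \<le> 1 + (norm y)\<^sup>2"
        using sum_squares_bound[of "norm y" 1] norm_ge_zero[of y]
        by (simp only: power_one mult_1_right)
      then show "norm y \<le> norm (1 + (norm (y - 0))\<^sup>2)" by simp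
    qed
  qed measurable
  define V where "V = (\<integral>x. (norm (x - m))\<^sup>2 \<partial>\<sigma>)"
  have V0: "0 \<le> V" unfolding V_def by (intro integral_nonneg_AE) auto
  have V: "(\<integral>\<^sup>+x. ennreal ((norm (x - m))\<^sup>2) \<partial>\<sigma>) = ennreal V"
    unfolding V_def by (intro nn_integral_eq_integral i2) auto
  then show "(\<integral>\<^sup>+x. ennreal ((norm (x - m))\<^sup>2) \<partial>\<sigma>) < \<infinity>" by simp
  have "(\<integral>\<^sup>+y. ennreal ((norm (x - y))\<^sup>2) \<partial>\<sigma>) = ennreal V + ennreal ((norm (x - m))\<^sup>2)" for x
  proof -
    have "(\<integral>\<^sup>+y. ennreal ((norm (x - y))\<^sup>2) \<partial>\<sigma>) = ennreal (\<integral>y. (norm (x - y))\<^sup>2 \<partial>\<sigma>)"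
      using i2[of x] by (intro nn_integral_eq_integral) (auto simp: norm_minus_commute)
    also have "(\<integral>y. (norm (x - y))\<^sup>2 \<partial>\<sigma>) = (\<integral>y. (norm (y - m))\<^sup>2 + 2 * ((y - m) \<bullet> (m - x)) + (norm (x - m))\<^sup>2 \<partial>\<sigma>)"
      by (intro Bochner_Integration.integral_cong refl)
         (simp add: power2_norm_eq_inner algebra_simps inner_commute)
    also have "\<dots> = V + 2 * ((m - m) \<bullet> (m - x)) + (norm (x - m))\<^sup>2"
      using i1 i2[of m] by (simp add: V_def m_def prob_space)
    finally show ?thesis using V0 by simp
  qed
  then have "(\<integral>\<^sup>+x. (\<integral>\<^sup>+y. ennreal ((norm (x - y))\<^sup>2) \<partial>\<sigma>) \<partial>\<sigma>)
     = (\<integral>\<^sup>+x. ennreal V + ennreal ((norm (x - m))\<^sup>2) \<partial>\<sigma>)"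
    by simp
  also have "\<dots> = ennreal V + ennreal V"
    by (subst nn_integral_add) (auto simp: V emeasure_space_1)
  finally show "(\<integral>\<^sup>+x. (\<integral>\<^sup>+y. ennreal ((norm (x - y))\<^sup>2) \<partial>\<sigma>) \<partial>\<sigma>) = 2 * (\<integral>\<^sup>+x. ennreal ((norm (x - m))\<^sup>2) \<partial>\<sigma>)"
    unfolding V by (simp add: mult_2)
qed

lemma pair_energy_planar_kernel:
  assumes "prob_space \<sigma>" and [measurable_cong]: "sets \<sigma> = sets borel"
  shows "pair_energy (planar_kernel s) \<sigma> = mutual_energy s \<sigma> \<sigma> +
     (\<integral>\<^sup>+x. (\<integral>\<^sup>+y. ennreal ((norm (x - y))\<^sup>2) \<partial>\<sigma>) \<partial>\<sigma>)"
proof -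
  interpret prob_space \<sigma> by fact
  show ?thesis
    unfolding pair_energy_def planar_kernel_def mutual_energy_def by (simp add: nn_integral_add)
qed

text \<open>
  Integrating the Euler--Lagrange equality over the measure itself determines the combination of
  energies that the minimality proof compares, and shows that they are finite.
\<close>
lemma planar_min_energy:
  assumes s: "0 < s" "s < 2"
  defines "\<mu> \<equiv> planar_min s" and "A \<equiv> ennreal ((R2 s)\<^sup>2 / (s / 2))"
  shows "mutual_energy s \<mu> \<mu> + (\<integral>\<^sup>+z. ennreal ((norm z)\<^sup>2) \<partial>\<mu>) = A"
    and "pair_energy (planar_kernel s) \<mu> + mutual_energy s \<mu> \<mu> = 2 * A"
    and "pair_energy (planar_kernel s) \<mu> < \<infinity>"
proof -
  interpret prob_space \<mu> unfolding \<mu>_def by (rule prob_space_planar_min[OF s])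
  have [measurable_cong]: "sets \<mu> = sets borel" by (simp add: \<mu>_def)
  have "mutual_energy s \<mu> \<mu> + (\<integral>\<^sup>+z. ennreal ((norm z)\<^sup>2) \<partial>\<mu>)
      = (\<integral>\<^sup>+z. planar_potential s z + ennreal ((norm z)\<^sup>2) \<partial>\<mu>)"
    unfolding mutual_energy_def planar_potential_def \<mu>_def[symmetric]
    by (simp add: nn_integral_add)
  also have "\<dots> = (\<integral>\<^sup>+z. A \<partial>\<mu>)"
    unfolding \<mu>_def A_def using AE_planar_min_le[of s]
    by (intro nn_integral_cong_AE) (auto elim!: eventually_mono simp: planar_potential_bounds(3)[OF s])
  finally show IM: "mutual_energy s \<mu> \<mu> + (\<integral>\<^sup>+z. ennreal ((norm z)\<^sup>2) \<partial>\<mu>) = A"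
    by (simp add: emeasure_space_1)
  have M: "(\<integral>\<^sup>+z. ennreal ((norm z)\<^sup>2) \<partial>\<mu>) < \<infinity>" and I: "mutual_energy s \<mu> \<mu> < \<infinity>"
  proof -
    have "mutual_energy s \<mu> \<mu> + (\<integral>\<^sup>+z. ennreal ((norm z)\<^sup>2) \<partial>\<mu>) < top"
      unfolding IM A_def by simp
    then show "(\<integral>\<^sup>+z. ennreal ((norm z)\<^sup>2) \<partial>\<mu>) < \<infinity>" "mutual_energy s \<mu> \<mu> < \<infinity>"
      by simp_all
  qed
  have m0: "(\<integral>z. z \<partial>\<mu>) = 0" unfolding \<mu>_def by (rule integral_planar_min_id[OF s])
  have bound: "(norm (x - y))\<^sup>2 \<le> 2 * (norm x)\<^sup>2 + 2 * (norm y)\<^sup>2" for x y :: "real^2"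
  proof -
    have "(norm (x - y))\<^sup>2 \<le> (norm x + norm y)\<^sup>2" by (intro power_mono norm_triangle_ineq4) auto
    also have "\<dots> \<le> 2 * (norm x)\<^sup>2 + 2 * (norm y)\<^sup>2"
      using sum_squares_bound[of "norm x" "norm y"] by (simp add: power2_sum)
    finally show ?thesis .
  qed
  have "(\<integral>\<^sup>+x. (\<integral>\<^sup>+y. ennreal ((norm (x - y))\<^sup>2) \<partial>\<mu>) \<partial>\<mu>)
     \<le> (\<integral>\<^sup>+x. (\<integral>\<^sup>+y. 2 * ennreal ((norm x)\<^sup>2) + 2 * ennreal ((norm y)\<^sup>2) \<partial>\<mu>) \<partial>\<mu>)"
  proof (intro nn_integral_mono)
    fix x y :: "real^2"
    have "ennreal ((norm (x - y))\<^sup>2) \<le> ennreal (2 * (norm x)\<^sup>2 + 2 * (norm y)\<^sup>2)"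
      by (intro ennreal_leI bound)
    then show "ennreal ((norm (x - y))\<^sup>2) \<le> 2 * ennreal ((norm x)\<^sup>2) + 2 * ennreal ((norm y)\<^sup>2)"
      by (simp add: ennreal_mult)
  qed
  also have "\<dots> < \<infinity>"
    using M by (simp add: nn_integral_add nn_integral_cmult emeasure_space_1 ennreal_mult_less_top)
  finally have fin: "(\<integral>\<^sup>+x. (\<integral>\<^sup>+y. ennreal ((norm (x - y))\<^sup>2) \<partial>\<mu>) \<partial>\<mu>) < \<infinity>" .
  have E: "pair_energy (planar_kernel s) \<mu> = mutual_energy s \<mu> \<mu> + 2 * (\<integral>\<^sup>+z. ennreal ((norm z)\<^sup>2) \<partial>\<mu>)"
    unfolding pair_energy_planar_kernel[OF prob_space_axioms \<open>sets \<mu> = sets borel\<close>]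
      finite_second_moment(2)[OF prob_space_axioms \<open>sets \<mu> = sets borel\<close> fin] m0 by simp
  show "pair_energy (planar_kernel s) \<mu> + mutual_energy s \<mu> \<mu> = 2 * A"
    unfolding E IM[symmetric] by (simp add: mult_2 distrib_left add_ac)
  show "pair_energy (planar_kernel s) \<mu> < \<infinity>"
    unfolding E using M I by (simp add: ennreal_mult_less_top)
qed

lemma
  fixes s :: real and \<tau> :: "'a::euclidean_space measure"
  assumes [measurable_cong]: "sets \<tau> = sets borel" and "prob_space \<tau>"
  shows mutual_energy_translate_right:
      "mutual_energy s \<sigma> (distr \<tau> borel (\<lambda>z. z + m)) = (\<integral>\<^sup>+x. (\<integral>\<^sup>+y. riesz s (x - m - y) \<partial>\<tau>) \<partial>\<sigma>)"
    and mutual_energy_translate: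
      "mutual_energy s (distr \<tau> borel (\<lambda>z. z + m)) (distr \<tau> borel (\<lambda>z. z + m)) = mutual_energy s \<tau> \<tau>"
proof -
  interpret prob_space \<tau> by fact
  show 1: "mutual_energy s \<sigma> (distr \<tau> borel (\<lambda>z. z + m)) = (\<integral>\<^sup>+x. (\<integral>\<^sup>+y. riesz s (x - m - y) \<partial>\<tau>) \<partial>\<sigma>)" for \<sigma>
    unfolding mutual_energy_def by (intro nn_integral_cong) (simp add: nn_integral_distr algebra_simps)
  show "mutual_energy s (distr \<tau> borel (\<lambda>z. z + m)) (distr \<tau> borel (\<lambda>z. z + m)) = mutual_energy s \<tau> \<tau>"
    unfolding 1 mutual_energy_def by (simp add: nn_integral_distr)
qed

text \<open>
  After translating \<open>planar_min s\<close> to the mean of \<open>\<sigma>\<close>, the confinement energy of \<open>\<sigma>\<close> becomes a single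
  integral \<open>V\<close>. Positive definiteness bounds the self-energy of \<open>\<sigma>\<close> from below by the mutual energy,
  which together with \<open>V\<close> is at least the Euler--Lagrange constant \<open>A\<close>; the measure itself attains
  \<open>A\<close>. Equality of energies forces equality in positive definiteness.
\<close>
theorem planar_min_optimal:
  fixes \<sigma> :: "(real^2) measure"
  assumes s: "0 < s" "s < 2"
    and p: "prob_space \<sigma>" and b [measurable_cong]: "sets \<sigma> = sets borel"
  shows "pair_energy (planar_kernel s) (planar_min s) \<le> pair_energy (planar_kernel s) \<sigma>"
    and "pair_energy (planar_kernel s) \<sigma> = pair_energy (planar_kernel s) (planar_min s) \<Longrightarrow>
         \<exists>m. \<sigma> = distr (planar_min s) borel (\<lambda>z. z + m)"
proof -
  let ?E = "pair_energy (planar_kernel s)"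
  define \<mu> where "\<mu> = planar_min s"
  define A where "A = ennreal ((R2 s)\<^sup>2 / (s / 2))"
  interpret S: prob_space \<sigma> by fact
  interpret M: prob_space \<mu> unfolding \<mu>_def by (rule prob_space_planar_min[OF s])
  have bM [measurable_cong]: "sets \<mu> = sets borel" by (simp add: \<mu>_def)
  note min = planar_min_energy[OF s, folded \<mu>_def A_def]
  have I: "mutual_energy s \<mu> \<mu> < \<infinity>"
  proof -
    have "mutual_energy s \<mu> \<mu> + (\<integral>\<^sup>+z. ennreal ((norm z)\<^sup>2) \<partial>\<mu>) < top"
      unfolding min(1) A_def by simp
    then show ?thesis by simp
  qed
  have key: "\<exists>m V. V < \<infinity> \<and> ?E \<sigma> = mutual_energy s \<sigma> \<sigma> + 2 * V \<and>
      A \<le> mutual_energy s \<sigma> (distr \<mu> borel (\<lambda>z. z + m)) + V" if fin: "?E \<sigma> < \<infinity>"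
  proof -
    define m where "m = (\<integral>x. x \<partial>\<sigma>)"
    define V where "V = (\<integral>\<^sup>+x. ennreal ((norm (x - m))\<^sup>2) \<partial>\<sigma>)"
    note E = pair_energy_planar_kernel[OF p b]
    have "(\<integral>\<^sup>+x. (\<integral>\<^sup>+y. ennreal ((norm (x - y))\<^sup>2) \<partial>\<sigma>) \<partial>\<sigma>) < \<infinity>"
      using fin unfolding E by (simp add: less_top)
    note V = finite_second_moment[OF p b this, folded m_def, folded V_def]
    have "A = (\<integral>\<^sup>+x. A \<partial>\<sigma>)" by (simp add: S.emeasure_space_1)
    also have "\<dots> \<le> (\<integral>\<^sup>+x. planar_potential s (x - m) + ennreal ((norm (x - m))\<^sup>2) \<partial>\<sigma>)"
      unfolding A_def by (intro nn_integral_mono planar_potential_bounds(2)[OF s])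
    also have "\<dots> = mutual_energy s \<sigma> (distr \<mu> borel (\<lambda>z. z + m)) + V"
      unfolding mutual_energy_translate_right[OF bM M.prob_space_axioms] planar_potential_def \<mu>_def[symmetric] V_def
      by (subst nn_integral_add) simp_all
    finally show ?thesis using V(1) unfolding E V(2) by (intro exI[of _ m] exI[of _ V]) simp
  qed
  have trans: "prob_space (distr \<mu> borel (\<lambda>z. z + m))" for m
    by (rule M.prob_space_distr) simp
  note pd = mutual_energy_positive_definite[OF s(1) p trans b, unfolded mutual_energy_translate[OF bM M.prob_space_axioms]]
  show "?E (planar_min s) \<le> ?E \<sigma>"
  proof (cases "?E \<sigma> < \<infinity>")
    case True
    then obtain m V where V: "V < \<infinity>" "?E \<sigma> = mutual_energy s \<sigma> \<sigma> + 2 * V"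
        "A \<le> mutual_energy s \<sigma> (distr \<mu> borel (\<lambda>z. z + m)) + V"
      using key by blast
    have "?E \<mu> + mutual_energy s \<mu> \<mu> = 2 * A" by (rule min(2))
    also have "\<dots> \<le> 2 * mutual_energy s \<sigma> (distr \<mu> borel (\<lambda>z. z + m)) + 2 * V"
      using mult_left_mono[OF V(3), of 2] by (simp add: distrib_left)
    also have "\<dots> \<le> mutual_energy s \<sigma> \<sigma> + mutual_energy s \<mu> \<mu> + 2 * V"
      by (intro add_right_mono pd(1)) simp
    also have "\<dots> = ?E \<sigma> + mutual_energy s \<mu> \<mu>" unfolding V(2) by (simp add: add_ac)
    finally show ?thesis
      using ennreal_add_right_le_cancel[OF I] unfolding \<mu>_def[symmetric] by blast
  qed (auto simp: not_less top_unique)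
  assume eq: "?E \<sigma> = ?E (planar_min s)"
  then have "?E \<sigma> < \<infinity>" using min(3) by (simp add: \<mu>_def)
  then obtain m V where V: "V < \<infinity>" "?E \<sigma> = mutual_energy s \<sigma> \<sigma> + 2 * V"
      "A \<le> mutual_energy s \<sigma> (distr \<mu> borel (\<lambda>z. z + m)) + V"
    using key by blast
  have "mutual_energy s \<sigma> \<sigma> + mutual_energy s \<mu> \<mu> + 2 * V = ?E \<mu> + mutual_energy s \<mu> \<mu>"
    using eq V(2) by (simp add: \<mu>_def add_ac)
  also have "\<dots> = 2 * A" by (rule min(2))
  also have "\<dots> \<le> 2 * mutual_energy s \<sigma> (distr \<mu> borel (\<lambda>z. z + m)) + 2 * V"
    using mult_left_mono[OF V(3), of 2] by (simp add: distrib_left)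
  finally have le_V: "mutual_energy s \<sigma> \<sigma> + mutual_energy s \<mu> \<mu> + 2 * V
      \<le> 2 * mutual_energy s \<sigma> (distr \<mu> borel (\<lambda>z. z + m)) + 2 * V" .
  have "2 * V < \<infinity>" using V(1) by (simp add: ennreal_mult_less_top)
  then have le: "mutual_energy s \<sigma> \<sigma> + mutual_energy s \<mu> \<mu> \<le> 2 * mutual_energy s \<sigma> (distr \<mu> borel (\<lambda>z. z + m))"
    using le_V by (rule ennreal_add_right_le_cancel)
  have "mutual_energy s \<sigma> \<sigma> + mutual_energy s \<mu> \<mu> < \<infinity>"
    using I \<open>?E \<sigma> < \<infinity>\<close> V(2) by simp
  then have "2 * mutual_energy s \<sigma> (distr \<mu> borel (\<lambda>z. z + m)) < \<infinity>"
    by (rule le_less_trans[OF pd(1)[OF sets_distr]])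
  then have "mutual_energy s \<sigma> (distr \<mu> borel (\<lambda>z. z + m)) < \<infinity>"
    by (auto simp: ennreal_mult_less_top)
  then have "\<sigma> = distr \<mu> borel (\<lambda>z. z + m)"
    using le by (intro prob_measure_eqI_smear[OF p trans b] pd(2)) auto
  then show "\<exists>m. \<sigma> = distr (planar_min s) borel (\<lambda>z. z + m)"
    unfolding \<mu>_def by blast
qed

section \<open>Tilted projections onto the plane\<close>

definition embed_plane :: "real^2 \<Rightarrow> real^3" where
  "embed_plane z = vector [z $ 1, z $ 2, 0]"

definition horizontal :: "real^3 \<Rightarrow> real^2" where
  "horizontal x = vector [x $ 1, x $ 2]"

text \<open>
  The projection onto the plane \<open>x\<^sub>3 = 0\<close> along the direction \<open>(- b, 1)\<close>; it restricts to the
  identity of that plane.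
\<close>
definition tilt :: "real^2 \<Rightarrow> real^3 \<Rightarrow> real^2" where
  "tilt b x = horizontal x + (x $ 3) *\<^sub>R b"

lemma horizontal_minus: "horizontal (x - y) = horizontal x - horizontal y"
  by (simp add: horizontal_def vec_eq_iff forall_2)

lemma tilt_minus: "tilt b (x - y) = tilt b x - tilt b y"
  by (simp add: tilt_def horizontal_minus algebra_simps)

lemma horizontal_embed_plane [simp]: "horizontal (embed_plane z) = z"
  by (simp add: horizontal_def embed_plane_def vec_eq_iff forall_2)

lemma embed_plane_3 [simp]: "embed_plane z $ 3 = 0"
  by (simp add: embed_plane_def)

lemma norm_horizontal: "(norm x)\<^sup>2 = (norm (horizontal x))\<^sup>2 + (x $ 3)\<^sup>2"
  unfolding power2_norm_eq_inner by (simp add: inner_vec_def sum_2 sum_3 horizontal_def power2_eq_square)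

lemma norm_horizontal_flat: "x $ 3 = 0 \<Longrightarrow> norm (horizontal x) = norm x"
  using norm_horizontal[of x] by (simp add: power2_eq_iff_nonneg)

lemma horizontal_measurable [measurable]: "horizontal \<in> borel_measurable borel"
proof -
  have "linear horizontal"
    by (rule linearI) (simp_all add: horizontal_def vec_eq_iff forall_2)
  then show ?thesis
    by (intro borel_measurable_continuous_onI linear_continuous_on) (simp only: linear_conv_bounded_linear)
qed

lemma embed_plane_measurable [measurable]: "embed_plane \<in> borel_measurable borel"
proof -
  have "linear embed_plane"
    by (rule linearI) (simp_all add: embed_plane_def vec_eq_iff forall_3)
  then show ?thesis
    by (intro borel_measurable_continuous_onI linear_continuous_on) (simp only: linear_conv_bounded_linear)
qed

lemma vec_nth_measurable [measurable (raw)]: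
  fixes f :: "'b \<Rightarrow> real^'n"
  assumes "f \<in> borel_measurable M"
  shows "(\<lambda>x. f x $ i) \<in> borel_measurable M"
  using assms by (rule measurable_compose) (intro borel_measurable_continuous_onI continuous_intros)

lemma tilt_measurable [measurable (raw)]:
  assumes [measurable]: "f \<in> borel_measurable M" "g \<in> borel_measurable M"
  shows "(\<lambda>x. tilt (f x) (g x)) \<in> borel_measurable M"
  unfolding tilt_def by measurable

lemma rho2D_eq: "rho2D s = distr (planar_min s) borel embed_plane"
  by (simp add: rho2D_def planar_min_def embed_plane_def[abs_def])

text \<open>
  The average of the planar kernel over tilted projections. Drawing the slope from a multiple of the
  planar minimizer itself makes the average of \<open>|z + h c b|\<^sup>-\<^sup>s\<close> a value of the planar potential, whose
  bounds are already known.
\<close>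
definition tilted_kernel :: "real \<Rightarrow> real \<Rightarrow> real^3 \<Rightarrow> ennreal" where
  "tilted_kernel s c x = (\<integral>\<^sup>+b. planar_kernel s (tilt (c *\<^sub>R b) x) \<partial>planar_min s)"

lemma tilted_kernel_measurable [measurable]:
  assumes "0 < s" "s < 2"
  shows "tilted_kernel s c \<in> borel_measurable borel"
proof -
  interpret prob_space "planar_min s" by (rule prob_space_planar_min[OF assms])
  show ?thesis unfolding tilted_kernel_def by measurable
qed

text \<open>
  For each fixed slope the energy is the planar energy of the image of \<open>\<sigma>\<close> under a projection.
\<close>
lemma tilted_kernel_energy_ge:
  fixes \<sigma> :: "(real^3) measure"
  assumes s: "0 < s" "s < 2" and "prob_space \<sigma>" and [measurable_cong]: "sets \<sigma> = sets borel"
  shows "pair_energy (planar_kernel s) (planar_min s) \<le> pair_energy (tilted_kernel s c) \<sigma>"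
proof -
  interpret S: prob_space \<sigma> by fact
  interpret M: prob_space "planar_min s" by (rule prob_space_planar_min[OF s])
  note sf = S.sigma_finite_measure_axioms M.sigma_finite_measure_axioms
  let ?E = "pair_energy (planar_kernel s)"
  let ?k = "\<lambda>b x y. planar_kernel s (tilt (c *\<^sub>R b) (x - y))"
  have b: "?E (planar_min s) \<le> (\<integral>\<^sup>+x. (\<integral>\<^sup>+y. ?k b x y \<partial>\<sigma>) \<partial>\<sigma>)" for b
  proof -
    have "?E (planar_min s) \<le> ?E (distr \<sigma> borel (tilt (c *\<^sub>R b)))"
      by (intro planar_min_optimal(1)[OF s] S.prob_space_distr) auto
    also have "\<dots> = (\<integral>\<^sup>+x. (\<integral>\<^sup>+y. ?k b x y \<partial>\<sigma>) \<partial>\<sigma>)"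
      unfolding pair_energy_def by (simp add: nn_integral_distr tilt_minus)
    finally show ?thesis .
  qed
  have "?E (planar_min s) = (\<integral>\<^sup>+b. ?E (planar_min s) \<partial>planar_min s)"
    using M.emeasure_space_1 by simp
  also have "\<dots> \<le> (\<integral>\<^sup>+b. (\<integral>\<^sup>+x. (\<integral>\<^sup>+y. ?k b x y \<partial>\<sigma>) \<partial>\<sigma>) \<partial>planar_min s)"
    by (intro nn_integral_mono b)
  also have "\<dots> = (\<integral>\<^sup>+x. (\<integral>\<^sup>+b. (\<integral>\<^sup>+y. ?k b x y \<partial>\<sigma>) \<partial>planar_min s) \<partial>\<sigma>)"
    by (rule nn_integral_swap[OF sf(2,1)]) measurable
  also have "\<dots> = (\<integral>\<^sup>+x. (\<integral>\<^sup>+y. (\<integral>\<^sup>+b. ?k b x y \<partial>planar_min s) \<partial>\<sigma>) \<partial>\<sigma>)"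
    by (intro nn_integral_cong nn_integral_swap[OF sf(2,1)]) measurable
  finally show ?thesis unfolding pair_energy_def tilted_kernel_def .
qed

text \<open>
  Young's inequality interpolates between the exponents \<open>0\<close> and \<open>1\<close>, and for exponent \<open>1\<close> the bound is
  a polynomial inequality.
\<close>
lemma powr_neg_one_plus_le:
  fixes u g :: real
  assumes "- 1 / 2 \<le> u" "0 \<le> g" "g \<le> 1"
  shows "(1 + u) powr (- g) \<le> 1 - g * u + 2 * u\<^sup>2"
proof -
  have pos: "0 < 1 + u" using assms(1) by simp
  have "(1 + u) powr (- g) = (1 / (1 + u)) powr g * 1 powr (1 - g)"
    using pos by (simp add: powr_minus_divide powr_divide)
  also have "\<dots> \<le> g * (1 / (1 + u)) + (1 - g) * 1"
    using pos assms by (intro Youngs_inequality_0) auto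
  also have "\<dots> \<le> g * (1 - u + 2 * u\<^sup>2) + (1 - g) * 1"
  proof -
    have "0 \<le> u\<^sup>2 * (1 + 2 * u)" using assms(1) by (intro mult_nonneg_nonneg) auto
    then have "1 \<le> (1 - u + 2 * u\<^sup>2) * (1 + u)"
      by (simp add: algebra_simps power2_eq_square power3_eq_cube)
    then have "1 / (1 + u) \<le> 1 - u + 2 * u\<^sup>2"
      using pos by (simp add: pos_divide_le_eq)
    then show ?thesis using assms(2) by (intro add_right_mono mult_left_mono)
  qed
  also have "\<dots> = 1 - g * u + g * (2 * u\<^sup>2)" by (simp add: algebra_simps)
  also have "g * (2 * u\<^sup>2) \<le> 1 * (2 * u\<^sup>2)" using assms(3) by (intro mult_right_mono) auto
  finally show ?thesis by simp
qed

text \<open>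
  Near the plane the tilted kernel is expanded to second order in \<open>h\<close>. The first-order term is kept
  exactly, because it is linear in \<open>b\<close> and vanishes after averaging.
\<close>
lemma riesz_expand:
  fixes z b :: "'a::real_inner"
  assumes s: "0 < s" "s < 2" and z: "z \<noteq> 0" and h: "\<bar>h\<bar> \<le> norm z / 4" and b: "norm b \<le> 1 / 2"
  defines "N \<equiv> (norm z)\<^sup>2 + h\<^sup>2"
  shows "riesz s (z + h *\<^sub>R b)
    \<le> ennreal (N powr (- (s / 2)) * (1 + 5 * h\<^sup>2 / N - s * h / N * (z \<bullet> b)))"
proof -
  define u where "u = (2 * h * (z \<bullet> b) + h\<^sup>2 * (norm b)\<^sup>2 - h\<^sup>2) / N"
  have z0: "0 < norm z" using z by simp
  have N: "0 < N" unfolding N_def using z0 by (intro add_pos_nonneg) auto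
  have zN: "(norm z)\<^sup>2 \<le> N" "h\<^sup>2 \<le> N" by (auto simp: N_def)
  have nrm: "(norm (z + h *\<^sub>R b))\<^sup>2 = N * (1 + u)"
  proof -
    have "N * (1 + u) = N + (2 * h * (z \<bullet> b) + h\<^sup>2 * (norm b)\<^sup>2 - h\<^sup>2)"
      using N by (simp add: u_def distrib_left)
    then show ?thesis
      unfolding N_def power2_norm_eq_inner by (simp add: algebra_simps inner_commute power2_eq_square)
  qed
  have zb: "\<bar>z \<bullet> b\<bar> \<le> norm z * (1 / 2)"
    by (rule order_trans[OF Cauchy_Schwarz_ineq2]) (intro mult_left_mono b, simp)
  have b2: "(norm b)\<^sup>2 \<le> 1" using power_mono[OF b, of 2] by (simp add: power_divide)
  have "\<bar>u\<bar> * N = \<bar>2 * h * (z \<bullet> b) + (h\<^sup>2 * (norm b)\<^sup>2 - h\<^sup>2)\<bar>"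
    using N by (simp add: u_def abs_divide)
  also have "\<dots> \<le> \<bar>2 * h * (z \<bullet> b)\<bar> + \<bar>h\<^sup>2 * (norm b)\<^sup>2 - h\<^sup>2\<bar>" by (rule abs_triangle_ineq)
  also have "\<bar>2 * h * (z \<bullet> b)\<bar> \<le> \<bar>h\<bar> * norm z"
    using mult_left_mono[OF zb, of "2 * \<bar>h\<bar>"] by (simp add: abs_mult)
  also have "\<bar>h\<^sup>2 * (norm b)\<^sup>2 - h\<^sup>2\<bar> \<le> h\<^sup>2"
    using mult_left_mono[OF b2, of "h\<^sup>2"] by (simp add: abs_le_iff)
  finally have uN: "\<bar>u\<bar> * N \<le> \<bar>h\<bar> * (norm z + \<bar>h\<bar>)" by (simp add: algebra_simps power2_eq_square)
  also have "\<dots> \<le> (norm z / 4) * (norm z + norm z / 4)"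
    using h z0 by (intro mult_mono) auto
  also have "\<dots> \<le> (1 / 2) * (norm z)\<^sup>2" by (simp add: power2_eq_square)
  also have "\<dots> \<le> (1 / 2) * N" using zN by simp
  finally have u12: "\<bar>u\<bar> \<le> 1 / 2" using N by simp
  have "(\<bar>u\<bar> * N)\<^sup>2 \<le> (\<bar>h\<bar> * (norm z + \<bar>h\<bar>))\<^sup>2" using uN N by (intro power_mono) auto
  also have "\<dots> = h\<^sup>2 * (norm z + \<bar>h\<bar>)\<^sup>2" by (simp add: power_mult_distrib)
  also have "(norm z + \<bar>h\<bar>)\<^sup>2 \<le> 2 * N"
    using sum_squares_bound[of "norm z" "\<bar>h\<bar>"] by (simp add: N_def power2_sum)
  finally have "u\<^sup>2 * N\<^sup>2 \<le> h\<^sup>2 * (2 * N)" by (simp add: power_mult_distrib mult_left_mono)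
  then have u2: "u\<^sup>2 \<le> 2 * h\<^sup>2 / N"
    using N by (simp add: field_simps power2_eq_square)
  have lin: "- (s / 2) * u \<le> h\<^sup>2 / N - s * h / N * (z \<bullet> b)"
  proof -
    have "- (s / 2) * u = s / 2 * (h\<^sup>2 - h\<^sup>2 * (norm b)\<^sup>2) / N - s * h / N * (z \<bullet> b)"
      using N by (simp add: u_def field_simps)
    moreover have "s / 2 * (h\<^sup>2 - h\<^sup>2 * (norm b)\<^sup>2) / N \<le> 1 * h\<^sup>2 / N"
      using s b2 N by (intro divide_right_mono mult_mono) (auto simp: mult_left_le)
    ultimately show ?thesis by simp
  qed
  have nz: "0 < 1 + u" using u12 by simp
  have ne: "z + h *\<^sub>R b \<noteq> 0" using nrm N nz by auto
  have "norm (z + h *\<^sub>R b) powr (- s) = ((norm (z + h *\<^sub>R b))\<^sup>2) powr (- (s / 2))"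
    using ne by (simp add: powr_numeral[symmetric] powr_powr del: powr_numeral)
  also have "\<dots> = N powr (- (s / 2)) * (1 + u) powr (- (s / 2))"
    unfolding nrm using N nz by (simp add: powr_mult)
  also have "\<dots> \<le> N powr (- (s / 2)) * (1 + 5 * h\<^sup>2 / N - s * h / N * (z \<bullet> b))"
  proof (rule mult_left_mono)
    have "(1 + u) powr (- (s / 2)) \<le> 1 - (s / 2) * u + 2 * u\<^sup>2"
      using u12 s by (intro powr_neg_one_plus_le) auto
    then show "(1 + u) powr (- (s / 2)) \<le> 1 + 5 * h\<^sup>2 / N - s * h / N * (z \<bullet> b)"
      using lin u2 by simp
  qed simp
  finally show ?thesis using ne by (simp add: riesz_def ennreal_leI)
qed

section \<open>The averaged tilted kernel\<close>

lemma nn_integral_planar_min_affine: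
  assumes s: "0 < s" "s < 2" and nonneg: "\<And>b. norm b \<le> R2 s \<Longrightarrow> 0 \<le> p + v \<bullet> b"
  shows "(\<integral>\<^sup>+b. ennreal (p + v \<bullet> b) \<partial>planar_min s) = ennreal p"
proof -
  interpret M: prob_space "planar_min s" by (rule prob_space_planar_min[OF s])
  have i: "integrable (planar_min s) (\<lambda>b. b)" by (intro integrable_planar_min[OF s] continuous_intros)
  have "(\<integral>\<^sup>+b. ennreal (p + v \<bullet> b) \<partial>planar_min s) = ennreal (\<integral>b. p + v \<bullet> b \<partial>planar_min s)"
    using AE_planar_min_le[of s] nonneg
    by (intro nn_integral_eq_integral integrable_planar_min[OF s] continuous_intros) (auto elim!: eventually_mono)
  also have "(\<integral>b. p + v \<bullet> b \<partial>planar_min s) = p + v \<bullet> (\<integral>b. b \<partial>planar_min s)"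
    using i M.prob_space by simp
  finally show ?thesis by (simp add: integral_planar_min_id[OF s])
qed

text \<open>The slopes of the tilted projections are then of norm at most \<open>1 / 2\<close>.\<close>
definition tilt_scale :: "real \<Rightarrow> real" where
  "tilt_scale s = 1 / (2 * R2 s)"

lemma tilt_scale_pos: "0 < s \<Longrightarrow> s < 2 \<Longrightarrow> 0 < tilt_scale s"
  using planar_consts_pos[of s] by (simp add: tilt_scale_def)

lemma norm_tilt_scale_le:
  assumes "0 < s" "s < 2" "norm b \<le> R2 s"
  shows "norm (tilt_scale s *\<^sub>R b) \<le> 1 / 2"
  using planar_consts_pos[OF assms(1,2)] assms(3) by (simp add: tilt_scale_def field_simps)

lemma averaged_square:
  assumes s: "0 < s" "s < 2"
  shows "(\<integral>\<^sup>+b. ennreal ((norm (z + h *\<^sub>R (tilt_scale s *\<^sub>R b)))\<^sup>2) \<partial>planar_min s)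
    \<le> ennreal ((norm z)\<^sup>2 + h\<^sup>2 / 4)"
proof -
  let ?c = "tilt_scale s"
  let ?v = "(2 * h * ?c) *\<^sub>R z"
  have pt: "(norm (z + h *\<^sub>R (?c *\<^sub>R b)))\<^sup>2 \<le> ((norm z)\<^sup>2 + h\<^sup>2 / 4) + ?v \<bullet> b"
    if "norm b \<le> R2 s" for b
  proof -
    have "(norm (z + h *\<^sub>R (?c *\<^sub>R b)))\<^sup>2 = (norm z)\<^sup>2 + ?v \<bullet> b + h\<^sup>2 * (norm (?c *\<^sub>R b))\<^sup>2"
      unfolding power2_norm_eq_inner by (simp add: algebra_simps inner_commute power2_eq_square)
    moreover have "(norm (?c *\<^sub>R b))\<^sup>2 \<le> (1 / 2)\<^sup>2"
      by (intro power_mono norm_tilt_scale_le[OF s that]) auto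
    then have "h\<^sup>2 * (norm (?c *\<^sub>R b))\<^sup>2 \<le> h\<^sup>2 * (1 / 2)\<^sup>2" by (intro mult_left_mono) auto
    ultimately show ?thesis by (simp add: power_divide)
  qed
  have "(\<integral>\<^sup>+b. ennreal ((norm (z + h *\<^sub>R (?c *\<^sub>R b)))\<^sup>2) \<partial>planar_min s)
     \<le> (\<integral>\<^sup>+b. ennreal (((norm z)\<^sup>2 + h\<^sup>2 / 4) + ?v \<bullet> b) \<partial>planar_min s)"
    by (rule nn_integral_mono_AE, use AE_planar_min_le[of s] in eventually_elim) (intro ennreal_leI pt)
  also have "\<dots> = ennreal ((norm z)\<^sup>2 + h\<^sup>2 / 4)"
    using order_trans[OF zero_le_power2 pt] by (intro nn_integral_planar_min_affine[OF s])
  finally show ?thesis .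
qed

text \<open>
  The linear term of the expansion integrates to \<open>0\<close>, so the average exceeds \<open>N\<^bsup>- s / 2\<^esup>\<close> only
  by a relative error of order \<open>h\<^sup>2 / N\<close>.
\<close>
lemma averaged_riesz_near_plane:
  fixes z :: "real^2"
  assumes s: "0 < s" "s < 2" and z: "z \<noteq> 0" and h: "\<bar>h\<bar> \<le> norm z / 4"
  defines "N \<equiv> (norm z)\<^sup>2 + h\<^sup>2"
  shows "(\<integral>\<^sup>+b. riesz s (z + h *\<^sub>R (tilt_scale s *\<^sub>R b)) \<partial>planar_min s)
    \<le> ennreal (N powr (- (s / 2)) * (1 + 5 * h\<^sup>2 / N))"
proof -
  let ?c = "tilt_scale s"
  have N: "0 < N" unfolding N_def using z by (intro add_pos_nonneg) auto
  define p where "p = N powr (- (s / 2)) * (1 + 5 * h\<^sup>2 / N)"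
  define v where "v = - (N powr (- (s / 2)) * (s * h / N) * ?c) *\<^sub>R z"
  have eq: "N powr (- (s / 2)) * (1 + 5 * h\<^sup>2 / N - s * h / N * (z \<bullet> (?c *\<^sub>R b))) = p + v \<bullet> b" for b
    by (simp add: p_def v_def algebra_simps)
  have pt: "riesz s (z + h *\<^sub>R (?c *\<^sub>R b)) \<le> ennreal (p + v \<bullet> b)" if "norm b \<le> R2 s" for b
    using riesz_expand[OF s z h norm_tilt_scale_le[OF s that]] unfolding N_def[symmetric] eq .
  have "\<bar>v \<bullet> b\<bar> \<le> p" if b: "norm b \<le> R2 s" for b
  proof -
    have zb: "\<bar>z \<bullet> (?c *\<^sub>R b)\<bar> \<le> norm z * (1 / 2)"
      by (rule order_trans[OF Cauchy_Schwarz_ineq2]) (intro mult_left_mono norm_tilt_scale_le[OF s b], simp)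
    have sh: "\<bar>s * h\<bar> \<le> 2 * (norm z / 4)"
      unfolding abs_mult using s h by (intro mult_mono) auto
    have "\<bar>s * h * (z \<bullet> (?c *\<^sub>R b))\<bar> \<le> 2 * (norm z / 4) * (norm z * (1 / 2))"
      unfolding abs_mult[of "s * h"] by (intro mult_mono sh zb) auto
    also have "\<dots> \<le> N" by (simp add: N_def power2_eq_square)
    finally have "\<bar>s * h / N * (z \<bullet> (?c *\<^sub>R b))\<bar> \<le> 1"
      using N by (simp add: abs_mult abs_divide)
    then have "\<bar>s * h / N * (z \<bullet> (?c *\<^sub>R b))\<bar> \<le> 1 + 5 * h\<^sup>2 / N" using N by (simp add: add_increasing2)
    then have "N powr (- (s / 2)) * \<bar>s * h / N * (z \<bullet> (?c *\<^sub>R b))\<bar> \<le> p"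
      unfolding p_def by (intro mult_left_mono) auto
    moreover have "v \<bullet> b = - (N powr (- (s / 2)) * (s * h / N * (z \<bullet> (?c *\<^sub>R b))))"
      by (simp add: v_def)
    ultimately show ?thesis by (simp add: abs_mult)
  qed
  then have nn: "0 \<le> p + v \<bullet> b" if "norm b \<le> R2 s" for b
    using that by (fastforce simp: abs_le_iff)
  have "(\<integral>\<^sup>+b. riesz s (z + h *\<^sub>R (?c *\<^sub>R b)) \<partial>planar_min s) \<le> (\<integral>\<^sup>+b. ennreal (p + v \<bullet> b) \<partial>planar_min s)"
    by (rule nn_integral_mono_AE, use AE_planar_min_le[of s] in eventually_elim) (rule pt)
  also have "\<dots> = ennreal p" by (intro nn_integral_planar_min_affine[OF s] nn)
  finally show ?thesis unfolding p_def .
qed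

lemma riesz_scale:
  assumes "k \<noteq> 0"
  shows "riesz s (k *\<^sub>R z) = ennreal (\<bar>k\<bar> powr (- s)) * riesz s z"
  using assms by (simp add: riesz_def powr_mult ennreal_mult ennreal_mult_top)

text \<open>
  The summand \<open>5\<close> comes from the second-order expansion near the plane, and \<open>289 = 17\<^sup>2\<close> from the cone
  \<open>|z| < 4 |h|\<close>, in which \<open>|x|\<^sup>2 < 17 h\<^sup>2\<close>.
\<close>
definition collapse_const :: "real \<Rightarrow> real" where
  "collapse_const s = 5 + 289 * (tilt_scale s powr (- s) * ((R2 s)\<^sup>2 / (s / 2)))"

text \<open>
  Away from the plane only boundedness is needed: up to scaling, the average is a value of the
  planar potential, which is at most its value at the origin.
\<close>
lemma averaged_riesz_off_plane:
  fixes z :: "real^2"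
  assumes s: "0 < s" "s < 2" and h: "norm z / 4 < \<bar>h\<bar>"
  defines "N \<equiv> (norm z)\<^sup>2 + h\<^sup>2"
  shows "(\<integral>\<^sup>+b. riesz s (z + h *\<^sub>R (tilt_scale s *\<^sub>R b)) \<partial>planar_min s)
    \<le> ennreal (N powr (- (s / 2)) * (collapse_const s * h\<^sup>2 / N))"
proof -
  let ?c = "tilt_scale s" and ?A = "(R2 s)\<^sup>2 / (s / 2)"
  have c: "0 < ?c" by (rule tilt_scale_pos[OF s])
  have h0: "h \<noteq> 0" using h norm_ge_zero[of z] by auto
  have h2: "0 < h\<^sup>2" using h0 by simp
  have N: "0 < N" unfolding N_def using h2 by (intro add_nonneg_pos) auto
  have N17: "N \<le> 17 * h\<^sup>2"
  proof -
    have "norm z \<le> 4 * \<bar>h\<bar>" using h by simp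
    then have "(norm z)\<^sup>2 \<le> (4 * \<bar>h\<bar>)\<^sup>2" by (intro power_mono) auto
    then show ?thesis by (simp add: N_def power_mult_distrib)
  qed
  \<comment> \<open>Factoring out \<open>k\<close> turns \<open>z + h c b\<close> into a difference \<open>z / k - b\<close>, the argument of the planar potential.\<close>
  define k where "k = - (h * ?c)"
  have k: "k \<noteq> 0" "\<bar>k\<bar> = \<bar>h\<bar> * ?c" using h0 c by (auto simp: k_def abs_mult)
  have "z + h *\<^sub>R (?c *\<^sub>R b) = k *\<^sub>R ((1 / k) *\<^sub>R z - b)" for b
    using k by (simp add: scaleR_diff_right) (simp add: k_def)
  then have "(\<integral>\<^sup>+b. riesz s (z + h *\<^sub>R (?c *\<^sub>R b)) \<partial>planar_min s)
      = ennreal (\<bar>k\<bar> powr (- s)) * planar_potential s ((1 / k) *\<^sub>R z)"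
    unfolding planar_potential_def by (simp only: riesz_scale[OF k(1)]) (simp add: nn_integral_cmult)
  also have "\<dots> \<le> ennreal (\<bar>k\<bar> powr (- s)) * ennreal ?A"
    by (intro mult_left_mono planar_potential_bounds(1)[OF s]) simp
  also have "\<dots> = ennreal (\<bar>k\<bar> powr (- s) * ?A)"
    using s by (intro ennreal_mult[symmetric]) auto
  also have "\<dots> \<le> ennreal (N powr (- (s / 2)) * (collapse_const s * h\<^sup>2 / N))"
  proof (rule ennreal_leI)
    have "\<bar>h\<bar> powr (- s) = (h\<^sup>2) powr (- (s / 2))"
    proof -
      have "(h\<^sup>2) powr (- (s / 2)) = (\<bar>h\<bar>\<^sup>2) powr (- (s / 2))" by simp
      also have "\<dots> = \<bar>h\<bar> powr (- s)"
        using h0 by (simp only: powr_numeral[symmetric] powr_powr abs_ge_zero) simp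
      finally show ?thesis ..
    qed
    also have "\<dots> \<le> (N / 17) powr (- (s / 2))"
      using N17 N s by (intro powr_mono2') auto
    also have "\<dots> = 17 powr (s / 2) * N powr (- (s / 2))"
      using N by (simp add: powr_divide powr_minus field_simps)
    also have "\<dots> \<le> 17 powr 1 * N powr (- (s / 2))"
      using s by (intro mult_right_mono powr_mono) auto
    finally have hN: "\<bar>h\<bar> powr (- s) \<le> 17 * N powr (- (s / 2))" by simp
    have A0: "0 \<le> ?A" using s by simp
    have "\<bar>k\<bar> powr (- s) * ?A = \<bar>h\<bar> powr (- s) * (?c powr (- s) * ?A)"
      unfolding k(2) using c by (simp add: powr_mult)
    also have "\<dots> \<le> (17 * N powr (- (s / 2))) * (?c powr (- s) * ?A)"
      using hN A0 by (intro mult_right_mono mult_nonneg_nonneg) auto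
    also have "\<dots> = N powr (- (s / 2)) * (289 * (?c powr (- s) * ?A) * (1 / 17))"
      by simp
    also have "\<dots> \<le> N powr (- (s / 2)) * (collapse_const s * (h\<^sup>2 / N))"
    proof (intro mult_left_mono mult_mono)
      show "1 / 17 \<le> h\<^sup>2 / N" using N N17 by (simp add: field_simps)
      show "0 \<le> collapse_const s" unfolding collapse_const_def using A0 by (intro add_nonneg_nonneg mult_nonneg_nonneg) auto
    qed (auto simp: collapse_const_def)
    finally show "\<bar>k\<bar> powr (- s) * ?A \<le> N powr (- (s / 2)) * (collapse_const s * h\<^sup>2 / N)" by simp
  qed
  finally show ?thesis .
qed

lemma collapse_const_ge: "0 < s \<Longrightarrow> 5 \<le> collapse_const s"
  unfolding collapse_const_def by simp

text \<open>
  The confinement term keeps only \<open>x\<^sub>3\<^sup>2 / 4\<close> in place of \<open>x\<^sub>3\<^sup>2\<close>. This slack later makes the comparison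
  with the anisotropic potential strict off the plane.
\<close>
lemma tilted_kernel_le:
  assumes s: "0 < s" "s < 2" and x: "x \<noteq> 0"
  shows "tilted_kernel s (tilt_scale s) x
    \<le> ennreal (norm x powr (- s) * (1 + collapse_const s * (x $ 3)\<^sup>2 / (norm x)\<^sup>2)
         + ((norm (horizontal x))\<^sup>2 + (x $ 3)\<^sup>2 / 4))"
proof -
  interpret M: prob_space "planar_min s" by (rule prob_space_planar_min[OF s])
  define z where "z = horizontal x"
  define h where "h = x $ 3"
  have Nx: "(norm x)\<^sup>2 = (norm z)\<^sup>2 + h\<^sup>2" by (simp add: z_def h_def norm_horizontal)
  have N0: "0 < (norm z)\<^sup>2 + h\<^sup>2" unfolding Nx[symmetric] using x by simp
  have pw: "norm x powr (- s) = ((norm z)\<^sup>2 + h\<^sup>2) powr (- (s / 2))"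
    unfolding Nx[symmetric] using x by (simp add: powr_numeral[symmetric] powr_powr del: powr_numeral)
  let ?N = "(norm z)\<^sup>2 + h\<^sup>2" and ?C = "collapse_const s"
  have C: "5 \<le> ?C" by (rule collapse_const_ge[OF s(1)])
  have r: "(\<integral>\<^sup>+b. riesz s (z + h *\<^sub>R (tilt_scale s *\<^sub>R b)) \<partial>planar_min s)
      \<le> ennreal (?N powr (- (s / 2)) * (1 + ?C * h\<^sup>2 / ?N))"
  proof (cases "\<bar>h\<bar> \<le> norm z / 4")
    case True
    then have "z \<noteq> 0" using N0 by auto
    have "(\<integral>\<^sup>+b. riesz s (z + h *\<^sub>R (tilt_scale s *\<^sub>R b)) \<partial>planar_min s)
      \<le> ennreal (?N powr (- (s / 2)) * (1 + 5 * h\<^sup>2 / ?N))"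
      by (rule averaged_riesz_near_plane[OF s \<open>z \<noteq> 0\<close> True])
    also have "\<dots> \<le> ennreal (?N powr (- (s / 2)) * (1 + ?C * h\<^sup>2 / ?N))"
      using C N0 by (intro ennreal_leI mult_left_mono add_left_mono divide_right_mono mult_right_mono) auto
    finally show ?thesis .
  next
    case False
    then have "(\<integral>\<^sup>+b. riesz s (z + h *\<^sub>R (tilt_scale s *\<^sub>R b)) \<partial>planar_min s)
      \<le> ennreal (?N powr (- (s / 2)) * (?C * h\<^sup>2 / ?N))"
      by (intro averaged_riesz_off_plane[OF s]) simp
    also have "\<dots> \<le> ennreal (?N powr (- (s / 2)) * (1 + ?C * h\<^sup>2 / ?N))"
      by (intro ennreal_leI mult_left_mono) auto
    finally show ?thesis .
  qed
  have "tilted_kernel s (tilt_scale s) x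
     = (\<integral>\<^sup>+b. riesz s (z + h *\<^sub>R (tilt_scale s *\<^sub>R b)) \<partial>planar_min s)
       + (\<integral>\<^sup>+b. ennreal ((norm (z + h *\<^sub>R (tilt_scale s *\<^sub>R b)))\<^sup>2) \<partial>planar_min s)"
    unfolding tilted_kernel_def planar_kernel_def tilt_def z_def[symmetric] h_def[symmetric]
    by (rule nn_integral_add) measurable
  also have "\<dots> \<le> ennreal (?N powr (- (s / 2)) * (1 + ?C * h\<^sup>2 / ?N)) + ennreal ((norm z)\<^sup>2 + h\<^sup>2 / 4)"
    by (intro add_mono r averaged_square[OF s])
  also have "\<dots> = ennreal (?N powr (- (s / 2)) * (1 + ?C * h\<^sup>2 / ?N) + ((norm z)\<^sup>2 + h\<^sup>2 / 4))"
    using C N0 by (intro ennreal_plus[symmetric] mult_nonneg_nonneg add_nonneg_nonneg) auto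
  finally show ?thesis
    unfolding pw Nx z_def[symmetric] h_def[symmetric] .
qed

section \<open>Collapse by comparison\<close>

lemma potential_measurable:
  assumes "continuous_on S2 \<Omega>"
  shows "potential s \<Omega> \<in> borel_measurable borel"
proof -
  have "continuous_on (- {0}) (\<lambda>x::real^3. \<Omega> (x /\<^sub>R norm x))"
    by (rule continuous_on_compose2[OF assms]) (auto intro!: continuous_intros simp: field_simps split: if_splits)
  then have [measurable]: "(\<lambda>x::real^3. indicator (- {0}) x *\<^sub>R \<Omega> (x /\<^sub>R norm x)) \<in> borel_measurable borel"
    by (intro borel_measurable_continuous_on_indicator) auto
  have "potential s \<Omega> = (\<lambda>x. if x = 0 then \<infinity> else
      ennreal (norm x powr (- s) * (indicator (- {0}) x *\<^sub>R \<Omega> (x /\<^sub>R norm x)) + (norm x)\<^sup>2))"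
    by (auto simp: potential_def fun_eq_iff)
  also have "\<dots> \<in> borel_measurable borel" by measurable
  finally show ?thesis .
qed

lemma smooth_on_set_imp_continuous_on:
  assumes "smooth_on_set S f"
  shows "continuous_on S f"
  unfolding continuous_on_eq_continuous_within
proof
  fix x assume x: "x \<in> S"
  then obtain U g where U: "open U" "x \<in> U" "\<And>k. Ck_on k U g" "\<And>y. y \<in> S \<inter> U \<Longrightarrow> g y = f y"
    using assms unfolding smooth_on_set_def by metis
  have "continuous_on U g" using U(3)[of 0] by simp
  then have "continuous_on (S \<inter> U) g" by (rule continuous_on_subset) auto
  then have "continuous_on (S \<inter> U) f"
    using continuous_on_cong[of "S \<inter> U" "S \<inter> U" g f] U(4) by simp
  then have "continuous (at x within S \<inter> U) f"
    using x U(2) by (simp add: continuous_on_eq_continuous_within)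
  moreover have "at x within S \<inter> U = at x within S"
    using U(1,2) by (intro at_within_nhd) auto
  ultimately show "continuous (at x within S) f" by simp
qed

lemma energy_eq_pair_energy: "energy W \<sigma> = 1 / 2 * pair_energy W \<sigma>"
  by (simp add: energy_def pair_energy_def)

lemma energy_le_iff: "energy W \<sigma> \<le> energy W' \<tau> \<longleftrightarrow> pair_energy W \<sigma> \<le> pair_energy W' \<tau>"
proof -
  have "(1 / 2 :: ennreal) = ennreal (1 / 2)"
    using divide_ennreal[of 1 2] by simp
  then show ?thesis
    unfolding energy_eq_pair_energy
    by (subst (1 2) \<open>1 / 2 = ennreal (1 / 2)\<close>, subst ennreal_mult_le_mult_iff)
       (simp_all only: ennreal_eq_0_iff ennreal_neq_top, simp_all)
qed

lemma rho2D_in_borel_prob: "0 < s \<Longrightarrow> s < 2 \<Longrightarrow> rho2D s \<in> borel_prob"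
  unfolding borel_prob_def rho2D_eq
  using prob_space.prob_space_distr[OF prob_space_planar_min, of s embed_plane borel] by simp

lemma pair_energy_rho2D:
  assumes s: "0 < s" "s < 2" and [measurable]: "W \<in> borel_measurable borel"
    and flat: "\<And>x. x $ 3 = 0 \<Longrightarrow> W x = planar_kernel s (horizontal x)"
  shows "pair_energy W (rho2D s) = pair_energy (planar_kernel s) (planar_min s)"
proof -
  interpret prob_space "planar_min s" by (rule prob_space_planar_min[OF s])
  show ?thesis
    unfolding pair_energy_def rho2D_eq
    by (simp add: nn_integral_distr flat horizontal_minus)
qed

text \<open>
  The measure \<open>rho2D s\<close> has the same energy for both potentials, because only differences of points of
  the plane enter; so it minimizes for the larger one as well. If \<open>\<sigma>\<close> attains the same energy, then
  \<open>W\<close> and \<open>W'\<close> agree at almost all differences \<open>x - y\<close>, so almost all points have the same height.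
  Then \<open>\<sigma>\<close> is determined by its horizontal projection, which is a minimizer of the planar problem.
\<close>
theorem collapse_by_comparison:
  assumes s: "0 < s" "s < 2"
    and [measurable]: "W \<in> borel_measurable borel" "W' \<in> borel_measurable borel"
    and le: "\<And>x. W x \<le> W' x" and less: "\<And>x. x $ 3 \<noteq> 0 \<Longrightarrow> W x < W' x"
    and flat: "\<And>x. x $ 3 = 0 \<Longrightarrow> W' x = planar_kernel s (horizontal x)"
    and lower: "\<And>\<sigma>. \<sigma> \<in> borel_prob \<Longrightarrow> pair_energy (planar_kernel s) (planar_min s) \<le> pair_energy W \<sigma>"
  shows "unique_energy_minimizer W' (rho2D s)"
proof -
  let ?E = "pair_energy (planar_kernel s) (planar_min s)"
  have E: "pair_energy W' (rho2D s) = ?E" by (rule pair_energy_rho2D[OF s _ flat]) auto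
  have fin: "?E < \<infinity>" by (rule planar_min_energy(3)[OF s])
  have mono: "pair_energy W \<sigma> \<le> pair_energy W' \<sigma>" for \<sigma>
    unfolding pair_energy_def by (intro nn_integral_mono le)
  have minimizer: "energy_minimizer W' (rho2D s)"
    unfolding energy_minimizer_def energy_le_iff E
    using rho2D_in_borel_prob[OF s] order_trans[OF lower mono] by blast
  have "\<exists>a. \<sigma> = distr (rho2D s) borel (\<lambda>x. x + a)" if \<sigma>: "energy_minimizer W' \<sigma>" for \<sigma>
  proof -
    have p: "prob_space \<sigma>" and b [measurable_cong]: "sets \<sigma> = sets borel" and in_bp: "\<sigma> \<in> borel_prob"
      using \<sigma> by (auto simp: energy_minimizer_def borel_prob_def)
    interpret S: prob_space \<sigma> by fact
    have up: "pair_energy W' \<sigma> \<le> ?E"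
      using \<sigma> rho2D_in_borel_prob[OF s] unfolding energy_minimizer_def energy_le_iff E[symmetric] by blast
    have "AE x in \<sigma>. (\<integral>\<^sup>+y. W' (x - y) \<partial>\<sigma>) = (\<integral>\<^sup>+y. W (x - y) \<partial>\<sigma>)"
    proof (rule nn_integral_le_eq_imp_AE_eq)
      show "(\<integral>\<^sup>+x. (\<integral>\<^sup>+y. W' (x - y) \<partial>\<sigma>) \<partial>\<sigma>) \<le> (\<integral>\<^sup>+x. (\<integral>\<^sup>+y. W (x - y) \<partial>\<sigma>) \<partial>\<sigma>)"
        using order_trans[OF up lower[OF in_bp]] unfolding pair_energy_def .
      show "(\<integral>\<^sup>+x. (\<integral>\<^sup>+y. W (x - y) \<partial>\<sigma>) \<partial>\<sigma>) < \<infinity>"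
        using le_less_trans[OF order_trans[OF mono up] fin] unfolding pair_energy_def .
    qed (auto intro!: nn_integral_mono le)
    moreover have "AE x in \<sigma>. (\<integral>\<^sup>+y. W (x - y) \<partial>\<sigma>) \<noteq> \<infinity>"
      using le_less_trans[OF order_trans[OF mono up] fin] unfolding pair_energy_def
      by (intro nn_integral_PInf_AE) auto
    ultimately have "AE x in \<sigma>. (AE y in \<sigma>. W' (x - y) = W (x - y))"
    proof eventually_elim
      case (elim x)
      then show ?case
        by (intro nn_integral_le_eq_imp_AE_eq) (auto simp: le less_top)
    qed
    then obtain x0 where x0: "AE y in \<sigma>. W' (x0 - y) = W (x0 - y)"
      using S.AE_False by (metis (mono_tags, lifting) eventually_mono)
    define c where "c = x0 $ 3"
    have flat_\<sigma>: "AE y in \<sigma>. y $ 3 = c"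
      using x0
    proof eventually_elim
      case (elim y)
      then have "\<not> W (x0 - y) < W' (x0 - y)" by simp
      then have "(x0 - y) $ 3 = 0" using less by blast
      then show ?case by (simp add: c_def)
    qed
    define \<tau> where "\<tau> = distr \<sigma> borel horizontal"
    have "pair_energy (planar_kernel s) \<tau> = (\<integral>\<^sup>+x. (\<integral>\<^sup>+y. planar_kernel s (horizontal (x - y)) \<partial>\<sigma>) \<partial>\<sigma>)"
      unfolding pair_energy_def \<tau>_def by (simp add: nn_integral_distr horizontal_minus)
    also have "\<dots> = pair_energy W' \<sigma>"
      unfolding pair_energy_def
    proof (rule nn_integral_cong_AE, use flat_\<sigma> in eventually_elim)
      fix x :: "real^3" assume x: "x $ 3 = c"
      show "(\<integral>\<^sup>+y. planar_kernel s (horizontal (x - y)) \<partial>\<sigma>) = (\<integral>\<^sup>+y. W' (x - y) \<partial>\<sigma>)"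
        by (rule nn_integral_cong_AE, use flat_\<sigma> in eventually_elim) (simp add: flat x)
    qed
    also have "\<dots> = ?E" using up order_trans[OF lower[OF in_bp] mono] by (rule antisym)
    finally have "pair_energy (planar_kernel s) \<tau> = ?E" .
    then obtain m where m: "\<tau> = distr (planar_min s) borel (\<lambda>z. z + m)"
      using planar_min_optimal(2)[OF s, of \<tau>] S.prob_space_distr[of horizontal borel] by (auto simp: \<tau>_def)
    define e :: "real^3" where "e = vector [0, 0, c]"
    have "\<sigma> = distr \<sigma> borel (\<lambda>x. x)"
      using b by (simp add: distr_id2)
    also have "\<dots> = distr \<sigma> borel (\<lambda>x. embed_plane (horizontal x) + e)"
    proof (rule distr_cong_AE[OF refl refl], use flat_\<sigma> in eventually_elim)
      fix x :: "real^3" assume "x $ 3 = c"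
      then show "x = embed_plane (horizontal x) + e"
        by (simp add: vec_eq_iff forall_3 embed_plane_def horizontal_def e_def)
    qed auto
    also have "\<dots> = distr \<tau> borel (\<lambda>z. embed_plane z + e)"
      unfolding \<tau>_def by (subst distr_distr) (auto simp: comp_def)
    also have "\<dots> = distr (planar_min s) borel (\<lambda>z. embed_plane (z + m) + e)"
      unfolding m by (subst distr_distr) (auto simp: comp_def)
    also have "(\<lambda>z. embed_plane (z + m) + e) = (\<lambda>z. embed_plane z + (embed_plane m + e))"
      by (simp add: fun_eq_iff vec_eq_iff forall_3 embed_plane_def)
    also have "distr (planar_min s) borel (\<lambda>z. embed_plane z + (embed_plane m + e))
        = distr (rho2D s) borel (\<lambda>x. x + (embed_plane m + e))"
      unfolding rho2D_eq by (subst distr_distr) (auto simp: comp_def)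
    finally show ?thesis by blast
  qed
  with minimizer show ?thesis unfolding unique_energy_minimizer_def by blast
qed

lemma normalized_in_S2: "x \<noteq> 0 \<Longrightarrow> x /\<^sub>R norm x \<in> S2"
  by simp

lemma potential_flat:
  assumes "\<And>v. v \<in> S2 \<Longrightarrow> v $ 3 = 0 \<Longrightarrow> \<Omega> v = 1" and "x $ 3 = 0"
  shows "potential s \<Omega> x = planar_kernel s (horizontal x)"
proof (cases "x = 0")
  case True
  then have "horizontal x = 0" using norm_horizontal_flat[OF assms(2)] by simp
  then show ?thesis using True by (simp add: potential_def planar_kernel_def riesz_def)
next
  case False
  then have "\<Omega> (x /\<^sub>R norm x) = 1" using assms normalized_in_S2 by simp
  moreover have "horizontal x \<noteq> 0" using norm_horizontal_flat[OF assms(2)] False by auto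
  ultimately show ?thesis
    using False norm_horizontal_flat[OF assms(2)]
    by (simp add: potential_def planar_kernel_def riesz_def)
qed

text \<open>
  The averaged tilted kernel is the smaller potential of the comparison; its energy is bounded below
  by the planar minimum.
\<close>
theorem collapse_of_large_anisotropy:
  assumes s: "0 < s" "s < 2" and cont: "continuous_on S2 \<Omega>"
    and ge: "\<And>v. v \<in> S2 \<Longrightarrow> 1 + collapse_const s * (v $ 3)\<^sup>2 \<le> \<Omega> v"
    and eq: "\<And>v. v \<in> S2 \<Longrightarrow> v $ 3 = 0 \<Longrightarrow> \<Omega> v = 1"
  shows "unique_energy_minimizer (potential s \<Omega>) (rho2D s)"
proof (rule collapse_by_comparison[OF s, where W = "tilted_kernel s (tilt_scale s)"])
  let ?W = "tilted_kernel s (tilt_scale s)"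
  have C: "0 \<le> collapse_const s" using collapse_const_ge[OF s(1)] by simp
  have key: "?W x \<le> ennreal (norm x powr (- s) * \<Omega> (x /\<^sub>R norm x) + ((norm (horizontal x))\<^sup>2 + (x $ 3)\<^sup>2 / 4))"
    if x: "x \<noteq> 0" for x
  proof -
    have "(x /\<^sub>R norm x) $ 3 = x $ 3 / norm x" by (simp add: divide_inverse mult.commute)
    then have "1 + collapse_const s * (x $ 3)\<^sup>2 / (norm x)\<^sup>2 \<le> \<Omega> (x /\<^sub>R norm x)"
      using ge[OF normalized_in_S2[OF x]] by (simp add: power_divide)
    then show ?thesis
      by (intro order_trans[OF tilted_kernel_le[OF s x]] ennreal_leI add_right_mono mult_left_mono) auto
  qed
  have \<Omega>pos: "0 \<le> \<Omega> (x /\<^sub>R norm x)" if "x \<noteq> 0" for x :: "real^3"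
  proof -
    have "0 \<le> 1 + collapse_const s * ((x /\<^sub>R norm x) $ 3)\<^sup>2" using C by (intro add_nonneg_nonneg mult_nonneg_nonneg) auto
    also have "\<dots> \<le> \<Omega> (x /\<^sub>R norm x)" by (rule ge[OF normalized_in_S2[OF that]])
    finally show ?thesis .
  qed
  show "?W x \<le> potential s \<Omega> x" for x
  proof (cases "x = 0")
    case False
    have "?W x \<le> ennreal (norm x powr (- s) * \<Omega> (x /\<^sub>R norm x) + (norm x)\<^sup>2)"
      using norm_horizontal[of x] by (intro order_trans[OF key[OF False]] ennreal_leI) auto
    then show ?thesis using False by (simp add: potential_def)
  qed (simp add: potential_def)
  show "?W x < potential s \<Omega> x" if "x $ 3 \<noteq> 0" for x
  proof -
    have x: "x \<noteq> 0" and "0 < (x $ 3)\<^sup>2" using that by auto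
    then have "ennreal (norm x powr (- s) * \<Omega> (x /\<^sub>R norm x) + ((norm (horizontal x))\<^sup>2 + (x $ 3)\<^sup>2 / 4))
       < ennreal (norm x powr (- s) * \<Omega> (x /\<^sub>R norm x) + (norm x)\<^sup>2)"
      using norm_horizontal[of x] \<Omega>pos[OF x] by (intro ennreal_lessI) (auto intro!: add_nonneg_pos)
    then show ?thesis using le_less_trans[OF key[OF x]] x by (simp add: potential_def)
  qed
  show "\<And>\<sigma>. \<sigma> \<in> borel_prob \<Longrightarrow> pair_energy (planar_kernel s) (planar_min s) \<le> pair_energy ?W \<sigma>"
    unfolding borel_prob_def by (auto intro!: tilted_kernel_energy_ge[OF s])
qed (auto intro: potential_measurable[OF cont] potential_flat eq tilted_kernel_measurable[OF s])

text \<open>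
  Here the comparison is between two parameters: the potential does not change on the plane and
  increases strictly off it.
\<close>
theorem collapse_monotone:
  assumes s: "0 < s" "s < 2" and cont: "continuous_on S2 \<omega>" and \<alpha>: "0 \<le> \<alpha>" "\<alpha> < \<beta>"
    and nn: "\<And>v. v \<in> S2 \<Longrightarrow> 0 \<le> \<omega> v"
    and pos: "\<And>v. v \<in> S2 \<Longrightarrow> v $ 3 \<noteq> 0 \<Longrightarrow> 0 < \<omega> v"
    and zero: "\<And>v. v \<in> S2 \<Longrightarrow> v $ 3 = 0 \<Longrightarrow> \<omega> v = 0"
    and minimizer: "energy_minimizer (potential s (\<lambda>x. 1 + \<alpha> * \<omega> x)) (rho2D s)"
  shows "unique_energy_minimizer (potential s (\<lambda>x. 1 + \<beta> * \<omega> x)) (rho2D s)"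
proof -
  have meas [measurable]: "potential s (\<lambda>x. 1 + a * \<omega> x) \<in> borel_measurable borel" for a
    by (intro potential_measurable continuous_intros cont)
  have flat: "potential s (\<lambda>x. 1 + a * \<omega> x) x = planar_kernel s (horizontal x)" if "x $ 3 = 0" for x a
    by (rule potential_flat[OF _ that]) (simp add: zero)
  show ?thesis
  proof (rule collapse_by_comparison[OF s meas meas])
    show "potential s (\<lambda>x. 1 + \<alpha> * \<omega> x) x \<le> potential s (\<lambda>x. 1 + \<beta> * \<omega> x) x" for x
    proof (cases "x = 0")
      case False
      then show ?thesis
        unfolding potential_def using \<alpha> nn[OF normalized_in_S2[OF False]]
        by (auto intro!: ennreal_leI mult_left_mono mult_right_mono)
    qed (simp add: potential_def)
    show "potential s (\<lambda>x. 1 + \<alpha> * \<omega> x) x < potential s (\<lambda>x. 1 + \<beta> * \<omega> x) x" if "x $ 3 \<noteq> 0" for x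
    proof -
      have x: "x \<noteq> 0" using that by auto
      then have p: "0 < \<omega> (x /\<^sub>R norm x)" using that by (intro pos normalized_in_S2) auto
      have "1 + \<alpha> * \<omega> (x /\<^sub>R norm x) < 1 + \<beta> * \<omega> (x /\<^sub>R norm x)" using \<alpha> p by simp
      then have "norm x powr (- s) * (1 + \<alpha> * \<omega> (x /\<^sub>R norm x)) < norm x powr (- s) * (1 + \<beta> * \<omega> (x /\<^sub>R norm x))"
        using x by (intro mult_strict_left_mono) auto
      moreover have "0 \<le> norm x powr (- s) * (1 + \<alpha> * \<omega> (x /\<^sub>R norm x))"
        using \<alpha> p by (intro mult_nonneg_nonneg add_nonneg_nonneg) auto
      ultimately have "ennreal (norm x powr (- s) * (1 + \<alpha> * \<omega> (x /\<^sub>R norm x)) + (norm x)\<^sup>2)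
          < ennreal (norm x powr (- s) * (1 + \<beta> * \<omega> (x /\<^sub>R norm x)) + (norm x)\<^sup>2)"
        by (intro ennreal_lessI add_strict_right_mono add_pos_nonneg) auto
      then show ?thesis using x by (simp add: potential_def del: ennreal_plus)
    qed
    show "potential s (\<lambda>x. 1 + \<beta> * \<omega> x) x = planar_kernel s (horizontal x)" if "x $ 3 = 0" for x
      by (rule flat[OF that])
    show "pair_energy (planar_kernel s) (planar_min s) \<le> pair_energy (potential s (\<lambda>x. 1 + \<alpha> * \<omega> x)) \<sigma>"
      if "\<sigma> \<in> borel_prob" for \<sigma>
    proof -
      have "pair_energy (potential s (\<lambda>x. 1 + \<alpha> * \<omega> x)) (rho2D s) = pair_energy (planar_kernel s) (planar_min s)"
        by (rule pair_energy_rho2D[OF s meas flat])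
      then show ?thesis
        using minimizer that unfolding energy_minimizer_def energy_le_iff by metis
    qed
  qed
qed

section \<open>Escape from the plane for weak anisotropy\<close>

lemma emeasure_planar_min_ball:
  assumes s: "0 < s" "s < 2" and r: "0 \<le> r" and sub: "ball z r \<subseteq> ball 0 (R2 s / 2)"
  shows "ennreal (C2 s * (3 / 4 * (R2 s)\<^sup>2) powr (s / 2) * (pi * r\<^sup>2)) \<le> emeasure (planar_min s) (ball z r)"
proof -
  note pos = planar_consts_pos[OF s]
  let ?d = "C2 s * (3 / 4 * (R2 s)\<^sup>2) powr (s / 2)"
  have d: "?d \<le> rho2 s w" if "w \<in> ball z r" for w
  proof -
    have "norm w \<le> R2 s / 2" using that sub by auto
    then have "(norm w)\<^sup>2 \<le> (R2 s / 2)\<^sup>2" by (intro power_mono) auto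
    then have "3 / 4 * (R2 s)\<^sup>2 \<le> (R2 s)\<^sup>2 - (norm w)\<^sup>2" by (simp add: power_divide)
    then have "3 / 4 * (R2 s)\<^sup>2 \<le> max 0 ((R2 s)\<^sup>2 - (norm w)\<^sup>2)" by (rule order_trans) simp
    then show ?thesis unfolding rho2_def using pos s by (intro mult_left_mono powr_mono2) auto
  qed
  have "ennreal (?d * (pi * r\<^sup>2)) = ennreal ?d * emeasure lborel (ball z r)"
    using pos r by (simp add: emeasure_disc ennreal_mult)
  also have "\<dots> = (\<integral>\<^sup>+w. ennreal ?d * indicator (ball z r) w \<partial>lborel)"
    by (rule nn_integral_cmult_indicator[symmetric]) simp
  also have "\<dots> \<le> (\<integral>\<^sup>+w. ennreal (rho2 s w) * indicator (ball z r) w \<partial>lborel)"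
    using d by (intro nn_integral_mono) (auto simp: indicator_def intro!: ennreal_leI)
  also have "\<dots> = emeasure (planar_min s) (ball z r)"
    unfolding planar_min_def by (simp add: emeasure_density)
  finally show ?thesis .
qed

text \<open>
  The density is bounded below near the centre of the disc, so two independent points are at distance
  at most \<open>H\<close> with probability at least of order \<open>H\<^sup>2\<close>.
\<close>
lemma planar_min_close_pairs:
  assumes s: "0 < s" "s < 2"
  shows "\<exists>c>0. \<forall>H>0. H \<le> R2 s / 4 \<longrightarrow>
    ennreal (c * H\<^sup>2) \<le> (\<integral>\<^sup>+z. (\<integral>\<^sup>+w. indicator {v. norm v \<le> H} (z - w) \<partial>planar_min s) \<partial>planar_min s)"
proof -
  note pos = planar_consts_pos[OF s]
  define d where "d = C2 s * (3 / 4 * (R2 s)\<^sup>2) powr (s / 2)"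
  have d: "0 < d" unfolding d_def using pos by simp
  define c where "c = d * pi * (d * (pi * (R2 s / 4)\<^sup>2))"
  have "ennreal (c * H\<^sup>2) \<le> (\<integral>\<^sup>+z. (\<integral>\<^sup>+w. indicator {v. norm v \<le> H} (z - w) \<partial>planar_min s) \<partial>planar_min s)"
    if H: "0 < H" "H \<le> R2 s / 4" for H
  proof -
    have inner: "ennreal (d * (pi * H\<^sup>2)) * indicator (ball 0 (R2 s / 4)) z
      \<le> (\<integral>\<^sup>+w. indicator {v. norm v \<le> H} (z - w) \<partial>planar_min s)" for z
    proof (cases "z \<in> ball 0 (R2 s / 4)")
      case True
      have "ball z H \<subseteq> ball 0 (R2 s / 2)"
      proof
        fix w assume "w \<in> ball z H"
        then have "norm (w - z) < H" by (simp add: dist_norm norm_minus_commute)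
        then show "w \<in> ball 0 (R2 s / 2)"
          using True H norm_triangle_sub[of w z] by simp
      qed
      then have "ennreal (d * (pi * H\<^sup>2)) \<le> emeasure (planar_min s) (ball z H)"
        unfolding d_def using H by (intro emeasure_planar_min_ball[OF s]) auto
      also have "\<dots> = (\<integral>\<^sup>+w. indicator (ball z H) w \<partial>planar_min s)" by simp
      also have "\<dots> \<le> (\<integral>\<^sup>+w. indicator {v. norm v \<le> H} (z - w) \<partial>planar_min s)"
        by (intro nn_integral_mono) (auto simp: indicator_def dist_norm)
      finally show ?thesis using True by simp
    qed simp
    have "ennreal (c * H\<^sup>2) = ennreal (d * (pi * H\<^sup>2)) * ennreal (d * (pi * (R2 s / 4)\<^sup>2))"
      using d by (subst ennreal_mult[symmetric]) (auto simp: c_def mult_ac)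
    also have "\<dots> \<le> ennreal (d * (pi * H\<^sup>2)) * emeasure (planar_min s) (ball 0 (R2 s / 4))"
      unfolding d_def using pos by (intro mult_left_mono emeasure_planar_min_ball[OF s]) auto
    also have "\<dots> = (\<integral>\<^sup>+z. ennreal (d * (pi * H\<^sup>2)) * indicator (ball 0 (R2 s / 4)) z \<partial>planar_min s)"
      by (rule nn_integral_cmult_indicator[symmetric]) simp
    also have "\<dots> \<le> (\<integral>\<^sup>+z. (\<integral>\<^sup>+w. indicator {v. norm v \<le> H} (z - w) \<partial>planar_min s) \<partial>planar_min s)"
      by (intro nn_integral_mono inner)
    finally show ?thesis .
  qed
  moreover have "0 < c" unfolding c_def using d pos by simp
  ultimately show ?thesis by blast
qed

text \<open>
  Lifting one of two charges by \<open>H\<close> never increases their interaction, and decreases it by an amount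
  of order \<open>H\<^sup>-\<^sup>s\<close> if their horizontal distance is at most \<open>H\<close>.
\<close>
lemma riesz_excess:
  fixes \<zeta> :: "'a::real_normed_vector"
  assumes "0 < s" "0 < H"
  defines "L \<equiv> ((norm \<zeta>)\<^sup>2 + H\<^sup>2) powr (- (s / 2))"
  shows "ennreal L + ennreal ((1 - 2 powr (- (s / 2))) * H powr (- s)) * indicator {v. norm v \<le> H} \<zeta> \<le> riesz s \<zeta>"
proof (cases "\<zeta> = 0")
  case False
  let ?n = "norm \<zeta>"
  have n: "0 < ?n" using False by simp
  have sq: "(?n\<^sup>2) powr (- (s / 2)) = ?n powr (- s)"
    using n by (simp add: powr_numeral[symmetric] powr_powr del: powr_numeral)
  show ?thesis
  proof (cases "?n \<le> H")
    case True
    have "2 * ?n\<^sup>2 \<le> ?n\<^sup>2 + H\<^sup>2" using True n by (simp add: power_mono)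
    then have "L \<le> (2 * ?n\<^sup>2) powr (- (s / 2))"
      unfolding L_def using n assms(1) by (intro powr_mono2') auto
    also have "\<dots> = 2 powr (- (s / 2)) * ?n powr (- s)"
      unfolding sq[symmetric] by (simp add: powr_mult)
    finally have 1: "L \<le> 2 powr (- (s / 2)) * ?n powr (- s)" .
    have k: "0 \<le> 1 - (2::real) powr (- (s / 2))"
      using assms(1) powr_mono[of "- (s / 2)" 0 2] by simp
    have "(1 - 2 powr (- (s / 2))) * H powr (- s) \<le> (1 - 2 powr (- (s / 2))) * ?n powr (- s)"
      using True n assms(1) k by (intro mult_left_mono powr_mono2') auto
    with 1 have "L + (1 - 2 powr (- (s / 2))) * H powr (- s) \<le> ?n powr (- s)"
      by (simp add: algebra_simps)
    then have "ennreal (L + (1 - 2 powr (- (s / 2))) * H powr (- s)) \<le> riesz s \<zeta>"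
      using False by (simp add: riesz_def ennreal_leI del: ennreal_plus)
    then show ?thesis using True k by (simp add: L_def)
  next
    case F: False
    have "L \<le> (?n\<^sup>2) powr (- (s / 2))"
      unfolding L_def using n assms(1) by (intro powr_mono2') auto
    then show ?thesis using F False unfolding sq by (simp add: riesz_def ennreal_leI)
  qed
qed (simp add: riesz_def)

lemma potential_lifted_le:
  assumes "0 < s" "0 < H" and \<alpha>: "0 \<le> \<alpha>" and t: "\<bar>t\<bar> = H"
    and \<omega>: "\<And>v. v \<in> S2 \<Longrightarrow> \<omega> v \<le> M" and M: "0 \<le> M"
  shows "potential s (\<lambda>x. 1 + \<alpha> * \<omega> x) (embed_plane \<zeta> + vector [0, 0, t])
    \<le> ennreal (((norm \<zeta>)\<^sup>2 + H\<^sup>2) powr (- (s / 2)) + (norm \<zeta>)\<^sup>2) + ennreal (\<alpha> * M * H powr (- s) + H\<^sup>2)"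
proof -
  let ?x = "embed_plane \<zeta> + vector [0, 0, t]"
  have x3: "?x $ 3 = t" by simp
  then have x: "?x \<noteq> 0" using t assms(2) by (metis abs_zero less_irrefl zero_index)
  have hx: "horizontal ?x = \<zeta>" by (simp add: horizontal_def embed_plane_def vec_eq_iff forall_2)
  have t2: "t\<^sup>2 = H\<^sup>2" using t assms(2) by (metis power2_abs)
  have n2: "(norm ?x)\<^sup>2 = (norm \<zeta>)\<^sup>2 + H\<^sup>2" unfolding norm_horizontal[of ?x] hx x3 t2 ..
  have pw: "norm ?x powr (- s) = ((norm \<zeta>)\<^sup>2 + H\<^sup>2) powr (- (s / 2))"
    unfolding n2[symmetric] using x by (simp add: powr_numeral[symmetric] powr_powr del: powr_numeral)
  have "H\<^sup>2 \<le> (norm ?x)\<^sup>2" unfolding n2 by simp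
  then have "H \<le> norm ?x" using power2_le_imp_le by fastforce
  then have le: "norm ?x powr (- s) \<le> H powr (- s)" using assms(1,2) by (intro powr_mono2') auto
  have "norm ?x powr (- s) * (\<alpha> * \<omega> (?x /\<^sub>R norm ?x)) \<le> norm ?x powr (- s) * (\<alpha> * M)"
    using \<omega>[OF normalized_in_S2[OF x]] \<alpha> by (intro mult_left_mono) auto
  also have "\<dots> \<le> H powr (- s) * (\<alpha> * M)" using le \<alpha> M by (intro mult_right_mono) auto
  finally have "norm ?x powr (- s) * (1 + \<alpha> * \<omega> (?x /\<^sub>R norm ?x)) + (norm ?x)\<^sup>2
      \<le> (norm ?x powr (- s) + (norm \<zeta>)\<^sup>2) + (\<alpha> * M * H powr (- s) + H\<^sup>2)"
    unfolding n2 by (simp add: algebra_simps)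
  then have "potential s (\<lambda>x. 1 + \<alpha> * \<omega> x) ?x
      \<le> ennreal ((norm ?x powr (- s) + (norm \<zeta>)\<^sup>2) + (\<alpha> * M * H powr (- s) + H\<^sup>2))"
    using x by (simp add: potential_def ennreal_leI del: ennreal_plus)
  also have "\<dots> = ennreal (norm ?x powr (- s) + (norm \<zeta>)\<^sup>2) + ennreal (\<alpha> * M * H powr (- s) + H\<^sup>2)"
    using \<alpha> M by (intro ennreal_plus) auto
  finally show ?thesis unfolding pw .
qed

text \<open>
  Half of the planar minimizer at height \<open>0\<close> and half at height \<open>H\<close>: the height is decided by a fair
  coin independent of the horizontal position.
\<close>
definition split_layer :: "real \<Rightarrow> real \<Rightarrow> (real^3) measure" where
  "split_layer s H = distr (planar_min s \<Otimes>\<^sub>M measure_pmf (bernoulli_pmf (1 / 2))) borel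
     (\<lambda>(z, c). embed_plane z + vector [0, 0, if c then H else 0])"

lemma split_layer_measurable [measurable]:
  "(\<lambda>(z, c). embed_plane z + vector [0, 0, if c then H else 0])
    \<in> borel_measurable (planar_min s \<Otimes>\<^sub>M measure_pmf (bernoulli_pmf (1 / 2)))"
  by measurable

lemma split_layer_in_borel_prob:
  assumes "0 < s" "s < 2"
  shows "split_layer s H \<in> borel_prob"
proof -
  interpret M: prob_space "planar_min s" by (rule prob_space_planar_min[OF assms])
  interpret pair_prob_space "planar_min s" "measure_pmf (bernoulli_pmf (1 / 2))" ..
  show ?thesis unfolding borel_prob_def split_layer_def by (auto intro!: prob_space_distr)
qed

lemma nn_integral_split_layer:
  assumes s: "0 < s" "s < 2" and [measurable]: "f \<in> borel_measurable borel"
  shows "(\<integral>\<^sup>+x. f x \<partial>split_layer s H)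
    = (\<integral>\<^sup>+z. (f (embed_plane z + vector [0, 0, H]) + f (embed_plane z + vector [0, 0, 0])) * ennreal (1 / 2) \<partial>planar_min s)"
proof -
  let ?B = "measure_pmf (bernoulli_pmf (1 / 2))"
  have "(\<integral>\<^sup>+x. f x \<partial>split_layer s H)
     = (\<integral>\<^sup>+p. f (case p of (z, c) \<Rightarrow> embed_plane z + vector [0, 0, if c then H else 0]) \<partial>(planar_min s \<Otimes>\<^sub>M ?B))"
    unfolding split_layer_def by (rule nn_integral_distr) auto
  also have "\<dots> = (\<integral>\<^sup>+z. (\<integral>\<^sup>+c. f (embed_plane z + vector [0, 0, if c then H else 0]) \<partial>?B) \<partial>planar_min s)"
    by (subst measure_pmf.nn_integral_fst[symmetric]) auto
  also have "\<dots> = (\<integral>\<^sup>+z. (f (embed_plane z + vector [0, 0, H]) + f (embed_plane z + vector [0, 0, 0])) * ennreal (1 / 2) \<partial>planar_min s)"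
    by (intro nn_integral_cong) (simp add: distrib_right)
  finally show ?thesis .
qed


text \<open>
  Two points of the split layer are at the same height with probability \<open>1 / 2\<close>; they then interact as
  in the plane, and otherwise through the lifted kernel.
\<close>
lemma pair_energy_split_layer_le:
  assumes s: "0 < s" "s < 2" and [measurable]: "W \<in> borel_measurable borel" "G \<in> borel_measurable borel"
    and flat: "\<And>x. x $ 3 = 0 \<Longrightarrow> W x = planar_kernel s (horizontal x)"
    and lifted: "\<And>\<zeta> t. \<bar>t\<bar> = \<bar>H\<bar> \<Longrightarrow> W (embed_plane \<zeta> + vector [0, 0, t]) \<le> G \<zeta>"
  shows "2 * pair_energy W (split_layer s H)
    \<le> pair_energy (planar_kernel s) (planar_min s) + pair_energy G (planar_min s)"
proof -
  interpret M: prob_space "planar_min s" by (rule prob_space_planar_min[OF s])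
  interpret S: prob_space "split_layer s H"
    using split_layer_in_borel_prob[OF s] by (auto simp: borel_prob_def)
  have [measurable_cong]: "sets (split_layer s H) = sets borel" by (simp add: split_layer_def)
  let ?\<mu> = "planar_min s"
  let ?e = "\<lambda>z t. embed_plane z + vector [0, 0, t] :: real^3"
  have half: "(a + a) * ennreal (1 / 2) = a" for a :: ennreal
  proof -
    have "(a + a) * ennreal (1 / 2) = a * (2 * ennreal (1 / 2))"
      by (simp only: mult_2_right[symmetric] mult.assoc)
    also have "2 * ennreal (1 / 2) = ennreal (2 * (1 / 2))"
      using ennreal_mult[of 2 "1 / 2"] by simp
    finally show ?thesis by simp
  qed
  define J where "J z = (\<integral>\<^sup>+w. (planar_kernel s (z - w) + G (z - w)) * ennreal (1 / 2) \<partial>?\<mu>)" for z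
  have diff: "?e z t - ?e w t' = ?e (z - w) (t - t')" for z w t t'
    by (simp add: vec_eq_iff forall_3 embed_plane_def)
  have zero: "W (?e \<zeta> 0) = planar_kernel s \<zeta>" for \<zeta>
  proof -
    have "horizontal (?e \<zeta> 0) = \<zeta>" by (simp add: horizontal_def embed_plane_def vec_eq_iff forall_2)
    then show ?thesis by (subst flat) simp_all
  qed
  have pt: "(W (?e z t - ?e w H) + W (?e z t - ?e w 0)) * ennreal (1 / 2)
      \<le> (planar_kernel s (z - w) + G (z - w)) * ennreal (1 / 2)" if "t \<in> {0, H}" for z w t
  proof (rule mult_right_mono)
    show "W (?e z t - ?e w H) + W (?e z t - ?e w 0) \<le> planar_kernel s (z - w) + G (z - w)"
    proof (cases "t = H")
      case True
      then show ?thesis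
        unfolding diff using lifted[of H "z - w"] by (simp add: zero[simplified] add_left_mono zero)
    next
      case False
      then have "t = 0" using that by simp
      then show ?thesis
        unfolding diff using lifted[of "- H" "z - w"] by (simp add: zero add.commute add_right_mono)
    qed
  qed simp
  have inner: "(\<integral>\<^sup>+y. W (?e z t - y) \<partial>split_layer s H) \<le> J z" if "t \<in> {0, H}" for z t
    unfolding J_def by (subst nn_integral_split_layer[OF s], measurable) (intro nn_integral_mono pt[OF that])
  have "pair_energy W (split_layer s H)
      = (\<integral>\<^sup>+z. ((\<integral>\<^sup>+y. W (?e z H - y) \<partial>split_layer s H) + (\<integral>\<^sup>+y. W (?e z 0 - y) \<partial>split_layer s H)) * ennreal (1 / 2) \<partial>?\<mu>)"
    unfolding pair_energy_def by (rule nn_integral_split_layer[OF s]) measurable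
  also have "\<dots> \<le> (\<integral>\<^sup>+z. (J z + J z) * ennreal (1 / 2) \<partial>?\<mu>)"
    by (intro nn_integral_mono mult_right_mono add_mono inner) auto
  also have "\<dots> = (\<integral>\<^sup>+z. J z \<partial>?\<mu>)" unfolding half ..
  also have "\<dots> = (pair_energy (planar_kernel s) ?\<mu> + pair_energy G ?\<mu>) * ennreal (1 / 2)"
    unfolding J_def pair_energy_def by (simp add: nn_integral_multc nn_integral_add)
  finally have "2 * pair_energy W (split_layer s H) \<le> 2 * ((pair_energy (planar_kernel s) ?\<mu> + pair_energy G ?\<mu>) * ennreal (1 / 2))"
    by (rule mult_left_mono) simp
  also have "\<dots> = pair_energy (planar_kernel s) ?\<mu> + pair_energy G ?\<mu>"
    by (subst half[symmetric]) (simp add: mult_2 distrib_right)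
  finally show ?thesis .
qed

text \<open>
  Splitting the layer replaces half of the planar energy by the energy across the gap \<open>H\<close>. The gain
  is at least \<open>k c H\<^sup>2\<close>, where \<open>k\<close> is of order \<open>H\<^sup>-\<^sup>s\<close> and \<open>c H\<^sup>2\<close> is the probability of a close pair. The
  cost \<open>g\<close> is \<open>H\<^sup>2\<close> from the confinement and \<open>\<alpha> M H\<^sup>-\<^sup>s\<close> from the anisotropy. The former is negligible
  for small \<open>H\<close>, and the latter for \<open>\<alpha>\<close> small compared with \<open>H\<^sup>2\<close>.
\<close>
theorem not_minimizer_for_small_anisotropy:
  assumes s: "0 < s" "s < 2" and cont: "continuous_on S2 \<omega>"
    and zero: "\<And>v. v \<in> S2 \<Longrightarrow> v $ 3 = 0 \<Longrightarrow> \<omega> v = 0"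
  shows "\<exists>\<alpha>>0. \<not> energy_minimizer (potential s (\<lambda>x. 1 + \<alpha> * \<omega> x)) (rho2D s)"
proof -
  note pos = planar_consts_pos[OF s]
  interpret M: prob_space "planar_min s" by (rule prob_space_planar_min[OF s])
  let ?\<mu> = "planar_min s" and ?E = "pair_energy (planar_kernel s) (planar_min s)"
  have "compact (\<omega> ` S2)" using cont by (intro compact_continuous_image) auto
  then obtain M0 where M0: "\<And>v. v \<in> S2 \<Longrightarrow> norm (\<omega> v) \<le> M0"
    using compact_imp_bounded bounded_iff by (metis (no_types) imageI)
  define M where "M = max 1 M0"
  have M: "0 < M" "\<And>v. v \<in> S2 \<Longrightarrow> \<omega> v \<le> M"
    using M0 by (auto simp: M_def intro: order_trans[OF abs_ge_self] max.coboundedI2)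
  obtain c where c: "0 < c" and close: "\<And>H. 0 < H \<Longrightarrow> H \<le> R2 s / 4 \<Longrightarrow>
      ennreal (c * H\<^sup>2) \<le> (\<integral>\<^sup>+z. (\<integral>\<^sup>+w. indicator {v. norm v \<le> H} (z - w) \<partial>?\<mu>) \<partial>?\<mu>)"
    using planar_min_close_pairs[OF s] by blast
  define \<kappa> where "\<kappa> = 1 - (2::real) powr (- (s / 2))"
  have \<kappa>: "0 < \<kappa>" using s powr_less_mono[of "- (s / 2)" 0 2] by (simp add: \<kappa>_def)
  \<comment> \<open>With these choices of \<open>H\<close> and \<open>\<alpha>\<close> the confinement costs at most half of the gain and the anisotropy a quarter.\<close>
  define H where "H = min (R2 s / 4) ((\<kappa> * c / 2) powr (1 / s))"
  have H: "0 < H" "H \<le> R2 s / 4" using pos \<kappa> c by (auto simp: H_def)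
  have "H powr s \<le> ((\<kappa> * c / 2) powr (1 / s)) powr s"
    using H(1) s by (intro powr_mono2) (auto simp: H_def)
  also have "\<dots> = \<kappa> * c / 2" using s \<kappa> c by (simp add: powr_powr)
  finally have Hs: "H powr s \<le> \<kappa> * c / 2" .
  define \<alpha> where "\<alpha> = \<kappa> * c * H\<^sup>2 / (4 * M)"
  have \<alpha>: "0 < \<alpha>" "\<alpha> * M = \<kappa> * c * H\<^sup>2 / 4" using \<kappa> c H M by (auto simp: \<alpha>_def)
  define g k where "g = \<alpha> * M * H powr (- s) + H\<^sup>2" and "k = \<kappa> * H powr (- s)"
  have gk: "g < k * (c * H\<^sup>2)"
  proof -
    have hh: "H powr (- s) * H powr s = 1" using H by (simp add: powr_add[symmetric])
    have "g = H powr (- s) * (\<kappa> * c * H\<^sup>2 / 4 + H\<^sup>2 * H powr s)"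
      unfolding g_def \<alpha>(2) distrib_left using hh by (simp add: mult.left_commute mult.commute)
    also have "\<dots> \<le> H powr (- s) * (\<kappa> * c * H\<^sup>2 / 4 + H\<^sup>2 * (\<kappa> * c / 2))"
      by (intro mult_left_mono add_left_mono Hs) auto
    also have "\<dots> = 3 / 4 * (k * (c * H\<^sup>2))" by (simp add: k_def algebra_simps)
    also have "\<dots> < k * (c * H\<^sup>2)" using \<kappa> c H by (simp add: k_def)
    finally show ?thesis .
  qed
  have g0: "0 \<le> g" and k0: "0 \<le> k" using \<alpha> M \<kappa> by (auto simp: g_def k_def)
  define L where "L \<zeta> = ennreal (((norm \<zeta>)\<^sup>2 + H\<^sup>2) powr (- (s / 2)) + (norm \<zeta>)\<^sup>2)" for \<zeta> :: "real^2"
  have [measurable]: "L \<in> borel_measurable borel" unfolding L_def by measurable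
  let ?W = "potential s (\<lambda>x. 1 + \<alpha> * \<omega> x)"
  let ?G = "\<lambda>\<zeta>. L \<zeta> + ennreal g"
  have [measurable]: "?W \<in> borel_measurable borel"
    by (intro potential_measurable continuous_intros cont)
  have flat: "?W x = planar_kernel s (horizontal x)" if "x $ 3 = 0" for x
    by (rule potential_flat[OF _ that]) (simp add: zero)
  have two: "2 * pair_energy ?W (split_layer s H) \<le> ?E + pair_energy ?G ?\<mu>"
  proof (rule pair_energy_split_layer_le[OF s _ _ flat])
    fix \<zeta> :: "real^2" and t :: real assume "\<bar>t\<bar> = \<bar>H\<bar>"
    then show "?W (embed_plane \<zeta> + vector [0, 0, t]) \<le> ?G \<zeta>"
      unfolding L_def g_def using H \<alpha> M s by (intro potential_lifted_le) auto
  qed auto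
  have G: "pair_energy ?G ?\<mu> = pair_energy L ?\<mu> + ennreal g"
    unfolding pair_energy_def by (simp add: nn_integral_add M.emeasure_space_1[simplified])
  have "pair_energy L ?\<mu> + ennreal (k * (c * H\<^sup>2)) \<le> pair_energy L ?\<mu>
      + ennreal k * (\<integral>\<^sup>+z. (\<integral>\<^sup>+w. indicator {v. norm v \<le> H} (z - w) \<partial>?\<mu>) \<partial>?\<mu>)"
    using close[OF H] k0 c by (subst ennreal_mult) (auto intro!: add_left_mono mult_left_mono)
  also have "\<dots> = (\<integral>\<^sup>+z. (\<integral>\<^sup>+w. L (z - w) + ennreal k * indicator {v. norm v \<le> H} (z - w) \<partial>?\<mu>) \<partial>?\<mu>)"
    unfolding pair_energy_def by (simp add: nn_integral_add nn_integral_cmult)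
  also have "\<dots> \<le> ?E"
    unfolding pair_energy_def
  proof (intro nn_integral_mono)
    fix z w :: "real^2"
    have "L (z - w) + ennreal k * indicator {v. norm v \<le> H} (z - w)
        = (ennreal (((norm (z - w))\<^sup>2 + H\<^sup>2) powr (- (s / 2))) + ennreal k * indicator {v. norm v \<le> H} (z - w)) + ennreal ((norm (z - w))\<^sup>2)"
      by (simp add: L_def ennreal_plus add_ac)
    also have "\<dots> \<le> planar_kernel s (z - w)"
      unfolding planar_kernel_def k_def \<kappa>_def by (intro add_right_mono riesz_excess s H)
    finally show "L (z - w) + ennreal k * indicator {v. norm v \<le> H} (z - w) \<le> planar_kernel s (z - w)" .
  qed
  finally have EL: "pair_energy L ?\<mu> + ennreal (k * (c * H\<^sup>2)) \<le> ?E" .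
  have fin: "?E < \<infinity>" by (rule planar_min_energy(3)[OF s])
  have Lfin: "pair_energy L ?\<mu> < \<infinity>"
    using le_less_trans[OF EL fin] by simp
  have "pair_energy ?G ?\<mu> < pair_energy L ?\<mu> + ennreal (k * (c * H\<^sup>2))"
    unfolding G using Lfin gk g0 by (simp add: ennreal_add_left_cancel_less ennreal_lessI)
  then have less: "pair_energy ?G ?\<mu> < ?E" using EL by (rule less_le_trans)
  have "\<not> energy_minimizer ?W (rho2D s)"
  proof
    assume "energy_minimizer ?W (rho2D s)"
    then have "pair_energy ?W (rho2D s) \<le> pair_energy ?W (split_layer s H)"
      using split_layer_in_borel_prob[OF s] unfolding energy_minimizer_def energy_le_iff by blast
    also have "pair_energy ?W (rho2D s) = ?E" by (rule pair_energy_rho2D[OF s _ flat]) auto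
    finally have "2 * ?E \<le> 2 * pair_energy ?W (split_layer s H)" by (rule mult_left_mono) simp
    also note two
    finally have "?E + ?E \<le> pair_energy ?G ?\<mu> + ?E" by (simp add: mult_2 add.commute)
    then have "?E \<le> pair_energy ?G ?\<mu>" by (rule ennreal_add_right_le_cancel[OF fin])
    then show False using less by simp
  qed
  with \<alpha>(1) show ?thesis by blast
qed

section \<open>Profiles of axisymmetric functions\<close>

lemma spherical_coordinates:
  assumes "v \<in> S2" "0 \<le> v $ 3"
  obtains \<theta> \<mu> where "\<theta> \<in> {0..pi / 2}" "\<mu> \<in> {0..<2 * pi}" "v = sph \<theta> \<mu>" "cos \<theta> = v $ 3"
proof -
  have n: "(v $ 1)\<^sup>2 + (v $ 2)\<^sup>2 + (v $ 3)\<^sup>2 = 1"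
  proof -
    have "(norm v)\<^sup>2 = 1" using assms(1) by simp
    then show ?thesis
      unfolding power2_norm_eq_inner by (simp add: inner_vec_def sum_3 power2_eq_square)
  qed
  then have le1: "v $ 3 \<le> 1"
    using power2_le_imp_le[of "v $ 3" 1] by (smt (verit) one_power2 zero_le_power2)
  define \<theta> where "\<theta> = arccos (v $ 3)"
  have c: "cos \<theta> = v $ 3" unfolding \<theta>_def using assms(2) le1 by (intro cos_arccos) auto
  have \<theta>: "\<theta> \<in> {0..pi / 2}"
    unfolding \<theta>_def using assms(2) le1 arccos_lbound[of "v $ 3"] arccos_le_pi2[of "v $ 3"] by auto
  then have s0: "0 \<le> sin \<theta>" by (intro sin_ge_zero) auto
  have s2: "(sin \<theta>)\<^sup>2 = (v $ 1)\<^sup>2 + (v $ 2)\<^sup>2" using n sin_squared_eq[of \<theta>] c by simp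
  obtain \<mu> where \<mu>: "\<mu> \<in> {0..<2 * pi}" "v $ 1 = sin \<theta> * cos \<mu>" "v $ 2 = sin \<theta> * sin \<mu>"
  proof (cases "sin \<theta> = 0")
    case True
    then have "v $ 1 = 0" "v $ 2 = 0" using s2 by (auto simp: sum_power2_eq_zero_iff)
    then show ?thesis using that[of 0] True by simp
  next
    case False
    have "(v $ 1 / sin \<theta>)\<^sup>2 + (v $ 2 / sin \<theta>)\<^sup>2 = 1"
      unfolding power_divide add_divide_distrib[symmetric] s2[symmetric] using False by simp
    then obtain t where "0 \<le> t" "t < 2 * pi" "v $ 1 / sin \<theta> = cos t" "v $ 2 / sin \<theta> = sin t"
      by (rule sincos_total_2pi)
    then show ?thesis using that[of t] False by (simp add: field_simps)
  qed
  have "v = sph \<theta> \<mu>" using \<mu> c by (simp add: sph_def vec_eq_iff forall_3)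
  then show ?thesis using that \<theta> \<mu>(1) c by blast
qed

text \<open>Evenness allows a reflection of the point into the upper hemisphere.\<close>
lemma profile_of_point:
  assumes "even_on_S2 f" "axisymmetric f" "v \<in> S2"
  obtains \<theta> where "\<theta> \<in> {0..pi / 2}" "f v = profile f \<theta>" "cos \<theta> = \<bar>v $ 3\<bar>"
proof -
  define u where "u = (if 0 \<le> v $ 3 then v else - v)"
  have u: "u \<in> S2" "0 \<le> u $ 3" "u $ 3 = \<bar>v $ 3\<bar>" using assms(3) by (auto simp: u_def)
  have fu: "f u = f v" using assms(1,3) by (auto simp: u_def even_on_S2_def)
  obtain \<theta> \<mu> where \<theta>: "\<theta> \<in> {0..pi / 2}" "\<mu> \<in> {0..<2 * pi}" "u = sph \<theta> \<mu>" "cos \<theta> = u $ 3"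
    by (rule spherical_coordinates[OF u(1,2)])
  have "0 \<in> {0..<2 * pi}" "\<theta> \<in> {0..pi}" using \<theta>(1) by auto
  then have "f u = profile f \<theta>"
    using assms(2) \<theta>(2) unfolding axisymmetric_def profile_def \<theta>(3) by blast
  then show ?thesis using that \<theta> fu u(3) by metis
qed

text \<open>
  On the unit sphere the squared height is at most the squared angular distance to the equator, which
  converts the hypotheses on profiles into bounds in \<open>x\<^sub>3\<close>.
\<close>
lemma height_le_angle: "(cos \<theta>)\<^sup>2 \<le> \<bar>\<theta> - pi / 2\<bar>\<^sup>2"
proof -
  have "\<bar>cos \<theta>\<bar> \<le> \<bar>pi / 2 - \<theta>\<bar>"
    using abs_sin_x_le_abs_x[of "pi / 2 - \<theta>"] by (simp add: cos_sin_eq)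
  then show ?thesis
    by (metis abs_ge_zero abs_minus_commute power2_abs power_mono)
qed

lemma profile_lower_bound_imp:
  assumes "even_on_S2 f" "axisymmetric f" "v \<in> S2" "0 \<le> C"
    and "\<forall>\<theta>\<in>{0..pi / 2}. profile f \<theta> \<ge> a + C * \<bar>\<theta> - pi / 2\<bar>\<^sup>2"
  shows "a + C * (v $ 3)\<^sup>2 \<le> f v"
proof -
  obtain \<theta> where \<theta>: "\<theta> \<in> {0..pi / 2}" "f v = profile f \<theta>" "cos \<theta> = \<bar>v $ 3\<bar>"
    by (rule profile_of_point[OF assms(1-3)])
  have "C * (v $ 3)\<^sup>2 \<le> C * \<bar>\<theta> - pi / 2\<bar>\<^sup>2"
    using height_le_angle[of \<theta>] assms(4) unfolding \<theta>(3) by (intro mult_left_mono) auto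
  moreover have "a + C * \<bar>\<theta> - pi / 2\<bar>\<^sup>2 \<le> profile f \<theta>" using assms(5) \<theta>(1) by blast
  ultimately show ?thesis using \<theta>(2) by linarith
qed

lemma profile_equator:
  assumes "even_on_S2 f" "axisymmetric f" "v \<in> S2" "v $ 3 = 0"
  shows "f v = profile f (pi / 2)"
proof -
  obtain \<theta> where \<theta>: "\<theta> \<in> {0..pi / 2}" "f v = profile f \<theta>" "cos \<theta> = \<bar>v $ 3\<bar>"
    by (rule profile_of_point[OF assms(1-3)])
  then have "cos \<theta> = cos (pi / 2)" using assms(4) by simp
  then have "\<theta> = pi / 2" by (rule cos_inj_pi[rotated 4]) (use \<theta>(1) in auto)
  with \<theta>(2) show ?thesis by (simp only:)
qed

section \<open>The collapse threshold\<close>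

theorem theorem4p2:
  fixes s :: real
  assumes "0 < s" and "s < 2"
  shows "\<exists>C::real.
    (\<forall>\<Omega> :: real^3 \<Rightarrow> real.
        smooth_on_set S2 \<Omega> \<and> (\<forall>x\<in>S2. 0 < \<Omega> x) \<and> even_on_S2 \<Omega> \<and> axisymmetric \<Omega> \<and>
        (\<forall>x\<in>S2. profile \<Omega> (pi / 2) \<le> \<Omega> x) \<and> profile \<Omega> (pi / 2) = 1 \<and>
        (\<forall>\<theta>\<in>{0..pi / 2}. profile \<Omega> \<theta> \<ge> 1 + C * \<bar>\<theta> - pi / 2\<bar>\<^sup>2)
        \<longrightarrow> unique_energy_minimizer (potential s \<Omega>) (rho2D s)) \<and>
    (\<forall>(\<omega> :: real^3 \<Rightarrow> real) (c :: real).
        smooth_on_set S2 \<omega> \<and> ((\<forall>x\<in>S2. 0 \<le> \<omega> x) \<and> (\<exists>x\<in>S2. \<omega> x = 0)) \<and>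
        even_on_S2 \<omega> \<and> axisymmetric \<omega> \<and>
        (\<forall>x\<in>S2. profile \<omega> (pi / 2) \<le> \<omega> x) \<and> profile \<omega> (pi / 2) = 0 \<and>
        0 < c \<and> (\<forall>\<theta>\<in>{0..pi / 2}. profile \<omega> \<theta> \<ge> c * \<bar>\<theta> - pi / 2\<bar>\<^sup>2)
        \<longrightarrow> (\<exists>!a::real.
              0 < a \<and> a \<le> C / c \<and>
              (\<forall>\<alpha>>a. unique_energy_minimizer (potential s (\<lambda>x. 1 + \<alpha> * \<omega> x)) (rho2D s)) \<and>
              (\<forall>\<alpha>. 0 \<le> \<alpha> \<and> \<alpha> < a \<longrightarrow>
                   \<not> energy_minimizer (potential s (\<lambda>x. 1 + \<alpha> * \<omega> x)) (rho2D s))))"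
proof (intro exI conjI allI impI; elim conjE)
  note s = assms
  let ?C = "collapse_const s"
  have C: "0 < ?C" using collapse_const_ge[OF s(1)] by simp
  {
    fix \<Omega> :: "real^3 \<Rightarrow> real"
    assume *: "smooth_on_set S2 \<Omega>" "even_on_S2 \<Omega>" "axisymmetric \<Omega>" "profile \<Omega> (pi / 2) = 1"
      "\<forall>\<theta>\<in>{0..pi / 2}. profile \<Omega> \<theta> \<ge> 1 + ?C * \<bar>\<theta> - pi / 2\<bar>\<^sup>2"
    show "unique_energy_minimizer (potential s \<Omega>) (rho2D s)"
    proof (rule collapse_of_large_anisotropy[OF s smooth_on_set_imp_continuous_on[OF *(1)]])
      show "1 + ?C * (v $ 3)\<^sup>2 \<le> \<Omega> v" if "v \<in> S2" for v
        using C by (intro profile_lower_bound_imp[OF *(2,3) that _ *(5)]) simp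
      show "\<Omega> v = 1" if "v \<in> S2" "v $ 3 = 0" for v
        using profile_equator[OF *(2,3) that] *(4) by simp
    qed
  }
  fix \<omega> :: "real^3 \<Rightarrow> real" and c :: real
  assume sm: "smooth_on_set S2 \<omega>" and nn: "\<forall>x\<in>S2. 0 \<le> \<omega> x" and ev: "even_on_S2 \<omega>" and ax: "axisymmetric \<omega>"
    and eq0: "profile \<omega> (pi / 2) = 0" and c: "0 < c"
    and quad: "\<forall>\<theta>\<in>{0..pi / 2}. profile \<omega> \<theta> \<ge> c * \<bar>\<theta> - pi / 2\<bar>\<^sup>2"
  let ?W = "\<lambda>\<alpha>. potential s (\<lambda>x. 1 + \<alpha> * \<omega> x)"
  have cont: "continuous_on S2 \<omega>" by (rule smooth_on_set_imp_continuous_on[OF sm])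
  have lower: "c * (v $ 3)\<^sup>2 \<le> \<omega> v" if "v \<in> S2" for v
    using profile_lower_bound_imp[OF ev ax that, of c 0] c quad by simp
  have zero: "\<omega> v = 0" if "v \<in> S2" "v $ 3 = 0" for v
    using profile_equator[OF ev ax that] eq0 by simp
  have pos: "0 < \<omega> v" if "v \<in> S2" "v $ 3 \<noteq> 0" for v
  proof -
    have "0 < c * (v $ 3)\<^sup>2" using c that by simp
    then show ?thesis using lower[OF that(1)] by linarith
  qed
  have mono: "unique_energy_minimizer (?W \<beta>) (rho2D s)"
    if "energy_minimizer (?W \<alpha>) (rho2D s)" "0 \<le> \<alpha>" "\<alpha> < \<beta>" for \<alpha> \<beta>
    using nn by (intro collapse_monotone[OF s cont that(2,3) _ pos zero that(1)]) auto
  define S where "S = {\<alpha>. 0 \<le> \<alpha> \<and> energy_minimizer (?W \<alpha>) (rho2D s)}"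
  have "unique_energy_minimizer (?W (?C / c)) (rho2D s)"
  proof (rule collapse_of_large_anisotropy[OF s])
    show "continuous_on S2 (\<lambda>x. 1 + ?C / c * \<omega> x)" by (intro continuous_intros cont)
    show "1 + ?C * (v $ 3)\<^sup>2 \<le> 1 + ?C / c * \<omega> v" if "v \<in> S2" for v
      using mult_left_mono[OF lower[OF that], of "?C / c"] C c by simp
  qed (simp add: zero)
  then have CS: "?C / c \<in> S" using C c by (simp add: S_def unique_energy_minimizer_def)
  obtain \<alpha>0 where \<alpha>0: "0 < \<alpha>0" "\<not> energy_minimizer (?W \<alpha>0) (rho2D s)"
    using not_minimizer_for_small_anisotropy[OF s cont zero] by blast
  \<comment> \<open>A smaller member of \<open>S\<close> would make \<open>\<alpha>0\<close> a member by monotonicity.\<close>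
  have S_ge: "\<alpha>0 \<le> \<alpha>" if "\<alpha> \<in> S" for \<alpha>
    using that mono[of \<alpha> \<alpha>0] \<alpha>0(2) by (force simp: S_def unique_energy_minimizer_def)
  then have bdd: "bdd_below S" by (rule bdd_belowI)
  define a where "a = Inf S"
  have a_le: "a \<le> ?C / c" unfolding a_def using CS bdd by (rule cInf_lower)
  have a_pos: "0 < a"
    using \<alpha>0(1) cInf_greatest[of S \<alpha>0] CS S_ge by (force simp: a_def)
  have above: "unique_energy_minimizer (?W \<alpha>) (rho2D s)" if "a < \<alpha>" for \<alpha>
  proof -
    have "S \<noteq> {}" using CS by blast
    then have "\<exists>\<beta>\<in>S. \<beta> < \<alpha>"
      using that unfolding a_def by (rule cInf_lessD)
    then obtain \<beta> where "\<beta> \<in> S" "\<beta> < \<alpha>"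
      by blast
    then show ?thesis using mono[of \<beta> \<alpha>] by (simp add: S_def)
  qed
  have below: "\<not> energy_minimizer (?W \<alpha>) (rho2D s)" if "0 \<le> \<alpha>" "\<alpha> < a" for \<alpha>
    using that cInf_lower[OF _ bdd, of \<alpha>] by (auto simp: S_def a_def)
  show "\<exists>!a. 0 < a \<and> a \<le> ?C / c \<and>
      (\<forall>\<alpha>>a. unique_energy_minimizer (?W \<alpha>) (rho2D s)) \<and>
      (\<forall>\<alpha>. 0 \<le> \<alpha> \<and> \<alpha> < a \<longrightarrow> \<not> energy_minimizer (?W \<alpha>) (rho2D s))"
  proof (rule ex1I[of _ a])
    show "0 < a \<and> a \<le> ?C / c \<and>
      (\<forall>\<alpha>>a. unique_energy_minimizer (?W \<alpha>) (rho2D s)) \<and>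
      (\<forall>\<alpha>. 0 \<le> \<alpha> \<and> \<alpha> < a \<longrightarrow> \<not> energy_minimizer (?W \<alpha>) (rho2D s))"
      using a_pos a_le above below by blast
  next
    fix b
    assume b: "0 < b \<and> b \<le> ?C / c \<and>
      (\<forall>\<alpha>>b. unique_energy_minimizer (?W \<alpha>) (rho2D s)) \<and>
      (\<forall>\<alpha>. 0 \<le> \<alpha> \<and> \<alpha> < b \<longrightarrow> \<not> energy_minimizer (?W \<alpha>) (rho2D s))"
    have "\<not> b < a"
    proof
      assume "b < a"
      then have "b < (a + b) / 2" "(a + b) / 2 < a" "0 \<le> (a + b) / 2" using b by auto
      then show False using b below unfolding unique_energy_minimizer_def by blast
    qed
    moreover have "\<not> a < b"
    proof
      assume "a < b"
      then have "a < (a + b) / 2" "(a + b) / 2 < b" "0 \<le> (a + b) / 2" using a_pos by auto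
      then show False using b above unfolding unique_energy_minimizer_def by blast
    qed
    ultimately show "b = a" by simp
  qed
qed

end
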